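(* Every $n$-dimensional cell-like compact metrizable space $X$ can be embedded into the $(2n+1)$-dimensional Euclidean space $\mathbb{R}^{2n+1}$ as a cellular subset; that is, there is a topological embedding $e:X\to\mathbb{R}^{2n+1}$ such that $e(X)$ is a cellular subset of $\mathbb{R}^{2n+1}$.
   Context: Dimension is covering dimension. A compact metrizable space $X$ is cell-like if, for an embedding of $X$ in an absolute neighborhood retract $M$ (for example the Hilbert cube), every neighborhood $U$ of $X$ in $M$ contains a neighborhood $V$ of $X$ such that the inclusion $V\hookrightarrow U$ is homotopic to a constant map (this does not depend on the choice of $M$ or of the embedding; equivalently, $X$ has the shape of a point). A subspace $Y\subset\mathbb{R}^m$ is called cellular if it is the intersection of a nested system of $m$-dimensional topological cubes (subspaces $D^m_i\subset \mathbb{R}^m$ homeomorphic to $[0,1]^m$): $Y=\bigcap_{i=1}^{\infty}D^m_i$, where $D^m_{i+1}\subset\mathrm{int}\,D^m_i$ for all $i$. *)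

theory Defs
  imports "HOL-Analysis.Analysis"
begin

text \<open>
  Covering dimension via finite open covers (the library's \<^const>\<open>dimension_le\<close> is the small
  inductive dimension). The bound is an integer, with
  \<open>- 1 \<le> n\<close>, so that exactly the empty space has dimension \<open>- 1\<close>. The refinement is required
  to be finite because \<^const>\<open>card\<close> is \<open>0\<close> on infinite sets.
\<close>

definition covering_dim_le :: "'a topology \<Rightarrow> int \<Rightarrow> bool" where
  "covering_dim_le X n \<longleftrightarrow>
     - 1 \<le> n \<and>
     (\<forall>\<U>. finite \<U> \<and> (\<forall>U\<in>\<U>. openin X U) \<and> \<Union>\<U> = topspace X \<longrightarrow>
        (\<exists>\<V>. finite \<V> \<and> (\<forall>V\<in>\<V>. openin X V) \<and> \<Union>\<V> = topspace X \<and>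
             (\<forall>V\<in>\<V>. \<exists>U\<in>\<U>. V \<subseteq> U) \<and>
             (\<forall>x\<in>topspace X. int (card {V\<in>\<V>. x \<in> V}) \<le> n + 1)))"

definition has_covering_dim :: "'a topology \<Rightarrow> int \<Rightarrow> bool" where
  "has_covering_dim X n \<longleftrightarrow> covering_dim_le X n \<and> \<not> covering_dim_le X (n - 1)"

definition neighborhood_in :: "'a topology \<Rightarrow> 'a set \<Rightarrow> 'a set \<Rightarrow> bool" where
  "neighborhood_in M S U \<longleftrightarrow>
     U \<subseteq> topspace M \<and> (\<exists>W. openin M W \<and> S \<subseteq> W \<and> W \<subseteq> U)"

text \<open>
  The condition \<open>c \<in> U\<close> makes \<open>\<lambda>x. c\<close> a map into \<open>U\<close> even if \<open>V\<close> is empty; in particular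
  the empty set does not have the following property.
\<close>

definition cell_like_in :: "'a topology \<Rightarrow> 'a set \<Rightarrow> bool" where
  "cell_like_in M S \<longleftrightarrow>
     (\<forall>U. neighborhood_in M S U \<longrightarrow>
        (\<exists>V. neighborhood_in M S V \<and> V \<subseteq> U \<and>
           (\<exists>c\<in>U. homotopic_with (\<lambda>_. True) (subtopology M V) (subtopology M U)
                    (\<lambda>x. x) (\<lambda>x. c))))"

definition Hilbert_cube :: "(nat \<Rightarrow> real) topology" where
  "Hilbert_cube = product_topology (\<lambda>_. top_of_set {0..1}) UNIV"

text \<open>
  The ambient absolute neighborhood retract is taken to be the Hilbert cube, into which every
  compact metrizable space embeds; for such spaces the property depends neither on the ambient
  absolute neighborhood retract nor on the embedding.
\<close>

definition cell_like_space :: "'a topology \<Rightarrow> bool" where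
  "cell_like_space X \<longleftrightarrow>
     (\<exists>e. embedding_map X Hilbert_cube e \<and> cell_like_in Hilbert_cube (e ` topspace X))"

definition cellular :: "'a::euclidean_space set \<Rightarrow> bool" where
  "cellular Y \<longleftrightarrow>
     (\<exists>D :: nat \<Rightarrow> 'a set.
        (\<forall>i. D i homeomorphic cbox (0::'a) One) \<and>
        (\<forall>i. D (Suc i) \<subseteq> interior (D i)) \<and>
        Y = (\<Inter>i. D i))"

end

theory Submission
  imports Defs
begin

text \<open>
  Call a set engulfed in an open set \<open>W\<close> if some ball inside \<open>W\<close>, the image of the
  round ball under a homeomorphism of the whole space, contains it in its interior. In the Baire space of maps
  \<open>X \<rightarrow> \<real>\<^sup>2\<^sup>n\<^sup>+\<^sup>1\<close>, the embeddings form a dense \<open>G\<^sub>\<delta>\<close> by general position, and the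
  maps whose image is engulfed in its \<open>1/k\<close>-neighbourhood form an open set. A map in all of these sets
  is an embedding with cellular image, so what remains is density: an embedded copy \<open>Y\<close> of \<open>X\<close>
  must admit arbitrarily small perturbations with engulfed image.

  For \<open>n \<ge> 2\<close>, contract \<open>Y\<close> in a small neighbourhood and let the vertices of a fine \<open>n\<close>-dimensional
  nerve follow the contraction backwards, one at a time and through generic positions, starting in a small
  ball. The ball is pushed along with the complex. A move sweeps out \<open>(n+1)\<close>-simplices, which cross the
  complex in finitely many points; the vertical segment below such a point has both ends in the complex, and since
  loops near \<open>Y\<close> are null-homotopic, it is first engulfed by a homotopy of polygonal lines,
  whose triangles miss the complex because \<open>2 + n < 2 n + 1\<close>. For \<open>n = 1\<close> the contraction is lifted to a
  tree of reduced walks, and a generic tree is engulfed edge by edge. For \<open>n = 0\<close> the space is a point.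
\<close>

section \<open>Engulfing by pushing along a direction\<close>

text \<open>Working with homeomorphisms of the whole space lets pushes be composed with earlier ones
  and makes the image of the open ball open. Each push fixes the part \<open>A\<close> engulfed so
  far and drags the ball over a set \<open>S\<close> lying above \<open>A\<close>. The criterion for
  its success is that \<open>A \<inter> S\<close> be closed under moving downwards within
  \<open>S\<close>, and every geometric step amounts to checking this by counting vertices. Two
  n-simplices have at most 2n+2 = \<open>DIM('a) + 1\<close> vertices and therefore meet in a common
  face, which is harmless. A swept (n+1)-simplex and an n-simplex may have 2n+3 vertices and cross
  in a point. There the criterion fails, as the points below the crossing belong to \<open>S\<close>
  but not to \<open>A\<close>; putting the vertical segment into \<open>A\<close> restores it. The
  triangle count for that segment requires n >= 2, whence the other argument for n = 1. Shape
  triviality is used in two nested neighbourhoods: the inner contraction provides the motion of the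
  vertices, the outer one the homotopies of paths.\<close>

definition engulfed :: "'a::euclidean_space set \<Rightarrow> 'a set \<Rightarrow> bool" where
  "engulfed W A \<longleftrightarrow>
     (\<exists>(h::'a \<Rightarrow> 'a) g. homeomorphism UNIV UNIV h g \<and> A \<subseteq> h ` ball 0 1 \<and> h ` cball 0 1 \<subseteq> W)"

lemma engulfed_mono: "engulfed W A \<Longrightarrow> B \<subseteq> A \<Longrightarrow> engulfed W B"
  unfolding engulfed_def by blast

lemma engulfed_superset: "engulfed W A \<Longrightarrow> W \<subseteq> W' \<Longrightarrow> engulfed W' A"
  unfolding engulfed_def by blast

text \<open>The displacement has Lipschitz constant 1/2, so preimages are fixed points of a
  contraction, and the map and its inverse are both 2-Lipschitz.\<close>

lemma homeomorphism_shift: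
  fixes e :: "'a::euclidean_space"
  assumes lip: "\<And>x y. \<bar>l x - l y\<bar> * norm e \<le> norm (x - y) / 2"
  obtains g where "homeomorphism UNIV UNIV (\<lambda>x. x + l x *\<^sub>R e) g"
proof -
  let ?f = "\<lambda>x. x + l x *\<^sub>R e"
  have low: "norm (x - y) \<le> 2 * norm (?f x - ?f y)" for x y
  proof -
    have "norm (x - y) = norm ((?f x - ?f y) - (l x - l y) *\<^sub>R e)"
      by (simp add: algebra_simps)
    also have "\<dots> \<le> norm (?f x - ?f y) + norm ((l x - l y) *\<^sub>R e)"
      by (rule norm_triangle_ineq4)
    also have "norm ((l x - l y) *\<^sub>R e) \<le> norm (x - y) / 2"
      using lip[of x y] by simp
    finally show ?thesis by simp
  qed
  have "\<exists>!x. y - l x *\<^sub>R e = x" for y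
  proof (rule banach_fix_type[of "1/2"])
    show "\<forall>x z. dist (y - l x *\<^sub>R e) (y - l z *\<^sub>R e) \<le> 1/2 * dist x z"
    proof (intro allI)
      fix x z
      have "dist (y - l x *\<^sub>R e) (y - l z *\<^sub>R e) = \<bar>l z - l x\<bar> * norm e"
        by (simp add: dist_norm flip: scaleR_left_diff_distrib norm_scaleR)
      also have "\<dots> \<le> 1/2 * dist x z" using lip[of z x] by (simp add: dist_norm norm_minus_commute)
      finally show "dist (y - l x *\<^sub>R e) (y - l z *\<^sub>R e) \<le> 1/2 * dist x z" .
    qed
  qed auto
  then obtain g where g: "\<And>y. y - l (g y) *\<^sub>R e = g y" by metis
  have fg: "?f (g y) = y" for y
    using g[of y] by (metis diff_add_cancel)
  have gf: "g (?f x) = x" for x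
    using low[of "g (?f x)" x] fg[of "?f x"] by simp
  have "continuous_on UNIV ?f"
  proof -
    have "norm (?f x - ?f y) \<le> 2 * norm (x - y)" for x y
    proof -
      have "norm (?f x - ?f y) = norm ((x - y) + (l x - l y) *\<^sub>R e)"
        by (simp add: algebra_simps)
      also have "\<dots> \<le> norm (x - y) + norm ((l x - l y) *\<^sub>R e)"
        by (rule norm_triangle_ineq)
      also have "\<dots> \<le> 2 * norm (x - y)"
        using lip[of x y] norm_ge_zero[of "x - y"] by (simp del: norm_ge_zero)
      finally show ?thesis .
    qed
    then have "2-lipschitz_on UNIV ?f"
      by (intro lipschitz_onI) (auto simp: dist_norm)
    then show ?thesis by (rule lipschitz_on_continuous_on)
  qed
  moreover have "continuous_on UNIV g"
  proof -
    have "2-lipschitz_on UNIV g"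
      using low[of "g x" "g y" for x y] fg by (intro lipschitz_onI) (auto simp: dist_norm)
    then show ?thesis by (rule lipschitz_on_continuous_on)
  qed
  ultimately have "homeomorphism UNIV UNIV ?f g"
    using fg gf by (intro homeomorphismI) auto
  then show thesis by (rule that)
qed

lemma homeomorphism_funpow:
  fixes f g :: "'a::topological_space \<Rightarrow> 'a"
  shows "homeomorphism UNIV UNIV f g \<Longrightarrow> homeomorphism UNIV UNIV (f ^^ N) (g ^^ N)"
proof (induction N)
  case 0
  then show ?case by (auto simp: homeomorphism_def)
next
  case (Suc N)
  show ?case
    unfolding funpow.simps(2)[of N f] funpow_Suc_right[of N g]
    by (rule homeomorphism_compose[OF Suc.IH[OF Suc.prems] Suc.prems])
qed

text \<open>The homeomorphism is an iterate of \<open>z \<mapsto> z + \<lambda>(z) e\<close>, where \<open>\<lambda>\<close> vanishes on \<open>A\<close> and away from \<open>S\<close>.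
  Backward orbits in \<open>S\<close> converge to \<open>A\<close>; the hypothesis that \<open>A \<inter> S\<close> is closed
  under moving downwards makes the number of iterations uniform.\<close>

lemma engulfed_push:
  fixes e :: "'a::euclidean_space"
  assumes eng: "engulfed W A" and "closed A" and "compact S" and "S \<subseteq> W" and "open W"
    and down: "\<And>z. z \<in> S \<Longrightarrow> \<exists>t\<ge>0. z - t *\<^sub>R e \<in> A \<and> (\<forall>u\<in>{0..t}. z - u *\<^sub>R e \<in> S)"
    and closed_down: "\<And>z u. \<lbrakk>z \<in> A; z \<in> S; 0 \<le> u; z - u *\<^sub>R e \<in> S\<rbrakk> \<Longrightarrow> z - u *\<^sub>R e \<in> A"
  shows "engulfed W (A \<union> S)"
proof (cases "S = {} \<or> e = 0")
  case True
  then have "S \<subseteq> A" using down by fastforce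
  then show ?thesis using eng by (simp add: Un_absorb2)
next
  case False
  then have "S \<noteq> {}" and "e \<noteq> 0" by auto
  then have "A \<noteq> {}" using down by blast
  obtain d where "d > 0" and d: "{x. infdist x S \<le> d} \<subseteq> W"
    using compact_in_open_separated[OF \<open>S \<noteq> {}\<close> \<open>compact S\<close> \<open>open W\<close> \<open>S \<subseteq> W\<close>] by metis
  define r where "r = d / 2"
  have "r > 0" using \<open>d > 0\<close> by (simp add: r_def)
  \<comment> \<open>\<open>l\<close> vanishes on \<open>A\<close> and at distance at least
    \<open>r\<close> from \<open>S\<close>. Both distances are 1-Lipschitz, so the divisor
    \<open>2 * norm e\<close> gives the bound of \<open>homeomorphism_shift\<close>. A point within
    \<open>r\<close> of \<open>S\<close> moves by at most \<open>r / 2\<close>, and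
    \<open>r = d / 2\<close> keeps it in \<open>W\<close>.\<close>
  define l where "l z = min (infdist z A) (max 0 (r - infdist z S)) / (2 * norm e)" for z
  have ne: "norm e > 0" using \<open>e \<noteq> 0\<close> by simp
  have l0: "l z \<ge> 0" for z
    by (simp add: l_def infdist_nonneg)
  have lA: "l z = 0" if "z \<in> A" for z
    using that by (simp add: l_def)
  have lip: "\<bar>l x - l y\<bar> * norm e \<le> norm (x - y) / 2" for x y
  proof -
    have "\<bar>min (infdist x A) (max 0 (r - infdist x S)) - min (infdist y A) (max 0 (r - infdist y S))\<bar>
        \<le> norm (x - y)"
      using infdist_triangle_abs[of x A y] infdist_triangle_abs[of x S y] by (simp add: dist_norm)
    then show ?thesis using ne
      by (simp add: l_def abs_divide divide_simps flip: diff_divide_distrib)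
  qed
  define f where "f x = x + l x *\<^sub>R e" for x
  obtain g where fg: "homeomorphism UNIV UNIV f g"
    using homeomorphism_shift[OF lip] unfolding f_def by blast
  have gf: "g (f x) = x" and fg': "f (g x) = x" for x
    using fg unfolding homeomorphism_def by auto
  have contf: "continuous_on UNIV f" using fg unfolding homeomorphism_def by auto
  have fW: "f x \<in> W" if "x \<in> W" for x
  proof (cases "l x = 0")
    case True then show ?thesis using that by (simp add: f_def)
  next
    case False
    then have "infdist x S \<le> r" using infdist_nonneg[of x A] by (auto simp: l_def min_def max_def split: if_splits)
    moreover have "l x * norm e \<le> r / 2"
      using \<open>r > 0\<close> ne infdist_nonneg[of x S] by (simp add: l_def)
    then have "dist (f x) x \<le> r / 2" using l0 by (simp add: f_def dist_norm)
    moreover have "infdist (f x) S \<le> infdist x S + dist (f x) x" by (rule infdist_triangle)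
    ultimately have "infdist (f x) S \<le> d" using \<open>r > 0\<close> by (simp add: r_def)
    then show ?thesis using d by blast
  qed
  have fA: "f x = x" if "x \<in> A" for x using lA[OF that] by (simp add: f_def)
  \<comment> \<open>Moving backwards cannot overshoot the point of \<open>A\<close> below
    \<open>z\<close>: there \<open>l\<close> is zero, so an overshooting step \<open>u\<close> would
    be at most half of the excess \<open>u - t\<close>.\<close>
  have gS: "g z \<in> S" if z: "z \<in> S" for z
  proof -
    obtain t where t: "t \<ge> 0" "z - t *\<^sub>R e \<in> A" "\<forall>u\<in>{0..t}. z - u *\<^sub>R e \<in> S" using down[OF z] by blast
    define u where "u = l (g z)"
    have gz: "g z = z - u *\<^sub>R e" using fg'[of z] by (simp add: f_def u_def algebra_simps)
    have "u \<le> t"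
    proof (rule ccontr)
      assume ut: "\<not> u \<le> t"
      have "g z - (z - t *\<^sub>R e) = - ((u - t) *\<^sub>R e)"
        unfolding gz by (simp add: algebra_simps)
      then have "norm (g z - (z - t *\<^sub>R e)) = (u - t) * norm e"
        using ut by simp
      moreover have "u * norm e \<le> norm (g z - (z - t *\<^sub>R e)) / 2"
        using lip[of "g z" "z - t *\<^sub>R e"] lA[OF t(2)] l0[of "g z"] by (simp add: u_def)
      ultimately have "u * norm e \<le> (u - t) / 2 * norm e" by simp
      then have "u \<le> (u - t) / 2" using ne by (metis mult_le_cancel_right_pos)
      then have "2 * u \<le> u - t" by (simp add: field_simps)
      then show False using ut t(1) by linarith
    qed
    moreover have "u \<ge> 0" unfolding u_def by (rule l0)
    ultimately show ?thesis using t(3) unfolding gz by auto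
  qed
  have gnS: "(g ^^ N) z \<in> S" if "z \<in> S" for z N
    using that by (induction N) (auto simp: gS)
  obtain h h' :: "'a \<Rightarrow> 'a" where h: "homeomorphism UNIV UNIV h h'" "A \<subseteq> h ` ball 0 1" "h ` cball 0 1 \<subseteq> W"
    using eng unfolding engulfed_def by blast
  define B where "B = h ` ball 0 1"
  have "open B" unfolding B_def
    using homeomorphism_imp_open_map[OF h(1), of "ball 0 1"] by simp
  \<comment> \<open>Otherwise points reached backwards outside \<open>B\<close> accumulate at some
    \<open>x\<close> outside \<open>B\<close>. The forward orbit of \<open>x\<close> stays in
    \<open>S\<close>, climbs along \<open>e\<close> and converges to a fixed point in
    \<open>S\<close>, which must lie in \<open>A\<close>; then \<open>closed_down\<close> puts
    \<open>x\<close> in \<open>A\<close>, hence in \<open>B\<close>.\<close>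
  have "\<exists>N. \<forall>z\<in>S. (g ^^ N) z \<in> B"
  proof (rule ccontr)
    assume "\<not> ?thesis"
    then obtain z where z: "\<And>N. z N \<in> S" "\<And>N. (g ^^ N) (z N) \<notin> B" by metis
    define w where "w N = (g ^^ N) (z N)" for N
    have "\<forall>N. w N \<in> S" using gnS z unfolding w_def by auto
    then obtain x s where x: "x \<in> S" "strict_mono s" "(w \<circ> s) \<longlonglongrightarrow> x"
      using \<open>compact S\<close>[unfolded compact_def, THEN spec, of w] by blast
    have "x \<notin> B"
    proof
      assume "x \<in> B"
      then have "eventually (\<lambda>N. (w \<circ> s) N \<in> B) sequentially"
        by (rule topological_tendstoD[OF x(3) \<open>open B\<close>])
      then obtain N where "w (s N) \<in> B" unfolding eventually_sequentially comp_def by blast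
      then show False using z(2) unfolding w_def by blast
    qed
    have fwd: "(f ^^ i) x \<in> S" for i
    proof -
      have "continuous_on UNIV (f ^^ i)"
        using homeomorphism_funpow[OF fg] unfolding homeomorphism_def by blast
      then have lim: "(\<lambda>N. (f ^^ i) ((w \<circ> s) N)) \<longlonglongrightarrow> (f ^^ i) x"
        using x(3) by (rule continuous_on_tendsto_compose) auto
      have "(f ^^ i) ((w \<circ> s) N) \<in> S" if "N \<ge> i" for N
      proof -
        have "s N \<ge> i" using seq_suble[OF x(2), of N] that by linarith
        then have "(g ^^ s N) (z (s N)) = (g ^^ i) ((g ^^ (s N - i)) (z (s N)))"
          using funpow_add[of i "s N - i" g] by (simp add: comp_def)
        moreover have "(f ^^ i) ((g ^^ i) y) = y" for y
          using homeomorphism_apply2[OF homeomorphism_funpow[OF fg, of i]] by simp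
        ultimately show ?thesis using gnS z(1) by (simp add: w_def)
      qed
      then have "eventually (\<lambda>N. (f ^^ i) ((w \<circ> s) N) \<in> S) sequentially"
        unfolding eventually_sequentially by blast
      then show ?thesis
        using Lim_in_closed_set[OF compact_imp_closed[OF \<open>compact S\<close>] _ _ lim] by simp
    qed
    define u where "u i = (\<Sum>j<i. l ((f ^^ j) x))" for i
    have u: "(f ^^ i) x = x + u i *\<^sub>R e" for i
    proof (induction i)
      case (Suc i)
      have "(f ^^ Suc i) x = (f ^^ i) x + l ((f ^^ i) x) *\<^sub>R e" by (simp add: f_def[of "(f ^^ i) x"])
      also have "\<dots> = x + u (Suc i) *\<^sub>R e" unfolding Suc by (simp add: u_def Suc algebra_simps)
      finally show ?case .
    qed (simp add: u_def)
    have "incseq u" unfolding u_def by (intro incseq_SucI) (simp add: l0)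
    obtain b where b: "\<And>y. y \<in> S \<Longrightarrow> norm y \<le> b"
      using compact_imp_bounded[OF \<open>compact S\<close>] unfolding bounded_iff by blast
    have "\<bar>u i\<bar> \<le> 2 * b / norm e" for i
    proof -
      have "norm (u i *\<^sub>R e) = norm ((f ^^ i) x - x)" by (simp add: u)
      also have "\<dots> \<le> norm ((f ^^ i) x) + norm x" by (rule norm_triangle_ineq4)
      also have "\<dots> \<le> 2 * b" using b[OF fwd[of i]] b[OF x(1)] by simp
      finally show ?thesis using ne by (simp add: field_simps)
    qed
    then have "Bseq u" by (intro BseqI') auto
    then obtain v where v: "u \<longlonglongrightarrow> v"
      using Bseq_monoseq_convergent \<open>incseq u\<close> incseq_imp_monoseq convergent_def by blast
    have u0: "u i \<ge> 0" for i by (simp add: u_def sum_nonneg l0)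
    have "v \<ge> 0" using LIMSEQ_le_const[OF v] u0 by blast
    have lim: "(\<lambda>i. (f ^^ i) x) \<longlonglongrightarrow> x + v *\<^sub>R e"
      unfolding u by (intro tendsto_intros v)
    have "x + v *\<^sub>R e \<in> S"
      using Lim_in_closed_set[OF compact_imp_closed[OF \<open>compact S\<close>] _ _ lim] fwd by simp
    have "(\<lambda>i. f ((f ^^ i) x)) \<longlonglongrightarrow> f (x + v *\<^sub>R e)"
      using contf lim by (rule continuous_on_tendsto_compose) auto
    moreover have "(\<lambda>i. f ((f ^^ i) x)) \<longlonglongrightarrow> x + v *\<^sub>R e"
      using LIMSEQ_Suc[OF lim] by simp
    ultimately have "f (x + v *\<^sub>R e) = x + v *\<^sub>R e" by (rule LIMSEQ_unique)
    then have "l (x + v *\<^sub>R e) = 0" using \<open>e \<noteq> 0\<close> by (simp add: f_def)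
    then have "infdist (x + v *\<^sub>R e) A = 0"
      using \<open>x + v *\<^sub>R e \<in> S\<close> \<open>r > 0\<close> ne infdist_nonneg[of "x + v *\<^sub>R e" A]
      by (auto simp: l_def min_def split: if_splits)
    then have "x + v *\<^sub>R e \<in> A"
      using in_closed_iff_infdist_zero[OF \<open>closed A\<close> \<open>A \<noteq> {}\<close>] by blast
    then have "x \<in> A"
      using closed_down[of "x + v *\<^sub>R e" v] \<open>x + v *\<^sub>R e \<in> S\<close> \<open>v \<ge> 0\<close> x(1) by simp
    then show False using \<open>x \<notin> B\<close> h(2) by (auto simp: B_def)
  qed
  then obtain N where N: "\<And>z. z \<in> S \<Longrightarrow> (g ^^ N) z \<in> B" by blast
  have hom: "homeomorphism UNIV UNIV (f ^^ N) (g ^^ N)" by (rule homeomorphism_funpow[OF fg])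
  have "homeomorphism UNIV UNIV ((f ^^ N) \<circ> h) (h' \<circ> (g ^^ N))"
    by (rule homeomorphism_compose[OF h(1) hom])
  moreover have "A \<union> S \<subseteq> ((f ^^ N) \<circ> h) ` ball 0 1"
  proof -
    have "(f ^^ N) a = a" if "a \<in> A" for a using fA[OF that] by (induction N) auto
    then have "a \<in> (f ^^ N) ` B" if "a \<in> A" for a using that h(2) unfolding B_def
      by (metis image_eqI subset_iff)
    moreover have "z \<in> (f ^^ N) ` B" if "z \<in> S" for z
      using N[OF that] hom unfolding homeomorphism_def by (metis UNIV_I image_eqI)
    ultimately show ?thesis unfolding B_def by (auto simp: image_comp)
  qed
  moreover have "((f ^^ N) \<circ> h) ` cball 0 1 \<subseteq> W"
  proof -
    have "(f ^^ N) x \<in> W" if "x \<in> W" for x using that by (induction N) (auto simp: fW)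
    then show ?thesis using h(3) by auto
  qed
  ultimately show ?thesis unfolding engulfed_def by (intro exI conjI)
qed

section \<open>Generic points\<close>

text \<open>\<open>B\<close> is a configuration that cannot be moved, such as the vertices of a
  given complex; affine relations inside it are tolerated. For \<open>B = {}\<close>, any at most
  \<open>DIM('a) + 1\<close> points of \<open>G\<close> are affinely independent.\<close>

definition generic_over :: "'a::euclidean_space set \<Rightarrow> 'a set \<Rightarrow> bool" where
  "generic_over B G \<longleftrightarrow>
     (\<forall>F c. finite F \<and> F \<subseteq> B \<union> G \<and> card F \<le> DIM('a) + 1 \<and> sum c F = (0::real) \<and>
        (\<Sum>x\<in>F. c x *\<^sub>R x) = 0 \<longrightarrow> (\<forall>x\<in>F \<inter> G. c x = 0))"

lemma generic_overD:
  fixes B G :: "'a::euclidean_space set"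
  assumes "generic_over B G" "finite F" "F \<subseteq> B \<union> G" "card F \<le> DIM('a) + 1" "sum c F = 0"
    "(\<Sum>x\<in>F. c x *\<^sub>R x) = 0" "x \<in> F" "x \<in> G"
  shows "c x = 0"
  using assms unfolding generic_over_def by blast

lemma generic_over_mono:
  assumes "generic_over B G" "B' \<subseteq> B" "G' \<subseteq> G"
  shows "generic_over B' G'"
  unfolding generic_over_def
proof (intro allI impI ballI)
  fix F c x
  assume a: "finite F \<and> F \<subseteq> B' \<union> G' \<and> card F \<le> DIM('a) + 1 \<and> sum c F = 0 \<and> (\<Sum>x\<in>F. c x *\<^sub>R x) = 0"
    "x \<in> F \<inter> G'"
  then show "c x = 0" using assms by (intro generic_overD[OF assms(1), of F c x]) auto
qed

text \<open>The new point avoids the affine hulls of all sets of at most \<open>DIM('a)\<close> old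
  points, which are finitely many null sets. A relation giving it nonzero weight would place it in
  such a hull.\<close>

lemma generic_over_insert:
  fixes B G U :: "'a::euclidean_space set"
  assumes gen: "generic_over B G" and fin: "finite B" "finite G" and U: "open U" "U \<noteq> {}"
  obtains g where "g \<in> U" "g \<notin> B \<union> G" "generic_over B (insert g G)"
proof -
  let ?T = "{T. T \<subseteq> B \<union> G \<and> card T \<le> DIM('a)}"
  let ?bad = "\<Union>T\<in>?T. affine hull T"
  have "finite ?T" using fin by simp
  moreover have "negligible (affine hull T)" if "T \<in> ?T" for T
    using that fin empty_interior_affine_hull[of T] finite_subset[of T "B \<union> G"]
      negligible_convex_interior[of "affine hull T"] by (auto simp: affine_imp_convex)
  ultimately have "negligible ?bad" by (intro negligible_Union) auto
  then have "\<not> U \<subseteq> ?bad" using U open_not_negligible negligible_subset by blast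
  then obtain g where g: "g \<in> U" "g \<notin> ?bad" by blast
  have "g \<notin> B \<union> G"
  proof
    assume "g \<in> B \<union> G"
    then have "{g} \<in> ?T" using DIM_positive[where 'a='a] by (simp add: Suc_leI)
    then show False using g(2) by (metis UN_I hull_inc singletonI)
  qed
  moreover have "generic_over B (insert g G)"
    unfolding generic_over_def
  proof (intro allI impI)
    fix F c
    assume F: "finite F \<and> F \<subseteq> B \<union> insert g G \<and> card F \<le> DIM('a) + 1 \<and> sum c F = 0 \<and> (\<Sum>x\<in>F. c x *\<^sub>R x) = 0"
    show "\<forall>x\<in>F \<inter> insert g G. c x = 0"
    proof (cases "g \<in> F")
      case False
      then have "F \<subseteq> B \<union> G" using F by auto
      then show ?thesis using F False generic_overD[OF gen, of F c] by auto
    next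
      case True
      define F' where "F' = F - {g}"
      have F': "finite F'" "F' \<subseteq> B \<union> G" "card F' \<le> DIM('a)" "g \<notin> F'" "F = insert g F'"
        using F True by (auto simp: F'_def)
      have s: "c g + sum c F' = 0" "c g *\<^sub>R g + (\<Sum>x\<in>F'. c x *\<^sub>R x) = 0"
        using F F' by auto
      have "c g = 0"
      proof (rule ccontr)
        assume "c g \<noteq> 0"
        define u where "u x = - c x / c g" for x
        have "sum u F' = 1"
          using s(1) \<open>c g \<noteq> 0\<close> by (simp add: u_def sum_negf flip: sum_divide_distrib)
             (simp add: add_eq_0_iff)
        moreover have "(\<Sum>x\<in>F'. u x *\<^sub>R x) = g"
        proof -
          have "(\<Sum>x\<in>F'. u x *\<^sub>R x) = (- 1 / c g) *\<^sub>R (\<Sum>x\<in>F'. c x *\<^sub>R x)"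
            by (simp add: scaleR_sum_right u_def sum_negf)
          also have "(\<Sum>x\<in>F'. c x *\<^sub>R x) = - (c g *\<^sub>R g)" using s(2) by (simp add: add_eq_0_iff2)
          also have "(- 1 / c g) *\<^sub>R - (c g *\<^sub>R g) = g" using \<open>c g \<noteq> 0\<close> by simp
          finally show ?thesis .
        qed
        ultimately have "g \<in> affine hull F'" using affine_hull_finite[OF F'(1)] by blast
        then show False using g(2) F' by auto
      qed
      moreover have "c x = 0" if "x \<in> F' \<inter> G" for x
        using generic_overD[OF gen F'(1,2), of c x] F' s \<open>c g = 0\<close> that by simp
      ultimately show ?thesis using F' by auto
    qed
  qed
  ultimately show thesis using that g(1) by blast
qed

lemma generic_over_family:
  fixes t :: "'j \<Rightarrow> 'a::euclidean_space"
  assumes "finite J" "finite B" "r > 0"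
  obtains q where "inj_on q J" "q ` J \<inter> B = {}" "\<forall>j\<in>J. dist (q j) (t j) < r"
    "generic_over B (q ` J)"
proof -
  from \<open>finite J\<close> have "\<exists>q. inj_on q J \<and> q ` J \<inter> B = {} \<and> (\<forall>j\<in>J. dist (q j) (t j) < r) \<and> generic_over B (q ` J)"
  proof induction
    case empty
    then show ?case by (auto simp: generic_over_def)
  next
    case (insert i J)
    then obtain q where q: "inj_on q J" "q ` J \<inter> B = {}" "\<forall>j\<in>J. dist (q j) (t j) < r" "generic_over B (q ` J)"
      by blast
    have "ball (t i) r \<noteq> {}" using \<open>r > 0\<close> by auto
    then obtain g where g: "g \<in> ball (t i) r" "g \<notin> B \<union> q ` J" "generic_over B (insert g (q ` J))"
      using generic_over_insert[OF q(4) \<open>finite B\<close> finite_imageI[OF \<open>finite J\<close>] open_ball] by metis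
    have im: "q(i := g) ` insert i J = insert g (q ` J)" using insert.hyps(2) by auto
    have "inj_on (q(i := g)) (insert i J)"
      using q(1) g(2) insert.hyps(2) by (auto simp: inj_on_def)
    moreover have "q(i := g) ` insert i J \<inter> B = {}" "generic_over B (q(i := g) ` insert i J)"
      unfolding im using q g by auto
    moreover have "\<forall>j\<in>insert i J. dist ((q(i := g)) j) (t j) < r"
      using q(3) g(1) by (simp add: dist_commute)
    ultimately show ?case by blast
  qed
  then show thesis using that by blast
qed

section \<open>Barycentric coordinates over generic vertices\<close>

lemma generic_over_coeff_eq:
  fixes B G :: "'a::euclidean_space set"
  assumes gen: "generic_over B G" and F: "finite F" "F \<subseteq> B \<union> G" "card F \<le> DIM('a) + 1"
    and "sum u F = sum w F" "(\<Sum>x\<in>F. u x *\<^sub>R x) = (\<Sum>x\<in>F. w x *\<^sub>R x)" "x \<in> F" "x \<in> G"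
  shows "u x = w x"
proof -
  have "u x - w x = 0"
    using generic_overD[OF gen F, of "\<lambda>x. u x - w x" x] assms
    by (simp add: sum_subtractf scaleR_left_diff_distrib)
  then show ?thesis by simp
qed

lemma sum_if_superset:
  assumes "finite F" "S \<subseteq> F"
  shows "(\<Sum>x\<in>F. if x \<in> S then f x else 0) = sum f S"
  using assms sum.inter_restrict[OF assms(1), of f S] by (simp add: Int_absorb1)

lemma in_convex_hull_superset:
  fixes S :: "'a::real_vector set"
  assumes "finite F" "S \<subseteq> F" "z \<in> convex hull S"
  obtains c where "\<And>x. c x \<ge> 0" "sum c F = 1" "(\<Sum>x\<in>F. c x *\<^sub>R x) = z" "\<And>x. x \<notin> S \<Longrightarrow> c x = 0"
proof -
  have fS: "finite S" using assms finite_subset by blast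
  obtain u where u: "\<And>x. x \<in> S \<Longrightarrow> u x \<ge> 0" "sum u S = 1" "(\<Sum>x\<in>S. u x *\<^sub>R x) = z"
    using assms(3) unfolding convex_hull_finite[OF fS] by blast
  let ?c = "\<lambda>x. if x \<in> S then u x else 0"
  have "sum ?c F = 1" using sum_if_superset[OF assms(1,2), of u] u(2) by simp
  moreover have "(\<Sum>x\<in>F. ?c x *\<^sub>R x) = z"
    using sum_if_superset[OF assms(1,2), of "\<lambda>x. u x *\<^sub>R x"] u(3)
    by (simp add: if_distrib[of "\<lambda>a. a *\<^sub>R _"] cong: if_cong)
  ultimately show thesis using u(1) by (intro that[of ?c]) auto
qed

lemma in_convex_hull_support:
  fixes S :: "'a::real_vector set"
  assumes "finite F" "\<And>x. x \<in> F \<Longrightarrow> c x \<ge> 0" "sum c F = 1" "(\<Sum>x\<in>F. c x *\<^sub>R x) = z"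
    "\<And>x. x \<in> F \<Longrightarrow> x \<notin> S \<Longrightarrow> c x = 0"
  shows "z \<in> convex hull S"
proof -
  have fin: "finite (F \<inter> S)" using assms by simp
  have "sum c (F \<inter> S) = sum c F"
    using assms(1,5) by (intro sum.mono_neutral_left) auto
  moreover have "(\<Sum>x\<in>F \<inter> S. c x *\<^sub>R x) = (\<Sum>x\<in>F. c x *\<^sub>R x)"
    using assms(1,5) by (intro sum.mono_neutral_left) auto
  ultimately have s: "sum c (F \<inter> S) = 1" "(\<Sum>x\<in>F \<inter> S. c x *\<^sub>R x) = z"
    using assms(3,4) by auto
  then have "z \<in> convex hull (F \<inter> S)"
    unfolding convex_hull_finite[OF fin] using assms(2) by auto
  then show ?thesis using hull_mono[of "F \<inter> S" S convex] by auto
qed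

text \<open>The barycentric coordinates of \<open>z\<close> over \<open>S\<close> and over
  \<open>T\<close> agree on \<open>G\<close>, and the latter vanish off \<open>T\<close>. So the
  vertices in \<open>G - T\<close> carry no weight.\<close>

lemma generic_over_remove:
  fixes B G :: "'a::euclidean_space set"
  assumes gen: "generic_over B G" and fin: "finite S" "finite T"
    and sub: "S \<union> T \<subseteq> B \<union> G" and card: "card (S \<union> T) \<le> DIM('a) + 1"
    and z: "z \<in> convex hull S" "z \<in> convex hull T"
  shows "z \<in> convex hull (S - (G - T))"
proof -
  have F: "finite (S \<union> T)" using fin by simp
  obtain c where c: "\<And>x. c x \<ge> 0" "sum c (S \<union> T) = 1" "(\<Sum>x\<in>S \<union> T. c x *\<^sub>R x) = z" "\<And>x. x \<notin> S \<Longrightarrow> c x = 0"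
    using in_convex_hull_superset[OF F _ z(1)] by blast
  obtain d where d: "\<And>x. d x \<ge> 0" "sum d (S \<union> T) = 1" "(\<Sum>x\<in>S \<union> T. d x *\<^sub>R x) = z" "\<And>x. x \<notin> T \<Longrightarrow> d x = 0"
    using in_convex_hull_superset[OF F _ z(2)] by blast
  have "c x = d x" if "x \<in> (S \<union> T) \<inter> G" for x
    using generic_over_coeff_eq[OF gen F sub card, of c d x] c d that by simp
  then show ?thesis
    using c d by (intro in_convex_hull_support[OF F, of c]) auto
qed

lemma generic_convex_hull_Int:
  fixes G :: "'a::euclidean_space set"
  assumes gen: "generic_over {} G" and "finite S" "finite T"
    and "S \<union> T \<subseteq> G" and "card (S \<union> T) \<le> DIM('a) + 1"
    and z: "z \<in> convex hull S" "z \<in> convex hull T"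
  shows "z \<in> convex hull (S \<inter> T)"
proof -
  have "S - (G - T) = S \<inter> T" using assms by auto
  then show ?thesis using generic_over_remove[of "{}" G S T z] assms by simp
qed

text \<open>Once the coefficients on \<open>G\<close> vanish, a relation involves only
  \<open>a\<close> and \<open>b\<close>, which are affinely independent. The fixed ends of a
  polygonal line may thus be counted as generic together with its inner vertices.\<close>

lemma generic_over_two_points:
  fixes B G :: "'a::euclidean_space set"
  assumes gen: "generic_over B G" and ab: "a \<noteq> b" "{a, b} \<subseteq> B"
  shows "generic_over {} (insert a (insert b G))"
  unfolding generic_over_def
proof (intro allI impI ballI)
  fix F c x
  assume A: "finite F \<and> F \<subseteq> {} \<union> insert a (insert b G) \<and> card F \<le> DIM('a) + 1 \<and> sum c F = 0 \<and>
           (\<Sum>x\<in>F. c x *\<^sub>R x) = 0" and x: "x \<in> F \<inter> insert a (insert b G)"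
  have G0: "c y = 0" if "y \<in> F" "y \<in> G" for y
    using generic_overD[OF gen, of F c y] A ab that by auto
  have F2: "F \<inter> ({a, b} - G) \<subseteq> F" by auto
  have s: "sum c (F \<inter> ({a, b} - G)) = 0" "(\<Sum>x\<in>F \<inter> ({a, b} - G). c x *\<^sub>R x) = 0"
    using A G0 sum.mono_neutral_left[of F "F \<inter> ({a, b} - G)" c]
      sum.mono_neutral_left[of F "F \<inter> ({a, b} - G)" "\<lambda>x. c x *\<^sub>R x"] by auto
  show "c x = 0"
  proof (cases "x \<in> G")
    case True then show ?thesis using G0 x by auto
  next
    case False
    then have xab: "x \<in> F \<inter> ({a, b} - G)" using x by auto
    consider "F \<inter> ({a, b} - G) = {x}" | "F \<inter> ({a, b} - G) = {a, b}" using xab by blast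
    then show ?thesis
    proof cases
      case 1 then show ?thesis using s by simp
    next
      case 2
      then have "c a + c b = 0" "c a *\<^sub>R a + c b *\<^sub>R b = 0" using s ab by auto
      moreover from this(1) have cb: "c b = - c a" by simp
      ultimately have "c a *\<^sub>R (a - b) = 0" by (simp add: algebra_simps)
      then show ?thesis using ab(1) xab 2 cb by auto
    qed
  qed
qed

text \<open>Each common point yields an affine relation on \<open>S \<union> T\<close> whose weights
  on \<open>S\<close> sum to one. Eliminating one vertex from two such relations leaves a relation
  on \<open>DIM('a) + 1\<close> points, hence a trivial one; so the two are proportional, and the
  normalisation makes them equal.\<close>

lemma generic_crossing_unique:
  fixes G :: "'a::euclidean_space set"
  assumes gen: "generic_over {} G" and fin: "finite S" "finite T" and sub: "S \<union> T \<subseteq> G"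
    and disj: "S \<inter> T = {}" and card: "card (S \<union> T) = DIM('a) + 2"
    and z: "y \<in> convex hull S" "y \<in> convex hull T" "z \<in> convex hull S" "z \<in> convex hull T"
  shows "y = z"
proof -
  have F: "finite (S \<union> T)" using fin by simp
  have rel: "\<exists>c. sum c (S \<union> T) = 0 \<and> (\<Sum>x\<in>S \<union> T. c x *\<^sub>R x) = 0 \<and> sum c S = 1 \<and> (\<Sum>x\<in>S. c x *\<^sub>R x) = p"
    if p: "p \<in> convex hull S" "p \<in> convex hull T" for p
  proof -
    obtain u where u: "sum u S = 1" "(\<Sum>x\<in>S. u x *\<^sub>R x) = p"
      using p(1) unfolding convex_hull_finite[OF fin(1)] by blast
    obtain w where w: "sum w T = 1" "(\<Sum>x\<in>T. w x *\<^sub>R x) = p"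
      using p(2) unfolding convex_hull_finite[OF fin(2)] by blast
    define c where "c x = (if x \<in> S then u x else - w x)" for x
    have S: "sum c S = 1" "(\<Sum>x\<in>S. c x *\<^sub>R x) = p" using u by (simp_all add: c_def)
    have "sum c T = sum (\<lambda>x. - w x) T" "(\<Sum>x\<in>T. c x *\<^sub>R x) = (\<Sum>x\<in>T. - (w x *\<^sub>R x))"
      using disj by (auto simp: c_def intro!: sum.cong)
    then have "sum c T = - 1" "(\<Sum>x\<in>T. c x *\<^sub>R x) = - p" using w by (simp_all add: sum_negf)
    then show ?thesis using S fin disj by (intro exI[of _ c]) (simp add: sum.union_disjoint)
  qed
  obtain c where c: "sum c (S \<union> T) = 0" "(\<Sum>x\<in>S \<union> T. c x *\<^sub>R x) = 0" "sum c S = 1" "(\<Sum>x\<in>S. c x *\<^sub>R x) = y"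
    using rel z by blast
  obtain d where d: "sum d (S \<union> T) = 0" "(\<Sum>x\<in>S \<union> T. d x *\<^sub>R x) = 0" "sum d S = 1" "(\<Sum>x\<in>S. d x *\<^sub>R x) = z"
    using rel z by blast
  obtain s where s: "s \<in> S" "c s \<noteq> 0" using c(3) by (metis sum.neutral zero_neq_one)
  define k where "k x = d s * c x - c s * d x" for x
  let ?F = "S \<union> T - {s}"
  have ks: "k s = 0" by (simp add: k_def)
  have "sum k (S \<union> T) = 0" "(\<Sum>x\<in>S \<union> T. k x *\<^sub>R x) = 0"
    using c d by (simp_all add: k_def sum_subtractf scaleR_left_diff_distrib
        flip: sum_distrib_left scaleR_scaleR scaleR_sum_right)
  then have k: "sum k ?F = 0" "(\<Sum>x\<in>?F. k x *\<^sub>R x) = 0"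
    using sum.remove[of "S \<union> T" s k] sum.remove[of "S \<union> T" s "\<lambda>x. k x *\<^sub>R x"] F s ks by auto
  have "card ?F \<le> DIM('a) + 1" using card F s by simp
  then have k0: "k x = 0" if "x \<in> ?F" for x
    using generic_overD[OF gen, of ?F k x] F sub k that by auto
  then have k0: "k x = 0" if "x \<in> S" for x using ks that by (cases "x = s") auto
  have "d s * sum c S - c s * sum d S = sum k S"
    by (simp add: k_def sum_subtractf flip: sum_distrib_left)
  also have "\<dots> = 0" using k0 by simp
  finally have "d s = c s" using c d by simp
  then have "c x = d x" if "x \<in> S" for x using k0[OF that] s by (simp add: k_def)
  then show ?thesis using c d by (metis (no_types, lifting) sum.cong)
qed

section \<open>Sweeping simplices and polygonal lines\<close>

text \<open>Neither closure under faces nor affine independence is demanded, so any set of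
  generating simplices, possibly degenerate, describes the polyhedron.\<close>

definition body :: "'a::real_vector set set \<Rightarrow> 'a set" where
  "body \<A> = (\<Union>s\<in>\<A>. convex hull s)"

lemma compact_body:
  fixes \<A> :: "'a::euclidean_space set set"
  assumes "finite \<A>" "\<And>s. s \<in> \<A> \<Longrightarrow> finite s"
  shows "compact (body \<A>)"
  unfolding body_def using assms by (intro compact_UN finite_imp_compact_convex_hull) auto

text \<open>Weight is transferred from \<open>w\<close> to \<open>v\<close>; the point reaches
  \<open>convex hull s\<close> once the whole weight of \<open>w\<close> has been moved.\<close>

lemma convex_hull_insert_down:
  fixes v w :: "'a::real_vector"
  assumes "finite s" "v \<in> s" "w \<notin> s" and z: "z \<in> convex hull (insert w s)"
  shows "\<exists>t\<ge>0. z - t *\<^sub>R (w - v) \<in> convex hull s \<and>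
    (\<forall>u\<in>{0..t}. z - u *\<^sub>R (w - v) \<in> convex hull (insert w s))"
proof -
  have fin: "finite (insert w s)" using assms by simp
  obtain c where c: "\<And>x. c x \<ge> 0" "sum c (insert w s) = 1" "(\<Sum>x\<in>insert w s. c x *\<^sub>R x) = z"
    using in_convex_hull_superset[OF fin subset_refl z] by blast
  have dn: "z - u *\<^sub>R (w - v) \<in> convex hull X" if u: "0 \<le> u" "u \<le> c w"
    and X: "w \<in> X \<or> u = c w" "s \<subseteq> X" for u X
  proof (rule in_convex_hull_support[OF fin])
    let ?d = "\<lambda>x. c x + (if x = v then u else 0) - (if x = w then u else 0)"
    show "?d x \<ge> 0" if "x \<in> insert w s" for x using c(1)[of x] u assms(2,3) by auto
    show "sum ?d (insert w s) = 1"
      using c(2) fin assms(2) by (simp add: sum.distrib sum_subtractf)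
    show "(\<Sum>x\<in>insert w s. ?d x *\<^sub>R x) = z - u *\<^sub>R (w - v)"
      using c(3) fin assms(2)
      by (simp add: scaleR_add_left scaleR_diff_left sum.distrib sum_subtractf scaleR_diff_right
          if_distrib[of "\<lambda>a. a *\<^sub>R _"] del: sum.insert sum.insert_if cong: if_cong)
    show "?d x = 0" if "x \<in> insert w s" "x \<notin> X" for x
      using that X assms(2) by auto
  qed
  show ?thesis
  proof (intro exI[of _ "c w"] conjI ballI)
    show "c w \<ge> 0" by (rule c(1))
    show "z - c w *\<^sub>R (w - v) \<in> convex hull s" using dn[of "c w" s] c(1) by simp
    show "z - u *\<^sub>R (w - v) \<in> convex hull insert w s" if "u \<in> {0..c w}" for u
      using dn[of u "insert w s"] that by auto
  qed
qed

text \<open>A point of \<open>convex hull s\<close> has weight zero at \<open>w\<close>, and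
  descending by \<open>u\<close> lowers this weight to \<open>- u\<close>. By genericity the weight
  is well defined, and in \<open>convex hull (insert w t)\<close> it is nonnegative.\<close>

lemma generic_no_descent:
  fixes v w :: "'a::euclidean_space"
  assumes gen: "generic_over {} G" and fin: "finite s" "finite t"
    and sub: "insert w (s \<union> t) \<subseteq> G" and card: "card (insert w (s \<union> t)) \<le> DIM('a) + 1"
    and v: "v \<in> t" "v \<noteq> w" and w: "w \<notin> s" and z: "z \<in> convex hull s"
    and u: "0 \<le> u" "z - u *\<^sub>R (w - v) \<in> convex hull (insert w t)"
  shows "u = 0"
proof -
  let ?F = "insert w (s \<union> t)"
  have F: "finite ?F" and sF: "s \<subseteq> ?F" and tF: "insert w t \<subseteq> ?F" using fin by auto
  obtain c where c: "\<And>x. c x \<ge> 0" "sum c ?F = 1" "(\<Sum>x\<in>?F. c x *\<^sub>R x) = z" "\<And>x. x \<notin> s \<Longrightarrow> c x = 0"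
    using in_convex_hull_superset[OF F sF z] by metis
  obtain d where d: "\<And>x. d x \<ge> 0" "sum d ?F = 1" "(\<Sum>x\<in>?F. d x *\<^sub>R x) = z - u *\<^sub>R (w - v)"
    using in_convex_hull_superset[OF F tF u(2)] by metis
  define d' where "d' x = d x + (if x = w then u else 0) - (if x = v then u else 0)" for x
  have "sum d' ?F = 1"
    using d(2) F v by (simp add: d'_def sum.distrib sum_subtractf del: sum.insert sum.insert_if)
  moreover have "(\<Sum>x\<in>?F. d' x *\<^sub>R x) = z"
    using d(3) F v
    by (simp add: d'_def scaleR_add_left scaleR_diff_left sum.distrib sum_subtractf scaleR_diff_right
        if_distrib[of "\<lambda>a. a *\<^sub>R _"] del: sum.insert sum.insert_if cong: if_cong)
  ultimately have "c w = d' w"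
    using generic_over_coeff_eq[OF gen F _ card, of c d' w] sub c by auto
  then show ?thesis using c(4)[OF w] d(1)[of w] u(1) v(2) by (simp add: d'_def)
qed

text \<open>This is \<open>engulfed_push\<close> in direction \<open>w - v\<close>: the cone from
  \<open>w\<close> over a simplex containing \<open>v\<close> lies above that simplex. Only
  \<open>closed_down\<close> depends on how the cones meet the rest of \<open>A\<close>.\<close>

lemma engulfed_sweep:
  fixes v w :: "'a::euclidean_space"
  assumes "engulfed W A" "closed A" "open W" "finite \<K>"
    and \<K>: "\<And>s. s \<in> \<K> \<Longrightarrow> finite s \<and> v \<in> s \<and> w \<notin> s"
    and A: "\<And>s. s \<in> \<K> \<Longrightarrow> convex hull s \<subseteq> A"
    and W: "\<And>s. s \<in> \<K> \<Longrightarrow> convex hull (insert w s) \<subseteq> W"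
    and closed_down: "\<And>s t z u. \<lbrakk>s \<in> \<K>; t \<in> \<K>; z \<in> A; z \<in> convex hull (insert w s); 0 \<le> u;
        z - u *\<^sub>R (w - v) \<in> convex hull (insert w t)\<rbrakk> \<Longrightarrow> z - u *\<^sub>R (w - v) \<in> A"
  shows "engulfed W (A \<union> (\<Union>s\<in>\<K>. convex hull (insert w s)))"
proof (rule engulfed_push[where e = "w - v"])
  show "compact (\<Union>s\<in>\<K>. convex hull insert w s)"
    using \<open>finite \<K>\<close> \<K> by (intro compact_UN finite_imp_compact_convex_hull) auto
  show "(\<Union>s\<in>\<K>. convex hull insert w s) \<subseteq> W" using W by auto
  show "\<exists>t\<ge>0. z - t *\<^sub>R (w - v) \<in> A \<and> (\<forall>u\<in>{0..t}. z - u *\<^sub>R (w - v) \<in> (\<Union>s\<in>\<K>. convex hull insert w s))"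
    if z: "z \<in> (\<Union>s\<in>\<K>. convex hull insert w s)" for z
  proof -
    obtain s where s: "s \<in> \<K>" "z \<in> convex hull insert w s" using z by blast
    show ?thesis using convex_hull_insert_down[of s v w z] \<K>[OF s(1)] A[OF s(1)] s by blast
  qed
  show "z - u *\<^sub>R (w - v) \<in> A"
    if "z \<in> A" "z \<in> (\<Union>s\<in>\<K>. convex hull insert w s)" "0 \<le> u"
      "z - u *\<^sub>R (w - v) \<in> (\<Union>s\<in>\<K>. convex hull insert w s)" for z u
    using closed_down that by blast
qed (use assms in auto)

text \<open>Only edges count: a list with one vertex gives the empty set, which keeps the rule for
  splitting at a shared vertex free of exceptions.\<close>

fun polyline :: "'a::real_vector list \<Rightarrow> 'a set" where
  "polyline (x # y # zs) = closed_segment x y \<union> polyline (y # zs)"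
| "polyline _ = {}"

lemma polyline_append: "polyline (xs @ x # ys) = polyline (xs @ [x]) \<union> polyline (x # ys)"
proof (induction xs)
  case (Cons a xs)
  then show ?case by (cases xs) auto
qed simp

lemma in_polylineE:
  assumes "z \<in> polyline xs"
  obtains x y where "x \<in> set xs" "y \<in> set xs" "z \<in> closed_segment x y"
  using assms by (induction xs rule: polyline.induct) auto

lemma compact_polyline: "compact (polyline (xs :: 'a::euclidean_space list))"
  by (induction xs rule: polyline.induct) auto

text \<open>A triangle and an edge have at most five vertices together, within
  \<open>DIM('a) + 1\<close>, so they meet in the hull of their common vertices. Each of the two
  pieces shares only one vertex with the triangle.\<close>

lemma triangle_Int_polyline:
  fixes G :: "'a::euclidean_space set"
  assumes gen: "generic_over {} G" and dim: "4 \<le> DIM('a)"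
    and L: "distinct (L @ l # v # r # M)" "set (L @ l # v # r # M) \<subseteq> G"
    and z: "z \<in> convex hull {l, v, r}" "z \<in> polyline (L @ [l]) \<union> polyline (r # M)"
  shows "z \<in> {l, r}"
proof -
  have *: "z \<in> {p}" if N: "z \<in> polyline N" "set N \<subseteq> G" "set N \<inter> {l, v, r} \<subseteq> {p}" for N p
  proof -
    obtain x y where xy: "x \<in> set N" "y \<in> set N" "z \<in> closed_segment x y"
      using N(1) by (rule in_polylineE)
    have "card ({l, v, r} \<union> {x, y}) \<le> card {l, v, r} + card {x, y}" by (rule card_Un_le)
    also have "\<dots> \<le> 3 + 2" by (intro add_mono) (auto simp: card_insert_if)
    finally have "card ({l, v, r} \<union> {x, y}) \<le> DIM('a) + 1" using dim by simp
    then have "z \<in> convex hull ({l, v, r} \<inter> {x, y})"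
      using generic_convex_hull_Int[OF gen, of "{l, v, r}" "{x, y}" z] L(2) xy z(1) N(2)
      by (auto simp: segment_convex_hull)
    moreover have "{l, v, r} \<inter> {x, y} \<subseteq> {p}" using xy N(3) by auto
    then have "convex hull ({l, v, r} \<inter> {x, y}) \<subseteq> convex hull {p}" by (rule hull_mono)
    ultimately show ?thesis by auto
  qed
  show ?thesis using z(2) *[of "L @ [l]" l] *[of "r # M" r] L by auto
qed

text \<open>The bound on \<open>card s\<close> leaves room for three more vertices within
  \<open>DIM('a) + 1\<close>, so a meeting point has no weight on the generic vertices of the
  triangle.\<close>

lemma triangle_Int_body:
  fixes B G :: "'a::euclidean_space set"
  assumes gen: "generic_over B G" and disj: "B \<inter> G = {}"
    and \<A>: "\<And>s. s \<in> \<A> \<Longrightarrow> finite s \<and> card s + 2 \<le> DIM('a) \<and> s \<subseteq> B"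
    and T: "{l, v, r} \<subseteq> B \<union> G"
    and z: "z \<in> convex hull {l, v, r}" "z \<in> body \<A>"
  shows "z \<in> convex hull ({l, v, r} - G)"
proof -
  obtain s where s: "s \<in> \<A>" "z \<in> convex hull s" using z(2) by (auto simp: body_def)
  have "card ({l, v, r} \<union> s) \<le> card {l, v, r} + card s" by (rule card_Un_le)
  also have "\<dots> \<le> 3 + card s" by (intro add_mono) (auto simp: card_insert_if)
  finally have "card ({l, v, r} \<union> s) \<le> DIM('a) + 1" using \<A>[OF s(1)] by linarith
  then have "z \<in> convex hull ({l, v, r} - (G - s))"
    using generic_over_remove[OF gen, of "{l, v, r}" s z] \<A>[OF s(1)] T z(1) s(2) by auto
  moreover have "G - s = G" using \<A>[OF s(1)] disj by auto
  ultimately show ?thesis by simp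
qed

section \<open>Elementary moves of a polygonal line across a triangle\<close>

context
  fixes W :: "'a::euclidean_space set" and \<A> :: "'a set set" and B G :: "'a set" and a b :: 'a
  assumes W: "open W" and fin: "finite \<A>"
    and \<A>: "\<And>s. s \<in> \<A> \<Longrightarrow> finite s \<and> card s + 2 \<le> DIM('a) \<and> s \<subseteq> B"
    and dim: "4 \<le> DIM('a)" and gen: "generic_over B G" and disj: "B \<inter> G = {}"
    and ab: "a \<noteq> b" "{a, b} \<subseteq> B"
begin

lemma closed_body_polyline: "closed (body \<A> \<union> polyline L)"
  using compact_body[of \<A>] fin \<A> compact_polyline by (intro closed_Un compact_imp_closed) auto

lemma generic_ab: "generic_over {} (insert a (insert b G))"
  by (rule generic_over_two_points[OF gen ab])

text \<open>By general position the triangle meets the engulfed set only in the edge from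
  \<open>l\<close> to \<open>r\<close>. No point of this edge can descend along \<open>v - l\<close>
  within the triangle, so the sweep is unobstructed.\<close>

lemma engulfed_polyline_insert:
  assumes eng: "engulfed W (body \<A> \<union> polyline (L @ l # r # M))"
    and L: "distinct (L @ l # v # r # M)" "set (L @ l # v # r # M) \<subseteq> insert a (insert b G)"
    and v: "v \<in> G" and tri: "convex hull {l, v, r} \<subseteq> W"
  shows "engulfed W (body \<A> \<union> polyline (L @ l # v # r # M))"
proof -
  let ?A = "body \<A> \<union> polyline (L @ l # r # M)"
  have eq: "polyline (L @ l # r # M) = polyline (L @ [l]) \<union> closed_segment l r \<union> polyline (r # M)"
    "polyline (L @ l # v # r # M) = polyline (L @ [l]) \<union> closed_segment l v \<union> closed_segment v r \<union> polyline (r # M)"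
    by (subst polyline_append, simp add: Un_ac)+
  have meet: "z \<in> closed_segment l r" if z: "z \<in> ?A" "z \<in> convex hull {l, v, r}" for z
  proof (cases "z \<in> body \<A>")
    case True
    have "{l, v, r} \<subseteq> B \<union> G" using L(2) ab(2) by auto
    then have "z \<in> convex hull ({l, v, r} - G)"
      using triangle_Int_body[OF gen disj \<A> _ z(2) True] by blast
    then show ?thesis using hull_mono[of "{l, v, r} - G" "{l, r}" convex] v
      by (auto simp: segment_convex_hull)
  next
    case False
    then show ?thesis using triangle_Int_polyline[OF generic_ab dim L z(2)] z(1) eq by auto
  qed
  have "engulfed W (?A \<union> (\<Union>s\<in>{{l, r}}. convex hull (insert v s)))"
  proof (rule engulfed_sweep[where v = l])
    fix s t z u
    assume st: "s \<in> {{l, r}}" "t \<in> {{l, r}}" and z: "z \<in> ?A" "z \<in> convex hull insert v s"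
      and u: "0 \<le> u" "z - u *\<^sub>R (v - l) \<in> convex hull insert v t"
    have "z \<in> convex hull {l, r}"
      using meet[of z] z st by (simp add: insert_commute segment_convex_hull)
    moreover have "card {v, l, r} \<le> DIM('a) + 1" using dim by (auto simp: card_insert_if)
    ultimately have "u = 0"
      using generic_no_descent[OF generic_ab, of "{l, r}" "{l, r}" v l z u] L u st by auto
    then show "z - u *\<^sub>R (v - l) \<in> ?A" using z by simp
  next
    show "closed ?A" by (rule closed_body_polyline)
    show "finite s \<and> l \<in> s \<and> v \<notin> s" if "s \<in> {{l, r}}" for s using that L by auto
    show "convex hull s \<subseteq> ?A" if "s \<in> {{l, r}}" for s
      using that eq by (auto simp: segment_convex_hull)
    show "convex hull insert v s \<subseteq> W" if "s \<in> {{l, r}}" for s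
      using that tri by (simp add: insert_commute)
  qed (use eng W in auto)
  moreover have "closed_segment l v \<union> closed_segment v r \<subseteq> convex hull {l, v, r}"
    by (simp add: segment_convex_hull hull_mono)
  ultimately show ?thesis unfolding eq
    by (elim engulfed_mono) (auto simp: insert_commute)
qed

text \<open>The triangle is swept from the edge \<open>l v\<close> in direction
  \<open>r - v\<close>. The other old edge \<open>v r\<close> is parallel to this direction, so
  descent stays on it. The condition \<open>lr\<close> keeps the complex off the inside of the new
  edge, which genericity does not do when both ends lie in \<open>B\<close>.\<close>

lemma engulfed_polyline_delete:
  assumes eng: "engulfed W (body \<A> \<union> polyline (L @ l # v # r # M))"
    and L: "distinct (L @ l # v # r # M)" "set (L @ l # v # r # M) \<subseteq> insert a (insert b G)"
    and v: "v \<in> G" and tri: "convex hull {l, v, r} \<subseteq> W"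
    and lr: "l \<in> G \<or> r \<in> G \<or> open_segment l r \<inter> body \<A> = {}"
  shows "engulfed W (body \<A> \<union> polyline (L @ l # r # M))"
proof -
  let ?A = "body \<A> \<union> polyline (L @ l # v # r # M)"
  have eq: "polyline (L @ l # r # M) = polyline (L @ [l]) \<union> closed_segment l r \<union> polyline (r # M)"
    "polyline (L @ l # v # r # M) = polyline (L @ [l]) \<union> closed_segment l v \<union> closed_segment v r \<union> polyline (r # M)"
    by (subst polyline_append, simp add: Un_ac)+
  have meet: "z \<in> closed_segment l v \<or> z \<in> closed_segment v r" if z: "z \<in> ?A" "z \<in> convex hull {l, v, r}" for z
  proof (cases "z \<in> body \<A>")
    case True
    have "{l, v, r} \<subseteq> B \<union> G" using L(2) ab(2) by auto
    then have *: "z \<in> convex hull ({l, v, r} - G)"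
      using triangle_Int_body[OF gen disj \<A> _ z(2) True] by blast
    consider "l \<in> G" | "r \<in> G" | "open_segment l r \<inter> body \<A> = {}" using lr by blast
    then have "z \<in> {l, r}"
    proof cases
      case 1
      then have "{l, v, r} - G \<subseteq> {r}" using v by auto
      then show ?thesis using * hull_mono[of "{l, v, r} - G" "{r}" convex] by auto
    next
      case 2
      then have "{l, v, r} - G \<subseteq> {l}" using v by auto
      then show ?thesis using * hull_mono[of "{l, v, r} - G" "{l}" convex] by auto
    next
      case 3
      have "z \<in> closed_segment l r"
        using * hull_mono[of "{l, v, r} - G" "{l, r}" convex] v by (auto simp: segment_convex_hull)
      then show ?thesis using 3 True by (auto simp: open_segment_def)
    qed
    then show ?thesis by auto
  next
    case False
    then show ?thesis using triangle_Int_polyline[OF generic_ab dim L z(2)] z(1) eq by auto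
  qed
  have "engulfed W (?A \<union> (\<Union>s\<in>{{l, v}}. convex hull (insert r s)))"
  proof (rule engulfed_sweep[where v = v])
    fix s t z u
    assume st: "s \<in> {{l, v}}" "t \<in> {{l, v}}" and z: "z \<in> ?A" "z \<in> convex hull insert r s"
      and u: "0 \<le> u" "z - u *\<^sub>R (r - v) \<in> convex hull insert r t"
    have c: "card {r, l, v} \<le> DIM('a) + 1" using dim by (auto simp: card_insert_if)
    have "z \<in> closed_segment l v \<or> z \<in> closed_segment v r"
      using meet[of z] z st by (simp add: insert_commute)
    then show "z - u *\<^sub>R (r - v) \<in> ?A"
    proof
      assume "z \<in> closed_segment l v"
      then have "u = 0"
        using generic_no_descent[OF generic_ab, of "{l, v}" "{l, v}" r v z u] L u st c
        by (auto simp: segment_convex_hull)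
      then show ?thesis using z by simp
    next
      assume "z \<in> closed_segment v r"
      then obtain k where "z = (1 - k) *\<^sub>R v + k *\<^sub>R r" by (auto simp: in_segment)
      then have k: "z - u *\<^sub>R (r - v) = (1 - (k - u)) *\<^sub>R v + (k - u) *\<^sub>R r" by (simp add: algebra_simps)
      let ?F = "{l, v, r}"
      have F: "finite ?F" by simp
      have u2: "z - u *\<^sub>R (r - v) \<in> convex hull ?F" using u(2) st by (simp add: insert_commute)
      obtain c where c': "\<And>x. c x \<ge> 0" "sum c ?F = 1" "(\<Sum>x\<in>?F. c x *\<^sub>R x) = z - u *\<^sub>R (r - v)"
        using in_convex_hull_superset[OF F subset_refl u2] by metis
      \<comment> \<open>These are the coordinates of the point on the line through \<open>v\<close>
        and \<open>r\<close>, with weight zero at \<open>l\<close>. Uniqueness forces the same zero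
        on the nonnegative coordinates \<open>c\<close> in the triangle, so the point has not passed
        below \<open>v\<close>.\<close>
      define d where "d x = (if x = v then 1 - (k - u) else if x = r then k - u else 0)" for x
      have ne: "l \<noteq> v" "l \<noteq> r" "v \<noteq> r" using L by auto
      have d: "sum d ?F = 1" "(\<Sum>x\<in>?F. d x *\<^sub>R x) = z - u *\<^sub>R (r - v)"
        using ne k by (simp_all add: d_def)
      have "c l = d l"
        by (rule generic_over_coeff_eq[OF generic_ab F]) (use c' d L c in \<open>auto simp: insert_commute\<close>)
      then have "z - u *\<^sub>R (r - v) \<in> convex hull {v, r}"
        using c' ne by (intro in_convex_hull_support[OF F, of c]) (auto simp: d_def)
      then show ?thesis using eq by (auto simp: segment_convex_hull)
    qed
  next
    show "closed ?A" by (rule closed_body_polyline)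
    show "finite s \<and> v \<in> s \<and> r \<notin> s" if "s \<in> {{l, v}}" for s using that L by auto
    show "convex hull s \<subseteq> ?A" if "s \<in> {{l, v}}" for s
      using that eq by (auto simp: segment_convex_hull)
    show "convex hull insert r s \<subseteq> W" if "s \<in> {{l, v}}" for s
      using that tri by (simp add: insert_commute)
  qed (use eng W in auto)
  moreover have "closed_segment l r \<subseteq> convex hull {l, v, r}"
    by (simp add: segment_convex_hull hull_mono)
  ultimately show ?thesis unfolding eq
    by (elim engulfed_mono) (auto simp: insert_commute)
qed

end

section \<open>Engulfing a segment\<close>

lemma in_polyline_mapE:
  assumes "z \<in> polyline (map f [m..<n])"
  obtains i where "m \<le> i" "Suc i < n" "z \<in> closed_segment (f i) (f (Suc i))"
proof -
  have "\<exists>i. m \<le> i \<and> Suc i < n \<and> z \<in> closed_segment (f i) (f (Suc i))"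
    using assms
  proof (induction "n - m" arbitrary: m)
    case 0
    then show ?case by simp
  next
    case (Suc d)
    show ?case
    proof (cases "Suc m < n")
      case True
      then have e: "[m..<n] = m # Suc m # [Suc (Suc m)..<n]" "[Suc m..<n] = Suc m # [Suc (Suc m)..<n]"
        by (simp_all add: upt_conv_Cons)
      consider "z \<in> closed_segment (f m) (f (Suc m))" | "z \<in> polyline (map f [Suc m..<n])"
        using Suc.prems unfolding e by auto
      then show ?thesis
      proof cases
        case 1 then show ?thesis using True by blast
      next
        case 2
        have "d = n - Suc m" using Suc.hyps(2) by simp
        from Suc.hyps(1)[OF this 2] show ?thesis using Suc_leD by blast
      qed
    next
      case False
      then have "[m..<n] = [] \<or> [m..<n] = [m]" using Suc.hyps(2)
        by (cases "m < n") (auto simp: upt_conv_Cons)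
      then show ?thesis using Suc.prems by auto
    qed
  qed
  then show thesis using that by blast
qed

lemma convex_hull_triple_ball:
  fixes x y z :: "'a::real_normed_vector"
  assumes "dist x c < r" "dist y c < r" "dist z c < r"
  shows "convex hull {x, y, z} \<subseteq> ball c r"
  using assms by (intro hull_minimal) (auto simp: dist_commute)

text \<open>The path inside the body is deformed into the segment, through polygonal lines whose vertices are generic
  points near a grid on the homotopy. The first one lies in the ball already, the others are
  reached by pushing the ball across triangles, which are too small in dimension to meet the body.\<close>

lemma engulfed_open_segment:
  fixes W :: "'a::euclidean_space set"
  assumes eng: "engulfed W (body \<A>)" and W: "open W" and fin: "finite \<A>"
    and \<A>: "\<And>s. s \<in> \<A> \<Longrightarrow> finite s \<and> card s + 2 \<le> DIM('a)"
    and dim: "4 \<le> DIM('a)" and "a \<noteq> b" and op: "open_segment a b \<inter> body \<A> = {}"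
    and p: "path_image p \<subseteq> body \<A>" and hom: "homotopic_paths W p (linepath a b)"
  shows "engulfed W (body \<A> \<union> closed_segment a b)"
proof -
  note upt_Suc [simp del]
  obtain h where h: "continuous_on ({0..1} \<times> {0..1}) h" "h \<in> ({0..1} \<times> {0..1}) \<rightarrow> W"
    "\<And>x. x \<in> {0..1} \<Longrightarrow> h (0, x) = p x" "\<And>x. x \<in> {0..1} \<Longrightarrow> h (1, x) = linepath a b x"
    "\<And>t. t \<in> {0..1::real} \<Longrightarrow> pathstart (h \<circ> Pair t) = pathstart p \<and> pathfinish (h \<circ> Pair t) = pathfinish p"
    using hom unfolding homotopic_paths by blast
  have pab: "pathstart p = a" "pathfinish p = b"
    using homotopic_paths_imp_pathstart[OF hom] homotopic_paths_imp_pathfinish[OF hom] by auto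
  define B where "B = insert a (insert b (\<Union>\<A>))"
  have B: "finite B" "{a, b} \<subseteq> B" "\<And>s. s \<in> \<A> \<Longrightarrow> finite s \<and> card s + 2 \<le> DIM('a) \<and> s \<subseteq> B"
    using fin \<A> by (auto simp: B_def)
  obtain f f' :: "'a \<Rightarrow> 'a" where f: "homeomorphism UNIV UNIV f f'" "body \<A> \<subseteq> f ` ball 0 1" "f ` cball 0 1 \<subseteq> W"
    using eng unfolding engulfed_def by blast
  define D where "D = f ` ball 0 1"
  have "open D" unfolding D_def
    using homeomorphism_imp_open_map[OF f(1), of "ball 0 1"] by simp
  have "path p" using homotopic_paths_imp_path[OF hom] by simp
  then have pim: "compact (path_image p)" "path_image p \<noteq> {}" "path_image p \<subseteq> D"
    using p f(2) by (auto simp: D_def compact_path_image)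
  obtain d1 where d1: "d1 > 0" "{x. infdist x (path_image p) \<le> d1} \<subseteq> D"
    using compact_in_open_separated[OF pim(2,1) \<open>open D\<close> pim(3)] by blast
  let ?I = "{0..1::real} \<times> {0..1::real}"
  have cI: "compact ?I" by (intro compact_Times compact_Icc)
  have him: "compact (h ` ?I)" "h ` ?I \<noteq> {}" "h ` ?I \<subseteq> W"
    using compact_continuous_image[OF h(1) cI] h(2) by auto
  obtain d2 where d2: "d2 > 0" "{x. infdist x (h ` ?I) \<le> d2} \<subseteq> W"
    using compact_in_open_separated[OF him(2,1) W him(3)] by blast
  \<comment> \<open>A generic vertex is within \<open>r\<close> of its grid value, and neighbouring
    grid values differ by less than \<open>r\<close>. The sum \<open>2 * r\<close> has to fit both
    the margin \<open>d1\<close> of the path inside the ball and the margin \<open>d2\<close> of the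
    homotopy inside \<open>W\<close>.\<close>
  define r where "r = min d1 d2 / 4"
  have r: "r > 0" "2 * r \<le> d1" "2 * r \<le> d2" using d1(1) d2(1) by (auto simp: r_def)
  obtain d where d: "d > 0" "\<And>x y. x \<in> ?I \<Longrightarrow> y \<in> ?I \<Longrightarrow> dist y x < d \<Longrightarrow> dist (h y) (h x) < r"
    using compact_uniformly_continuous[OF h(1) cI] r(1) unfolding uniformly_continuous_on_def by meson
  obtain N :: nat where N: "2 / d + 2 < real N" using reals_Archimedean2 by blast
  moreover have "0 \<le> 2 / d" using d(1) by simp
  ultimately have "2 < real N" and Nd: "2 / d < real N" by linarith+
  then have N2: "2 \<le> N" by simp
  have N3: "2 / real N < d" using Nd N2 d(1) by (simp add: field_simps)
  define c where "c k i = h (real k / real N, real i / real N)" for k i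
  have inI: "(real k / real N, real i / real N) \<in> ?I" if "k \<le> N" "i \<le> N" for k i
    using that N2 by auto
  have cc: "dist (c k' i') (c k i) < r"
    if "k \<le> N" "i \<le> N" "k' \<le> N" "i' \<le> N" "\<bar>real k' - real k\<bar> \<le> 1" "\<bar>real i' - real i\<bar> \<le> 1" for k i k' i'
  proof -
    let ?x = "(real k / real N, real i / real N)" and ?y = "(real k' / real N, real i' / real N)"
    have "dist ?y ?x \<le> \<bar>real k' / real N - real k / real N\<bar> + \<bar>real i' / real N - real i / real N\<bar>"
      unfolding dist_Pair_Pair dist_real_def by (rule sqrt_sum_squares_le_sum_abs[THEN order_trans]) simp
    also have "\<dots> = (\<bar>real k' - real k\<bar> + \<bar>real i' - real i\<bar>) / real N"
      using N2 by (simp add: add_divide_distrib flip: diff_divide_distrib)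
    also have "\<dots> \<le> 2 / real N" using that by (intro divide_right_mono) auto
    finally have "dist ?y ?x < d" using N3 by simp
    then show ?thesis unfolding c_def using d(2)[OF inI[OF that(1,2)] inI[OF that(3,4)]] by simp
  qed
  obtain q where q: "inj_on q ({0..N} \<times> {1..<N})" "q ` ({0..N} \<times> {1..<N}) \<inter> B = {}"
    "\<forall>j\<in>{0..N} \<times> {1..<N}. dist (q j) (case j of (k, i) \<Rightarrow> c k i) < r"
    "generic_over B (q ` ({0..N} \<times> {1..<N}))"
    by (rule generic_over_family[OF _ B(1) r(1), of "{0..N} \<times> {1..<N}" "\<lambda>(k, i). c k i"]) auto
  define G where "G = q ` ({0..N} \<times> {1..<N})"
  have gen: "generic_over B G" "B \<inter> G = {}" using q unfolding G_def by auto
  \<comment> \<open>The outer columns are frozen at \<open>a\<close> and \<open>b\<close>, the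
    common ends of all paths of the homotopy; only the inner vertices of a row are generic.\<close>
  define g where "g k i = (if i = 0 then a else if i = N then b else q (k, i))" for k i
  have c0: "c k 0 = a" "c k N = b" if "k \<le> N" for k
    using h(5)[of "real k / real N"] pab that N2 by (auto simp: c_def pathstart_def pathfinish_def)
  have near: "dist (g k i) (c k i) < r" if "k \<le> N" "i \<le> N" for k i
    using bspec[OF q(3), of "(k, i)"] that r(1) c0 by (auto simp: g_def)
  have gG: "g k i \<in> G" if "k \<le> N" "0 < i" "i < N" for k i
    using that by (auto simp: g_def G_def)
  have gab: "g k i \<in> insert a (insert b G)" if "k \<le> N" "i \<le> N" for k i
    using that gG[of k i] by (cases "i = 0 \<or> i = N") (auto simp: g_def)
  have ginj: "i = i' \<and> (i = 0 \<or> i = N \<or> k = k')"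
    if e: "g k i = g k' i'" "k \<le> N" "k' \<le> N" "i \<le> N" "i' \<le> N" for k i k' i'
  proof -
    have "a \<notin> G" "b \<notin> G" using gen(2) B(2) by auto
    consider "0 < i" "i < N" "0 < i'" "i' < N" | "0 < i" "i < N" "i' = 0 \<or> i' = N"
      | "i = 0 \<or> i = N" "0 < i'" "i' < N" | "i = 0 \<or> i = N" "i' = 0 \<or> i' = N"
      using e by linarith
    then show ?thesis
    proof cases
      case 1
      then show ?thesis using e inj_onD[OF q(1), of "(k, i)" "(k', i')"] by (auto simp: g_def)
    next
      case 2
      then have "g k' i' \<notin> G" using \<open>a \<notin> G\<close> \<open>b \<notin> G\<close> by (auto simp: g_def)
      then show ?thesis using e gG[OF _ 2(1,2), of k] by simp
    next
      case 3
      then have "g k i \<notin> G" using \<open>a \<notin> G\<close> \<open>b \<notin> G\<close> by (auto simp: g_def)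
      then show ?thesis using e gG[OF _ 3(2,3), of k'] by simp
    next
      case 4
      then show ?thesis using e(1) \<open>a \<noteq> b\<close> N2 by (auto simp: g_def split: if_splits)
    qed
  qed
  note insert = engulfed_polyline_insert[OF W fin B(3) dim gen \<open>a \<noteq> b\<close> B(2)]
  note delete = engulfed_polyline_delete[OF W fin B(3) dim gen \<open>a \<noteq> b\<close> B(2)]
  have dst: "distinct (map (g (Suc k)) [0..<m] @ map (g k) [j..<Suc N])"
    if "k < N" "0 < j" "j < N" "m \<le> Suc j" for k m j
  proof -
    have "inj_on (g (Suc k)) {0..<m}" "inj_on (g k) {j..<Suc N}"
      using ginj that by (auto intro!: inj_onI)
    moreover have "g (Suc k) x \<noteq> g k y" if "x < m" "j \<le> y" "y < Suc N" for x y
      using ginj[of "Suc k" x k y] that \<open>k < N\<close> \<open>0 < j\<close> \<open>j < N\<close> \<open>m \<le> Suc j\<close> by force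
    ultimately show ?thesis by (auto simp: distinct_map)
  qed
  have sub: "set (map (g (Suc k)) [0..<m] @ map (g k) [j..<Suc N]) \<subseteq> insert a (insert b G)"
    if "k < N" "m \<le> Suc N" for k m j
  proof -
    have "g (Suc k) ` {0..<m} \<subseteq> insert a (insert b G)" "g k ` {j..<Suc N} \<subseteq> insert a (insert b G)"
      unfolding image_subset_iff using gab[of "Suc k"] gab[of k] that
      by (auto simp del: insert_iff simp: less_Suc_eq_le)
    then show ?thesis by simp
  qed
  have row: "engulfed W (body \<A> \<union> polyline (map (g k) [0..<Suc N]))" if "k \<le> N" for k
    using that
  proof (induction k)
    case 0
    have "polyline (map (g 0) [0..<Suc N]) \<subseteq> D"
    proof
      fix z assume "z \<in> polyline (map (g 0) [0..<Suc N])"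
      then obtain i where i: "Suc i < Suc N" "z \<in> closed_segment (g 0 i) (g 0 (Suc i))"
        by (rule in_polyline_mapE)
      have "dist (g 0 (Suc i)) (c 0 i) < 2 * r"
        using near[of 0 "Suc i"] cc[of 0 i 0 "Suc i"] dist_triangle[of "g 0 (Suc i)" "c 0 i" "c 0 (Suc i)"] i(1)
        by auto
      moreover have "dist (g 0 i) (c 0 i) < 2 * r" using near[of 0 i] i(1) r(1) by simp
      ultimately have "closed_segment (g 0 i) (g 0 (Suc i)) \<subseteq> ball (c 0 i) (2 * r)"
        by (intro closed_segment_subset) (auto simp: dist_commute)
      then have "dist z (c 0 i) \<le> 2 * r" using i(2) by (auto simp: dist_commute)
      moreover have "c 0 i \<in> path_image p"
        using h(3)[of "real i / real N"] i(1) N2 by (auto simp: c_def path_image_def)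
      ultimately have "infdist z (path_image p) \<le> d1" using infdist_le2 r(2) by (meson order_trans)
      then show "z \<in> D" using d1(2) by blast
    qed
    then show ?case using f D_def unfolding engulfed_def by blast
  next
    case (Suc k)
    then have k: "k < N" by simp
    \<comment> \<open>A mixed row: the first \<open>j\<close> vertices are already taken from row
      \<open>k + 1\<close>, the others still from row \<open>k\<close>. One insertion followed by
      one deletion advances \<open>j\<close> by one.\<close>
    define T where "T j = map (g (Suc k)) [0..<j] @ map (g k) [j..<Suc N]" for j
    have tri: "convex hull {x, y, z} \<subseteq> W"
      if "i \<le> N" "x \<in> g k ` {i'. i' \<le> N \<and> \<bar>real i' - real i\<bar> \<le> 1} \<union> g (Suc k) ` {i'. i' \<le> N \<and> \<bar>real i' - real i\<bar> \<le> 1}"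
        "y \<in> g k ` {i'. i' \<le> N \<and> \<bar>real i' - real i\<bar> \<le> 1} \<union> g (Suc k) ` {i'. i' \<le> N \<and> \<bar>real i' - real i\<bar> \<le> 1}"
        "z \<in> g k ` {i'. i' \<le> N \<and> \<bar>real i' - real i\<bar> \<le> 1} \<union> g (Suc k) ` {i'. i' \<le> N \<and> \<bar>real i' - real i\<bar> \<le> 1}"
      for x y z i
    proof -
      have *: "dist w (c k i) < 2 * r"
        if w: "w \<in> g k ` {i'. i' \<le> N \<and> \<bar>real i' - real i\<bar> \<le> 1} \<union> g (Suc k) ` {i'. i' \<le> N \<and> \<bar>real i' - real i\<bar> \<le> 1}" for w
      proof -
        obtain k' i' where w: "w = g k' i'" "i' \<le> N" "\<bar>real i' - real i\<bar> \<le> 1" "k' = k \<or> k' = Suc k"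
          using w by auto
        then have "k' \<le> N" "\<bar>real k' - real k\<bar> \<le> 1" using k by auto
        then show ?thesis
          using near[of k' i'] cc[of k i k' i'] dist_triangle[of w "c k i" "c k' i'"] w \<open>i \<le> N\<close> k by auto
      qed
      have "convex hull {x, y, z} \<subseteq> ball (c k i) (2 * r)"
        using * that by (intro convex_hull_triple_ball) auto
      also have "\<dots> \<subseteq> W"
      proof
        fix w assume "w \<in> ball (c k i) (2 * r)"
        moreover have "c k i \<in> h ` ?I" using inI[of k i] \<open>i \<le> N\<close> k unfolding c_def by (intro imageI) auto
        ultimately have "infdist w (h ` ?I) \<le> d2"
          using infdist_le2[of "c k i" "h ` ?I" w d2] r(3) by (auto simp: dist_commute)
        then show "w \<in> W" using d2(2) by blast
      qed
      finally show ?thesis .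
    qed
    have "engulfed W (body \<A> \<union> polyline (T (Suc j)))" if "Suc j \<le> N" for j
      using that
    proof (induction j)
      case 0
      have "T (Suc 0) = map (g k) [0..<Suc N]"
        unfolding T_def by (simp add: upt_conv_Cons[of 0 "Suc N"] upt_conv_Cons[of 0 "Suc 0"] g_def)
      then show ?case using Suc.IH k by simp
    next
      case (Suc j)
      define i where "i = Suc j"
      have i: "0 < i" "i < N" using Suc.prems by (auto simp: i_def)
      let ?L = "map (g (Suc k)) [0..<j]"
      let ?M = "map (g k) [Suc (Suc i)..<Suc N]"
      have up: "[i..<Suc N] = i # Suc i # [Suc (Suc i)..<Suc N]" "[Suc i..<Suc N] = Suc i # [Suc (Suc i)..<Suc N]"
        using i by (simp_all add: upt_conv_Cons)
      have e1: "T (Suc j) = ?L @ g (Suc k) j # g k i # g k (Suc i) # ?M"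
        unfolding T_def i_def[symmetric] up unfolding i_def by (simp add: upt_Suc)
      have e2: "?L @ g (Suc k) j # g (Suc k) i # g k i # g k (Suc i) # ?M
          = map (g (Suc k)) [0..<Suc i] @ map (g k) [i..<Suc N]"
        unfolding up unfolding i_def by (simp add: upt_Suc)
      have e3: "T (Suc (Suc j)) = (?L @ [g (Suc k) j]) @ g (Suc k) i # g k (Suc i) # ?M"
        unfolding T_def i_def[symmetric] up unfolding i_def by (simp add: upt_Suc)
      have ds: "distinct (?L @ g (Suc k) j # g (Suc k) i # g k i # g k (Suc i) # ?M)"
        "set (?L @ g (Suc k) j # g (Suc k) i # g k i # g k (Suc i) # ?M) \<subseteq> insert a (insert b G)"
        unfolding e2 using i by (intro dst[OF k i] sub[OF k]; simp)+
      have ins: "engulfed W (body \<A> \<union> polyline (?L @ g (Suc k) j # g (Suc k) i # g k i # g k (Suc i) # ?M))"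
      proof (rule insert)
        show "engulfed W (body \<A> \<union> polyline (?L @ g (Suc k) j # g k i # g k (Suc i) # ?M))"
          using Suc e1 by simp
        show "distinct (?L @ g (Suc k) j # g (Suc k) i # g k i # g k (Suc i) # ?M)"
          "set (?L @ g (Suc k) j # g (Suc k) i # g k i # g k (Suc i) # ?M) \<subseteq> insert a (insert b G)"
          by (rule ds)+
        show "g (Suc k) i \<in> G" using gG k i by simp
        show "convex hull {g (Suc k) j, g (Suc k) i, g k i} \<subseteq> W"
          by (rule tri[of i]) (use i in \<open>auto simp: i_def\<close>)
      qed
      have "engulfed W (body \<A> \<union> polyline ((?L @ [g (Suc k) j]) @ g (Suc k) i # g k (Suc i) # ?M))"
      proof (rule delete)
        show "engulfed W (body \<A> \<union> polyline ((?L @ [g (Suc k) j]) @ g (Suc k) i # g k i # g k (Suc i) # ?M))"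
          using ins by simp
        show "distinct ((?L @ [g (Suc k) j]) @ g (Suc k) i # g k i # g k (Suc i) # ?M)"
          "set ((?L @ [g (Suc k) j]) @ g (Suc k) i # g k i # g k (Suc i) # ?M) \<subseteq> insert a (insert b G)"
          using ds by simp_all
        show "g k i \<in> G" using gG k i by simp
        show "convex hull {g (Suc k) i, g k i, g k (Suc i)} \<subseteq> W"
          by (rule tri[of i]) (use i in \<open>auto simp: i_def\<close>)
        show "g (Suc k) i \<in> G \<or> g k (Suc i) \<in> G \<or> open_segment (g (Suc k) i) (g k (Suc i)) \<inter> body \<A> = {}"
          using gG k i by simp
      qed
      then show ?case unfolding e3 .
    qed
    from this[of "N - 1"] have "engulfed W (body \<A> \<union> polyline (T N))" using N2 by simp
    moreover have "T N = map (g (Suc k)) [0..<Suc N]" using N2 by (simp add: T_def g_def upt_Suc)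
    ultimately show ?case by simp
  qed
  \<comment> \<open>A convex neighbourhood of the segment inside \<open>W\<close>. It contains the
    last row, so all triangles used to shorten this row stay in \<open>W\<close>.\<close>
  define K where "K = (\<Union>x\<in>closed_segment a b. \<Union>y\<in>ball 0 r. {x + y})"
  have "convex K" unfolding K_def by (intro convex_sums) auto
  have "K \<subseteq> W"
  proof
    fix z assume "z \<in> K"
    then obtain x y where xy: "x \<in> closed_segment a b" "norm y < r" "z = x + y" by (auto simp: K_def)
    then obtain t where "t \<in> {0..1}" "x = linepath a b t"
      unfolding linepath_image_01[symmetric] by blast
    then have "x = h (1, t)" "(1, t) \<in> ?I" using h(4) by auto
    then have "x \<in> h ` ?I" by blast
    moreover have "dist z x \<le> d2" using xy r by (simp add: dist_norm)
    ultimately have "infdist z (h ` ?I) \<le> d2" by (rule infdist_le2)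
    then show "z \<in> W" using d2(2) by blast
  qed
  have gK: "g N i \<in> K" if "i \<le> N" for i
  proof -
    have "c N i = linepath a b (real i / real N)" using h(4) that N2 by (simp add: c_def)
    then have "c N i \<in> closed_segment a b" using that N2 by (simp add: linepath_in_path)
    moreover have "g N i - c N i \<in> ball 0 r" using near[of N i] that by (simp add: dist_norm norm_minus_commute)
    ultimately have "c N i + (g N i - c N i) \<in> K" unfolding K_def by blast
    then show ?thesis by simp
  qed
  \<comment> \<open>Inner vertices are deleted starting next to \<open>a\<close>. Only the last
    deletion creates an edge with both ends fixed, and there \<open>op\<close> provides the
    condition \<open>lr\<close> of the move.\<close>
  have "engulfed W (body \<A> \<union> polyline (a # map (g N) [Suc j..<Suc N]))" if "Suc j \<le> N" for j
    using that
  proof (induction j)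
    case 0
    have "a # map (g N) [Suc 0..<Suc N] = map (g N) [0..<Suc N]"
      by (simp add: upt_conv_Cons[of 0 "Suc N"] g_def)
    then show ?case using row[of N] by simp
  next
    case (Suc j)
    define i where "i = Suc j"
    have i: "0 < i" "i < N" using Suc.prems by (auto simp: i_def)
    have up: "[i..<Suc N] = i # Suc i # [Suc (Suc i)..<Suc N]" "[Suc i..<Suc N] = Suc i # [Suc (Suc i)..<Suc N]"
      using i by (simp_all add: upt_conv_Cons)
    let ?M = "map (g N) [Suc (Suc i)..<Suc N]"
    have "engulfed W (body \<A> \<union> polyline ([] @ a # g N (Suc i) # ?M))"
    proof (rule delete)
      show "engulfed W (body \<A> \<union> polyline ([] @ a # g N i # g N (Suc i) # ?M))"
        using Suc unfolding i_def[symmetric] up by simp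
      have "g N 0 \<notin> g N ` {i..<Suc N}" using ginj[of N 0 N] i by force
      moreover have "inj_on (g N) {i..<Suc N}" using ginj[of N _ N] by (auto intro!: inj_onI)
      moreover have "g N 0 = a" by (simp add: g_def)
      ultimately have "distinct (a # map (g N) [i..<Suc N])" by (auto simp: distinct_map)
      then show "distinct ([] @ a # g N i # g N (Suc i) # ?M)" unfolding up by simp
      have "g N ` {i..<Suc N} \<subseteq> insert a (insert b G)"
        unfolding image_subset_iff using gab[of N] by (auto simp del: insert_iff simp: less_Suc_eq_le)
      then have "set (map (g N) [i..<Suc N]) \<subseteq> insert a (insert b G)" by simp
      then show "set ([] @ a # g N i # g N (Suc i) # ?M) \<subseteq> insert a (insert b G)"
        unfolding up by simp
      show "g N i \<in> G" using gG i by simp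
      have "a \<in> K" using gK[of 0] by (simp add: g_def)
      then show "convex hull {a, g N i, g N (Suc i)} \<subseteq> W"
        using gK[of i] gK[of "Suc i"] i \<open>K \<subseteq> W\<close> hull_minimal[of "{a, g N i, g N (Suc i)}" K convex] \<open>convex K\<close>
        by auto
      show "a \<in> G \<or> g N (Suc i) \<in> G \<or> open_segment a (g N (Suc i)) \<inter> body \<A> = {}"
        using gG[of N "Suc i"] op i by (cases "Suc i = N") (auto simp: g_def)
    qed
    then show ?case unfolding i_def[symmetric] up by simp
  qed
  from this[of "N - 1"] show ?thesis using N2 by (simp add: g_def upt_Suc)
qed

section \<open>Moving a vertex of a complex\<close>

lemma body_insert: "body (insert s \<A>) = convex hull s \<union> body \<A>"
  by (simp add: body_def)

context
  fixes U W :: "'a::euclidean_space set"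
  assumes W: "open W" and dim: "4 \<le> DIM('a)"
    and hom: "\<And>p q. \<lbrakk>path p; path q; path_image p \<subseteq> U; path_image q \<subseteq> U;
      pathstart q = pathstart p; pathfinish q = pathfinish p\<rbrakk> \<Longrightarrow> homotopic_paths W p q"
begin

text \<open>Induction on the number of points in which the segment meets the complex. If its
  interior misses the complex, \<open>hom\<close> deforms a path of the complex into it. Otherwise
  it is cut at an inner meeting point, and the first piece joins the complex before the second is
  treated.\<close>

lemma engulfed_segment:
  fixes a b :: 'a
  assumes "finite \<A>" "\<And>s. s \<in> \<A> \<Longrightarrow> finite s \<and> card s + 2 \<le> DIM('a)"
    "engulfed W (body \<A>)" "path_connected (body \<A>)" "body \<A> \<subseteq> U"
    "a \<in> body \<A>" "b \<in> body \<A>" "closed_segment a b \<subseteq> U" "finite (closed_segment a b \<inter> body \<A>)"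
  shows "engulfed W (body \<A> \<union> closed_segment a b)"
  using assms
proof (induction "card (closed_segment a b \<inter> body \<A>)" arbitrary: \<A> a b rule: less_induct)
  case less
  show ?case
  proof (cases "a = b \<or> open_segment a b \<inter> body \<A> = {}")
    case True
    show ?thesis
    proof (cases "a = b")
      case True
      then show ?thesis using less.prems by (simp add: insert_absorb)
    next
      case False
      then have op: "open_segment a b \<inter> body \<A> = {}" using True by simp
      obtain p where p: "path p" "path_image p \<subseteq> body \<A>" "pathstart p = a" "pathfinish p = b"
        using less.prems(4,6,7) unfolding path_connected_def by blast
      have "homotopic_paths W p (linepath a b)"
        using p less.prems(5,8) by (intro hom) auto
      then show ?thesis
        using engulfed_open_segment[OF less.prems(3) W less.prems(1,2) dim False op p(2)] by blast
    qed
  next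
    case False
    then obtain c where c: "c \<in> open_segment a b" "c \<in> body \<A>" and "a \<noteq> b" by blast
    have cab: "c \<in> closed_segment a b" "c \<noteq> a" "c \<noteq> b" using c(1) by (auto simp: open_segment_def)
    have Un: "closed_segment a c \<union> closed_segment c b = closed_segment a b"
      using cab by (simp add: Un_closed_segment)
    have Int: "closed_segment a c \<inter> closed_segment c b = {c}"
      using cab by (simp add: Int_closed_segment)
    have b: "b \<notin> closed_segment a c" and a: "a \<notin> closed_segment c b"
      using Int cab by (metis IntI ends_in_segment singletonD)+
    let ?B = "insert {a, c} \<A>"
    have B: "body ?B = body \<A> \<union> closed_segment a c"
      by (simp add: body_insert segment_convex_hull Un_commute)
    have ps: "closed_segment a c \<inter> body \<A> \<subset> closed_segment a b \<inter> body \<A>"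
      using Un b less.prems(7) ends_in_segment[of a b] by blast
    have 1: "engulfed W (body \<A> \<union> closed_segment a c)"
    proof (rule less.hyps)
      show "card (closed_segment a c \<inter> body \<A>) < card (closed_segment a b \<inter> body \<A>)"
        by (rule psubset_card_mono[OF less.prems(9) ps])
      show "finite (closed_segment a c \<inter> body \<A>)"
        using ps less.prems(9) finite_subset by blast
      show "closed_segment a c \<subseteq> U" using Un less.prems(8) by blast
      show "finite \<A>" "engulfed W (body \<A>)" "path_connected (body \<A>)" "body \<A> \<subseteq> U"
        "a \<in> body \<A>" "c \<in> body \<A>"
        by (fact less.prems(1) less.prems(3) less.prems(4) less.prems(5) less.prems(6) c(2))+
      show "finite s \<and> card s + 2 \<le> DIM('a)" if "s \<in> \<A>" for s by (rule less.prems(2)[OF that])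
    qed
    \<comment> \<open>The added piece meets the second one only in \<open>c\<close>, which was a
      meeting point already, and the meeting point \<open>a\<close> is lost; so the count
      drops.\<close>
    have ps: "closed_segment c b \<inter> body ?B \<subset> closed_segment a b \<inter> body \<A>"
    proof -
      have "closed_segment c b \<inter> body ?B \<subseteq> insert c (closed_segment c b \<inter> body \<A>)"
        unfolding B using Int by blast
      moreover have "closed_segment c b \<subseteq> closed_segment a b" using Un by blast
      moreover have "a \<in> closed_segment a b" by simp
      ultimately show ?thesis using a less.prems(6) c(2) cab(1) by blast
    qed
    have "engulfed W (body ?B \<union> closed_segment c b)"
    proof (rule less.hyps)
      show "card (closed_segment c b \<inter> body ?B) < card (closed_segment a b \<inter> body \<A>)"
        by (rule psubset_card_mono[OF less.prems(9) ps])
      show "path_connected (body ?B)"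
        unfolding B using less.prems(4,6) by (intro path_connected_Un) auto
      show "finite s \<and> card s + 2 \<le> DIM('a)" if "s \<in> ?B" for s
        using that less.prems(2) dim by (auto simp: card_insert_if)
      show "finite (closed_segment c b \<inter> body ?B)"
        using ps less.prems(9) finite_subset by blast
      show "engulfed W (body ?B)" using 1 B by simp
      show "body ?B \<subseteq> U" "closed_segment c b \<subseteq> U" using less.prems(5,8) Un B by auto
      show "c \<in> body ?B" "b \<in> body ?B" using c(2) less.prems(7) B by auto
    qed (simp add: less.prems(1))
    then show ?thesis unfolding B using Un by (simp add: Un_assoc)
  qed
qed

text \<open>Moving the vertex \<open>v\<close> to \<open>w\<close> sweeps out simplices of dimension \<open>n + 1\<close>, which meet the
  \<open>n\<close>-dimensional complex in finitely many points off the star of \<open>v\<close>. Below each crossing point the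
  vertical segment is engulfed first; then nothing obstructs the sweep.\<close>

lemma engulfed_move_vertex:
  fixes \<K> :: "'a set set" and v w :: 'a
  assumes n: "DIM('a) = 2 * n + 1" and fin: "finite \<K>"
    and \<K>: "\<And>s. s \<in> \<K> \<Longrightarrow> finite s \<and> card s \<le> n + 1"
    and gen: "generic_over {} (insert w (\<Union>\<K>))" and w: "w \<notin> \<Union>\<K>"
    and eng: "engulfed W (body \<K>)" and conn: "path_connected (body \<K>)"
    and U: "body \<K> \<subseteq> U" "\<And>s. s \<in> \<K> \<Longrightarrow> v \<in> s \<Longrightarrow> convex hull (insert w s) \<subseteq> U" and UW: "U \<subseteq> W"
  shows "engulfed W (body ((\<lambda>s. if v \<in> s then insert w (s - {v}) else s) ` \<K>))"
proof -
  define \<S> where "\<S> = {s \<in> \<K>. v \<in> s}"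
  define e where "e = w - v"
  have n2: "2 \<le> n" using dim n by linarith
  have SK: "s \<in> \<K>" "v \<in> s" "finite s" "card s \<le> n + 1" "w \<notin> s" if "s \<in> \<S>" for s
    using that \<K> w by (auto simp: \<S>_def)
  \<comment> \<open>Two simplices of the star share \<open>v\<close>, so together they have at most
    \<open>2 * n + 1\<close> vertices, and with \<open>w\<close> at most \<open>DIM('a) + 1\<close>.
    Under this count descent is impossible.\<close>
  have nodesc: "u = 0"
    if st: "s \<in> \<S>" "t \<in> \<S>" and z: "z \<in> convex hull s" "0 \<le> u" "z - u *\<^sub>R e \<in> convex hull (insert w t)" for s t z u
  proof (rule generic_no_descent[OF gen SK(3)[OF st(1)] SK(3)[OF st(2)]])
    have "card (s \<inter> t) > 0" using SK[OF st(1)] SK[OF st(2)] by (auto simp: card_gt_0_iff)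
    then have "card (s \<union> t) \<le> 2 * n + 1"
      using card_Un_Int[of s t] SK[OF st(1)] SK[OF st(2)] by linarith
    then show "card (insert w (s \<union> t)) \<le> DIM('a) + 1"
      using n card_insert_le_m1[of "2 * n + 2" "s \<union> t" w] by simp
  qed (use SK[OF st(1)] SK[OF st(2)] z in \<open>auto simp: e_def\<close>)
  \<comment> \<open>Up to \<open>DIM('a) + 1\<close> vertices the two hulls meet in a common face.
    The only other case is the full count \<open>(n + 2) + (n + 1)\<close> with no shared vertex,
    where they meet in at most one point.\<close>
  define C where "C s t = (if insert w s \<inter> t = {} \<and> card (insert w s \<union> t) = DIM('a) + 2
    then convex hull (insert w s) \<inter> convex hull t else {})" for s t
  have finC: "finite (C s t)" if st: "s \<in> \<S>" "t \<in> \<K>" for s t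
  proof -
    have "x = y" if "x \<in> C s t" "y \<in> C s t" for x y
      using that SK[OF st(1)] \<K>[OF st(2)] st(2)
      by (intro generic_crossing_unique[OF gen, of "insert w s" t x y])
         (auto simp: C_def split: if_splits)
    then have "C s t \<subseteq> {SOME x. x \<in> C s t}" by (metis singletonI someI subsetI)
    then show ?thesis using finite_subset by blast
  qed
  define Z where "Z = (\<Union>s\<in>\<S>. \<Union>t\<in>\<K>. C s t)"
  have "finite Z" unfolding Z_def using fin finC by (auto simp: \<S>_def)
  have meet: "z \<in> body \<S> \<or> z \<in> Z" if s: "s \<in> \<S>" "z \<in> convex hull (insert w s)" and z: "z \<in> body \<K>" for s z
  proof -
    obtain t where t: "t \<in> \<K>" "z \<in> convex hull t" using z by (auto simp: body_def)
    have fin2: "finite (insert w s)" "finite t" using SK[OF s(1)] \<K>[OF t(1)] by auto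
    have sub: "insert w s \<union> t \<subseteq> insert w (\<Union>\<K>)" using SK[OF s(1)] t by auto
    consider "card (insert w s \<union> t) \<le> DIM('a) + 1" | "card (insert w s \<union> t) > DIM('a) + 1" by linarith
    then show ?thesis
    proof cases
      case 1
      then have "z \<in> convex hull (insert w s \<inter> t)"
        using generic_convex_hull_Int[OF gen fin2 sub 1 s(2) t(2)] by simp
      moreover have "insert w s \<inter> t \<subseteq> s" using w t(1) by auto
      ultimately have "z \<in> convex hull s" by (meson hull_mono subsetD)
      then show ?thesis using s(1) by (auto simp: body_def)
    next
      case 2
      have "card (insert w s) \<le> n + 2" using SK[OF s(1)] by (simp add: card_insert_if)
      then have "card (insert w s \<union> t) = DIM('a) + 2" "card (insert w s \<inter> t) = 0"
        using 2 card_Un_Int[OF fin2] \<K>[OF t(1)] n by linarith+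
      then have "z \<in> C s t" using s t fin2 by (simp add: C_def)
      then show ?thesis using s(1) t(1) by (auto simp: Z_def)
    qed
  qed
  have "\<exists>t. 0 \<le> t \<and> (\<exists>s\<in>\<S>. z - t *\<^sub>R e \<in> convex hull s \<and> z \<in> convex hull (insert w s))" if zZ: "z \<in> Z" for z
  proof -
    obtain s where s: "s \<in> \<S>" "z \<in> convex hull (insert w s)"
      using zZ by (auto simp: Z_def C_def split: if_splits)
    then show ?thesis using convex_hull_insert_down[of s v w z] SK[OF s(1)] unfolding e_def by blast
  qed
  then obtain ht where ht: "\<And>z. z \<in> Z \<Longrightarrow> 0 \<le> ht z \<and> (\<exists>s\<in>\<S>. z - ht z *\<^sub>R e \<in> convex hull s \<and> z \<in> convex hull (insert w s))"
    by metis
  have ZK: "z \<in> body \<K>" if "z \<in> Z" for z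
    using that by (auto simp: Z_def C_def body_def split: if_splits)
  define foot where "foot z = z - ht z *\<^sub>R e" for z
  \<comment> \<open>Several crossings may lie over one foot; the segment \<open>J b\<close> reaches
    up to the highest of them and so contains them all.\<close>
  define H where "H b = Max (ht ` {z \<in> Z. foot z = b})" for b
  define J where "J b = closed_segment b (b + H b *\<^sub>R e)" for b
  let ?F = "foot ` Z"
  have top: "b + H b *\<^sub>R e \<in> Z \<and> foot (b + H b *\<^sub>R e) = b \<and> ht (b + H b *\<^sub>R e) = H b" if "b \<in> ?F" for b
  proof -
    have "H b \<in> ht ` {z \<in> Z. foot z = b}"
      unfolding H_def using that \<open>finite Z\<close> by (intro Max_in) auto
    then obtain z where "z \<in> Z" "foot z = b" "ht z = H b" by auto
    moreover have "z = foot z + ht z *\<^sub>R e" by (simp add: foot_def)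
    ultimately show ?thesis by simp
  qed
  have H0: "0 \<le> H b" if "b \<in> ?F" for b using top[OF that] ht by metis
  have Jeq: "J b = {b + u *\<^sub>R e |u. 0 \<le> u \<and> u \<le> H b}" if b: "b \<in> ?F" for b
  proof -
    have comb: "(1 - k) *\<^sub>R b + k *\<^sub>R (b + H b *\<^sub>R e) = b + (k * H b) *\<^sub>R e" for k
      by (simp add: algebra_simps)
    have "x \<in> J b \<longleftrightarrow> (\<exists>u. 0 \<le> u \<and> u \<le> H b \<and> x = b + u *\<^sub>R e)" for x
    proof
      assume "x \<in> J b"
      then obtain k where k: "0 \<le> k" "k \<le> 1" "x = b + (k * H b) *\<^sub>R e"
        unfolding J_def in_segment comb by blast
      then show "\<exists>u. 0 \<le> u \<and> u \<le> H b \<and> x = b + u *\<^sub>R e"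
        using H0[OF b] by (intro exI[of _ "k * H b"]) (auto simp: mult_left_le_one_le)
    next
      assume "\<exists>u. 0 \<le> u \<and> u \<le> H b \<and> x = b + u *\<^sub>R e"
      then obtain u where u: "0 \<le> u" "u \<le> H b" "x = b + u *\<^sub>R e" by blast
      define k where "k = u / H b"
      have "0 \<le> k" "k \<le> 1" "k * H b = u"
        using u(1,2) by (auto simp: k_def divide_le_eq_1)
      then show "x \<in> J b" unfolding J_def in_segment comb using u(3) by blast
    qed
    then show ?thesis by blast
  qed
  have inJ: "z \<in> J (foot z)" if "z \<in> Z" for z
  proof -
    have "ht z \<le> H (foot z)" unfolding H_def using that \<open>finite Z\<close> by (intro Max_ge) auto
    moreover have "0 \<le> ht z" using ht[OF that] by simp
    moreover have "z = foot z + ht z *\<^sub>R e" by (simp add: foot_def)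
    ultimately show ?thesis using Jeq[of "foot z"] that by blast
  qed
  have foot: "\<exists>s\<in>\<S>. b \<in> convex hull s" if "b \<in> ?F" for b
    using that ht by (auto simp: foot_def)
  have JS: "\<exists>s\<in>\<S>. J b \<subseteq> convex hull (insert w s)" if b: "b \<in> ?F" for b
  proof -
    let ?z = "b + H b *\<^sub>R e"
    obtain s where s: "s \<in> \<S>" "?z - H b *\<^sub>R e \<in> convex hull s" "?z \<in> convex hull (insert w s)"
      using top[OF b] ht by metis
    then have "b \<in> convex hull (insert w s)" using hull_mono[of s "insert w s" convex] by auto
    then show ?thesis using s unfolding J_def by (meson closed_segment_subset convex_convex_hull)
  qed
  have JU: "J b \<subseteq> U" if "b \<in> ?F" for b using JS[OF that] U(2) SK by blast
  have JK: "J b \<inter> body \<K> \<subseteq> insert b Z" if b: "b \<in> ?F" for b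
  proof
    fix y assume y: "y \<in> J b \<inter> body \<K>"
    then obtain u where u: "0 \<le> u" "y = b + u *\<^sub>R e" unfolding Jeq[OF b] by blast
    have "y \<in> body \<S> \<or> y \<in> Z" using JS[OF b] meet y by blast
    moreover have "y = b" if yS: "y \<in> body \<S>"
    proof -
      obtain s where s: "s \<in> \<S>" "y \<in> convex hull s" using yS by (auto simp: body_def)
      obtain t where t: "t \<in> \<S>" "b \<in> convex hull t" using foot[OF b] by blast
      then have "y - u *\<^sub>R e \<in> convex hull (insert w t)"
        using hull_mono[of t "insert w t" convex] u(2) by auto
      then have "u = 0" by (rule nodesc[OF s(1) t(1) s(2) u(1)])
      then show ?thesis using u(2) by simp
    qed
    ultimately show "y \<in> insert b Z" by blast
  qed
  \<comment> \<open>If segments over different feet met, one foot could descend to the other,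
    against \<open>nodesc\<close>. Hence adding the segments one at a time creates no new crossings
    between them.\<close>
  have JJ: "J b \<inter> J b' = {}" if b: "b \<in> ?F" "b' \<in> ?F" "b \<noteq> b'" for b b'
  proof (rule ccontr)
    assume "J b \<inter> J b' \<noteq> {}"
    then obtain x where "x \<in> J b" "x \<in> J b'" by blast
    then obtain u u' where "x = b + u *\<^sub>R e" "x = b' + u' *\<^sub>R e"
      unfolding Jeq[OF b(1)] Jeq[OF b(2)] by blast
    then have u: "b + u *\<^sub>R e = b' + u' *\<^sub>R e" by simp
    have *: "c = c'" if cc: "c \<in> ?F" "c' \<in> ?F" "c + k *\<^sub>R e = c' + k' *\<^sub>R e" "k \<le> k'" for c c' k k'
    proof -
      have c: "c - (k' - k) *\<^sub>R e = c'" using cc(3) by (simp add: algebra_simps)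
      obtain s where s: "s \<in> \<S>" "c \<in> convex hull s" using foot cc(1) by blast
      obtain t where t: "t \<in> \<S>" "c' \<in> convex hull t" using foot cc(2) by blast
      then have "c - (k' - k) *\<^sub>R e \<in> convex hull (insert w t)"
        using hull_mono[of t "insert w t" convex] c by auto
      then have "k' - k = 0" by (rule nodesc[OF s(1) t(1) s(2), rotated]) (simp add: cc(4))
      then show ?thesis using c by simp
    qed
    show False using *[OF b(1,2) u] *[OF b(2,1) u[symmetric]] b(3) linear[of u u'] by blast
  qed
  define F where "F X = \<K> \<union> (\<lambda>b. {b, b + H b *\<^sub>R e}) ` X" for X
  have bodyF: "body (F X) = body \<K> \<union> (\<Union>b\<in>X. J b)" for X
    by (auto simp: F_def body_def J_def segment_convex_hull)
  have "X \<subseteq> ?F \<Longrightarrow> engulfed W (body (F X)) \<and> path_connected (body (F X))" if "finite X" for X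
    using that
  proof (induction X)
    case empty
    then show ?case using eng conn bodyF[of "{}"] by simp
  next
    case (insert b X)
    then have b: "b \<in> ?F" and IH: "engulfed W (body (F X))" "path_connected (body (F X))" by auto
    have bK: "b \<in> body \<K>" using foot[OF b] SK by (auto simp: body_def)
    have eq: "body (F (insert b X)) = body (F X) \<union> closed_segment b (b + H b *\<^sub>R e)"
      unfolding bodyF J_def[symmetric] by auto
    have "engulfed W (body (F X) \<union> closed_segment b (b + H b *\<^sub>R e))"
    proof (rule engulfed_segment)
      show "finite (F X)" using fin insert.hyps(1) by (simp add: F_def)
      show "finite s \<and> card s + 2 \<le> DIM('a)" if "s \<in> F X" for s
      proof (cases "s \<in> \<K>")
        case True then show ?thesis using \<K>[OF True] n n2 by linarith
      next
        case False
        then show ?thesis using that dim by (auto simp: F_def card_insert_if)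
      qed
      show "body (F X) \<subseteq> U" unfolding bodyF using U(1) JU insert.prems by blast
      show "b \<in> body (F X)" using bK bodyF by simp
      show "b + H b *\<^sub>R e \<in> body (F X)" using top[OF b] ZK bodyF by simp
      show "closed_segment b (b + H b *\<^sub>R e) \<subseteq> U" using JU[OF b] by (simp add: J_def)
      have "J b \<inter> body (F X) \<subseteq> insert b Z"
        unfolding bodyF using JK[OF b] JJ[OF b] insert by blast
      then show "finite (closed_segment b (b + H b *\<^sub>R e) \<inter> body (F X))"
        using \<open>finite Z\<close> finite_subset unfolding J_def by blast
    qed (use IH in auto)
    moreover have "path_connected (body (F X) \<union> closed_segment b (b + H b *\<^sub>R e))"
      using IH bK bodyF by (intro path_connected_Un) auto
    ultimately show ?case unfolding eq by simp
  qed
  from this[of ?F] have engA: "engulfed W (body (F ?F))" using \<open>finite Z\<close> by simp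
  have "engulfed W (body (F ?F) \<union> (\<Union>s\<in>\<S>. convex hull (insert w s)))"
  proof (rule engulfed_sweep[where v = v, OF engA _ W])
    show "closed (body (F ?F))"
      using fin \<K> \<open>finite Z\<close> by (intro compact_imp_closed compact_body) (auto simp: F_def)
    show "finite \<S>" using fin by (simp add: \<S>_def)
    show "convex hull s \<subseteq> body (F ?F)" if "s \<in> \<S>" for s
      using SK[OF that] bodyF by (auto simp: body_def)
    show "convex hull insert w s \<subseteq> W" if "s \<in> \<S>" for s
      using U(2) SK[OF that] UW by blast
    \<comment> \<open>The point lies either in the star, where it cannot descend, or on some
      \<open>J b\<close>. In the latter case it cannot pass below the foot, because the foot is in
      the star, and \<open>J b\<close> contains everything above.\<close>
    show "z - u *\<^sub>R (w - v) \<in> body (F ?F)"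
      if st: "s \<in> \<S>" "t \<in> \<S>" and z: "z \<in> body (F ?F)" "z \<in> convex hull insert w s" and u: "0 \<le> u"
        "z - u *\<^sub>R (w - v) \<in> convex hull insert w t" for s t z u
    proof -
      consider "z \<in> body \<S>" | b where "b \<in> ?F" "z \<in> J b"
        using meet[OF st(1) z(2)] z(1) inJ unfolding bodyF by blast
      then show ?thesis
      proof cases
        case 1
        then obtain s' where s': "s' \<in> \<S>" "z \<in> convex hull s'" by (auto simp: body_def)
        have "u = 0" by (rule nodesc[OF s'(1) st(2) s'(2) u(1)]) (use u(2) in \<open>simp add: e_def\<close>)
        then show ?thesis using z(1) by simp
      next
        case 2
        then obtain k where k: "0 \<le> k" "k \<le> H b" "z = b + k *\<^sub>R e" using Jeq by blast
        have eq: "z - u *\<^sub>R (w - v) = b - (u - k) *\<^sub>R e" using k(3) by (simp add: e_def algebra_simps)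
        have "u \<le> k"
        proof (rule ccontr)
          assume "\<not> u \<le> k"
          obtain s' where s': "s' \<in> \<S>" "b \<in> convex hull s'" using foot 2 by blast
          have "u - k = 0"
            by (rule nodesc[OF s'(1) st(2) s'(2)]) (use u(2) \<open>\<not> u \<le> k\<close> eq in simp_all)
          then show False using \<open>\<not> u \<le> k\<close> by simp
        qed
        moreover have "b - (u - k) *\<^sub>R e = b + (k - u) *\<^sub>R e" by (simp add: algebra_simps)
        ultimately have "b - (u - k) *\<^sub>R e \<in> J b" using Jeq[OF 2(1)] k u(1) by force
        then show ?thesis unfolding eq using 2(1) bodyF by blast
      qed
    qed
  qed (use SK in auto)
  then show ?thesis
  proof (rule engulfed_mono)
    show "body ((\<lambda>s. if v \<in> s then insert w (s - {v}) else s) ` \<K>)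
      \<subseteq> body (F ?F) \<union> (\<Union>s\<in>\<S>. convex hull (insert w s))"
    proof
      fix x assume "x \<in> body ((\<lambda>s. if v \<in> s then insert w (s - {v}) else s) ` \<K>)"
      then obtain s where s: "s \<in> \<K>" "x \<in> convex hull (if v \<in> s then insert w (s - {v}) else s)"
        by (auto simp: body_def)
      show "x \<in> body (F ?F) \<union> (\<Union>s\<in>\<S>. convex hull (insert w s))"
      proof (cases "v \<in> s")
        case True
        then have "x \<in> convex hull (insert w s)"
          using s(2) hull_mono[of "insert w (s - {v})" "insert w s" convex] by auto
        then show ?thesis using s(1) True by (auto simp: \<S>_def)
      next
        case False
        then show ?thesis using s bodyF by (auto simp: body_def)
      qed
    qed
  qed
qed

end

section \<open>Contractions, partitions of unity and nerves\<close>

definition contracts_in :: "'a::topological_space set \<Rightarrow> 'a set \<Rightarrow> bool" where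
  "contracts_in V U \<longleftrightarrow> (\<exists>h c. continuous_on ({0..1::real} \<times> V) h \<and> h ` ({0..1} \<times> V) \<subseteq> U \<and>
     (\<forall>x\<in>V. h (0, x) = x \<and> h (1, x) = c))"

text \<open>The form that cell-likeness takes for a subset of Euclidean space, the ambient retract
  being the whole type.\<close>

definition shape_trivial :: "'a::topological_space set \<Rightarrow> bool" where
  "shape_trivial Y \<longleftrightarrow>
     (\<forall>W. open W \<and> Y \<subseteq> W \<longrightarrow> (\<exists>U. open U \<and> Y \<subseteq> U \<and> U \<subseteq> W \<and> contracts_in U W))"

text \<open>A contraction may move base points, so it yields only a free null-homotopy of the loop
  made of \<open>p\<close> and the reversed \<open>q\<close>. This suffices to compare
  \<open>p\<close> and \<open>q\<close> relative to their ends.\<close>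

lemma contracts_in_imp_homotopic_paths:
  fixes U W :: "'a::real_normed_vector set"
  assumes "contracts_in U W" and p: "path p" "path_image p \<subseteq> U" and q: "path q" "path_image q \<subseteq> U"
    and ends: "pathstart q = pathstart p" "pathfinish q = pathfinish p"
  shows "homotopic_paths W p q"
proof -
  obtain h c where h: "continuous_on ({0..1::real} \<times> U) h" "h ` ({0..1} \<times> U) \<subseteq> W"
    "\<And>x. x \<in> U \<Longrightarrow> h (0, x) = x" "\<And>x. x \<in> U \<Longrightarrow> h (1, x) = c"
    using assms(1) unfolding contracts_in_def by blast
  define l where "l = p +++ reversepath q"
  have "path l" unfolding l_def using p q ends by simp
  have "path_image l \<subseteq> U" unfolding l_def using p q ends by (simp add: path_image_join)
  then have lU: "l x \<in> U" if "x \<in> {0..1}" for x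
    using that by (auto simp: path_image_def)
  have l01: "l 0 = l 1"
    using ends by (simp add: l_def joinpaths_def reversepath_def pathstart_def pathfinish_def)
  have "homotopic_loops W l (linepath c c)"
    unfolding homotopic_loops
  proof (intro exI[of _ "\<lambda>(t, s). h (t, l s)"] conjI ballI)
    have "continuous_on ({0..1} \<times> {0..1}) (h \<circ> (\<lambda>(t, s). (t, l s)))"
    proof (rule continuous_on_compose)
      have "continuous_on ({0..1::real} \<times> {0..1}) (\<lambda>z. l (snd z))"
        by (rule continuous_on_compose2[OF \<open>path l\<close>[unfolded path_def]]) (auto intro: continuous_intros)
      then show "continuous_on ({0..1::real} \<times> {0..1}) (\<lambda>(t, s). (t, l s))"
        by (simp add: case_prod_unfold continuous_on_Pair continuous_on_fst)
      show "continuous_on ((\<lambda>(t, s). (t, l s)) ` ({0..1} \<times> {0..1})) h"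
        by (rule continuous_on_subset[OF h(1)]) (auto simp: lU)
    qed
    then show "continuous_on ({0..1} \<times> {0..1}) (\<lambda>(t, s). h (t, l s))"
      by (simp add: comp_def case_prod_unfold)
    show "(\<lambda>(t, s). h (t, l s)) \<in> {0..1} \<times> {0..1} \<rightarrow> W"
      using h(2) lU by fastforce
  qed (use h lU l01 in \<open>auto simp: pathfinish_def pathstart_def linepath_refl\<close>)
  then show ?thesis unfolding l_def by (rule homotopic_paths_loop_parts[OF _ q(1)])
qed

text \<open>Within disjoint open neighbourhoods of two closed parts, each track of the contraction
  stays on the side where it starts, yet all tracks end at the same \<open>c\<close>.\<close>

lemma shape_trivial_connected:
  fixes Y :: "'a::metric_space set"
  assumes "shape_trivial Y" "compact Y"
  shows "connected Y"
proof (rule ccontr)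
  assume "\<not> connected Y"
  then obtain A B where AB: "closedin (top_of_set Y) A" "closedin (top_of_set Y) B" "A \<union> B = Y" "A \<inter> B = {}" "A \<noteq> {}" "B \<noteq> {}"
    unfolding connected_closedin_eq by blast
  then have "closed A" "closed B" using closedin_closed_trans compact_imp_closed[OF assms(2)] by blast+
  then obtain P Q where PQ: "open P" "open Q" "A \<subseteq> P" "B \<subseteq> Q" "P \<inter> Q = {}"
    using t4_space[of A B] AB(4) by metis
  then have "open (P \<union> Q)" "Y \<subseteq> P \<union> Q" using AB(3) by auto
  then obtain U where U: "Y \<subseteq> U" "contracts_in U (P \<union> Q)"
    using assms(1) unfolding shape_trivial_def by blast
  obtain h c where h: "continuous_on ({0..1::real} \<times> U) h" "h ` ({0..1} \<times> U) \<subseteq> P \<union> Q"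
    "\<And>x. x \<in> U \<Longrightarrow> h (0, x) = x" "\<And>x. x \<in> U \<Longrightarrow> h (1, x) = c"
    using U(2) unfolding contracts_in_def by blast
  have track: "connected ((\<lambda>t. h (t, x)) ` {0..1})" if "x \<in> U" for x
  proof (rule connected_continuous_image)
    show "continuous_on {0..1} (\<lambda>t. h (t, x))"
      by (rule continuous_on_compose2[OF h(1)]) (use that in \<open>auto intro!: continuous_intros\<close>)
  qed simp
  obtain a b where ab: "a \<in> A" "b \<in> B" using AB by blast
  then have abU: "a \<in> U" "b \<in> U" using U(1) AB(3) by auto
  have e: "x \<in> (\<lambda>t. h (t, x)) ` {0..1}" "c \<in> (\<lambda>t. h (t, x)) ` {0..1}" if "x \<in> U" for x
    using h(3,4)[OF that] by force+
  have s: "(\<lambda>t. h (t, x)) ` {0..1} \<subseteq> P \<union> Q" if "x \<in> U" for x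
    using h(2) that by auto
  have "c \<in> P"
    using connectedD[OF track[OF abU(1)] PQ(1,2)] PQ ab e[OF abU(1)] s[OF abU(1)] by blast
  moreover have "c \<in> Q"
    using connectedD[OF track[OF abU(2)] PQ(1,2)] PQ ab e[OF abU(2)] s[OF abU(2)] by blast
  ultimately show False using PQ by auto
qed

text \<open>The data of a map to a nerve: \<open>V\<close> indexes the vertices, the
  \<open>f v\<close> are barycentric coordinates, and \<open>p v\<close> marks a place in
  \<open>Y\<close> close to wherever \<open>f v\<close> is positive.\<close>

lemma covering_dim_partition:
  fixes Y :: "'b::metric_space set"
  assumes "compact Y" "Y \<noteq> {}" and dim: "covering_dim_le (top_of_set Y) (int n)" and "r > 0"
  obtains V :: "'b set set" and f :: "'b set \<Rightarrow> 'b \<Rightarrow> real" and p :: "'b set \<Rightarrow> 'b"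
    where "finite V" "\<forall>v\<in>V. continuous_on Y (f v) \<and> (\<forall>y\<in>Y. 0 \<le> f v y)"
      "\<forall>y\<in>Y. (\<Sum>v\<in>V. f v y) = 1 \<and> card {v \<in> V. 0 < f v y} \<le> n + 1"
      "\<forall>v\<in>V. p v \<in> Y \<and> (\<forall>y\<in>Y. 0 < f v y \<longrightarrow> dist (p v) y < r)"
proof -
  have "Y \<subseteq> \<Union> ((\<lambda>c. ball c (r/2)) ` Y)" using \<open>r > 0\<close> by auto
  then obtain C where C: "C \<subseteq> Y" "finite C" "Y \<subseteq> (\<Union>c\<in>C. ball c (r/2))"
    using compactE_image[OF \<open>compact Y\<close>, of Y "\<lambda>c. ball c (r/2)"] by auto
  define \<U> where "\<U> = (\<lambda>c. Y \<inter> ball c (r/2)) ` C"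
  have "finite \<U>" "\<forall>U\<in>\<U>. openin (top_of_set Y) U" "\<Union>\<U> = topspace (top_of_set Y)"
    using C by (auto simp: \<U>_def openin_open)
  then obtain \<V> where \<V>: "finite \<V>" "\<forall>v\<in>\<V>. openin (top_of_set Y) v" "\<Union>\<V> = Y"
    "\<forall>v\<in>\<V>. \<exists>u\<in>\<U>. v \<subseteq> u" "\<forall>x\<in>Y. int (card {v \<in> \<V>. x \<in> v}) \<le> int n + 1"
    using dim[unfolded covering_dim_le_def, THEN conjunct2, THEN spec, of \<U>] by auto
  \<comment> \<open>The refinement is open only relative to \<open>Y\<close>. Extending its members
    to open sets of the whole space leaves their traces, and hence the multiplicities at points of
    \<open>Y\<close>, unchanged.\<close>
  have "\<forall>v\<in>\<V>. \<exists>T. open T \<and> v = Y \<inter> T" using \<V>(2) by (auto simp: openin_open)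
  then obtain T where T: "\<And>v. v \<in> \<V> \<Longrightarrow> open (T v) \<and> v = Y \<inter> T v" by metis
  let ?V = "T ` \<V>"
  have finV: "finite ?V" using \<V>(1) by simp
  have cov: "Y \<subseteq> \<Union>?V" using \<V>(3) T by blast
  have op: "open t" if "t \<in> ?V" for t using that T by blast
  have lf: "\<exists>V. open V \<and> x \<in> V \<and> finite {U \<in> ?V. U \<inter> V \<noteq> {}}" for x
    using finV by (intro exI[of _ UNIV]) simp
  have "\<exists>F :: 'b set \<Rightarrow> 'b \<Rightarrow> real. (\<forall>U\<in>?V. continuous_on Y (F U) \<and> (\<forall>x\<in>Y. 0 \<le> F U x)) \<and>
      (\<forall>U\<in>?V. \<forall>x\<in>Y. x \<notin> U \<longrightarrow> F U x = 0) \<and> (\<forall>x\<in>Y. supp_sum (\<lambda>W. F W x) ?V = 1)"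
  proof (rule subordinate_partition_of_unity[OF cov op lf])
    fix F :: "'b set \<Rightarrow> 'b \<Rightarrow> real"
    assume F: "\<And>U. U \<in> ?V \<Longrightarrow> continuous_on Y (F U) \<and> (\<forall>x\<in>Y. 0 \<le> F U x)"
      "\<And>x U. U \<in> ?V \<Longrightarrow> x \<in> Y \<Longrightarrow> x \<notin> U \<Longrightarrow> F U x = 0"
      "\<And>x. x \<in> Y \<Longrightarrow> supp_sum (\<lambda>W. F W x) ?V = 1"
    show ?thesis by (rule exI[of _ F], intro conjI[OF _ conjI] ballI impI) (rule F, assumption+)+
  qed
  then obtain F :: "'b set \<Rightarrow> 'b \<Rightarrow> real" where
    FF: "\<forall>U\<in>?V. continuous_on Y (F U) \<and> (\<forall>x \<in> Y. 0 \<le> F U x)"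
      "\<forall>U\<in>?V. \<forall>x\<in>Y. x \<notin> U \<longrightarrow> F U x = 0" "\<forall>x\<in>Y. supp_sum (\<lambda>W. F W x) ?V = 1"
    by (elim exE conjE) (rule that)
  have F: "\<And>U. U \<in> ?V \<Longrightarrow> continuous_on Y (F U) \<and> (\<forall>x \<in> Y. 0 \<le> F U x)"
      "\<And>x U. \<lbrakk>U \<in> ?V; x \<in> Y; x \<notin> U\<rbrakk> \<Longrightarrow> F U x = 0"
      "\<And>x. x \<in> Y \<Longrightarrow> supp_sum (\<lambda>W. F W x) ?V = 1"
    using FF by (blast, blast, simp)
  have small: "dist x y < r" if v: "v \<in> ?V" and xy: "x \<in> Y" "y \<in> Y" "x \<in> v" "y \<in> v" for v x y
  proof -
    obtain w where w: "w \<in> \<V>" "v = T w" using v by blast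
    then have "x \<in> w" "y \<in> w" using T[OF w(1)] xy by auto
    moreover obtain u where "u \<in> \<U>" "w \<subseteq> u" using \<V>(4) w(1) by blast
    ultimately obtain c where "x \<in> ball c (r/2)" "y \<in> ball c (r/2)" unfolding \<U>_def by blast
    then show ?thesis using dist_triangle_half_r[of c x r y] by simp
  qed
  \<comment> \<open>A set missing \<open>Y\<close> is assigned an arbitrary point of
    \<open>Y\<close>, so that \<open>p v\<close> always lies in \<open>Y\<close>.\<close>
  define p where "p v = (if \<exists>y\<in>Y. y \<in> v then SOME y. y \<in> Y \<and> y \<in> v else SOME y. y \<in> Y)" for v
  have pY: "p v \<in> Y" for v
    unfolding p_def using someI_ex[of "\<lambda>y. y \<in> Y \<and> y \<in> v"] some_in_eq[of Y] \<open>Y \<noteq> {}\<close> by auto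
  have pv: "p v \<in> v" if "y \<in> Y" "y \<in> v" for v y
    unfolding p_def using someI_ex[of "\<lambda>y. y \<in> Y \<and> y \<in> v"] that by auto
  show thesis
  proof (rule that[of ?V F p]; (intro ballI conjI impI)?)
    show "finite ?V" by (rule finV)
    show "continuous_on Y (F v)" if "v \<in> ?V" for v using F(1)[OF that] by simp
    show "0 \<le> F v y" if "v \<in> ?V" "y \<in> Y" for v y using F(1)[OF that(1)] that(2) by simp
    show "(\<Sum>v\<in>?V. F v y) = 1" if y: "y \<in> Y" for y
    proof -
      have "(\<Sum>v\<in>support_on ?V (\<lambda>W. F W y). F v y) = (\<Sum>v\<in>?V. F v y)"
        by (rule sum.mono_neutral_left[OF finV]) (auto simp: support_on_def)
      then show ?thesis using F(3)[OF y] by (simp add: supp_sum_def)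
    qed
    show "card {v \<in> ?V. 0 < F v y} \<le> n + 1" if y: "y \<in> Y" for y
    proof -
      have "{v \<in> ?V. 0 < F v y} \<subseteq> T ` {v \<in> \<V>. y \<in> v}"
      proof
        fix v assume "v \<in> {v \<in> ?V. 0 < F v y}"
        then obtain w where w: "w \<in> \<V>" "v = T w" "0 < F v y" by blast
        then have "y \<in> v" using F(2)[of v y] y by force
        then show "v \<in> T ` {v \<in> \<V>. y \<in> v}" using w T[OF w(1)] y by blast
      qed
      then have "card {v \<in> ?V. 0 < F v y} \<le> card (T ` {v \<in> \<V>. y \<in> v})"
        using \<V>(1) by (intro card_mono) auto
      also have "\<dots> \<le> card {v \<in> \<V>. y \<in> v}" using \<V>(1) by (intro card_image_le) auto
      also have "\<dots> \<le> n + 1" using \<V>(5) y by fastforce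
      finally show ?thesis .
    qed
    show "p v \<in> Y" for v by (rule pY)
    show "dist (p v) y < r" if "v \<in> ?V" "y \<in> Y" "0 < F v y" for v y
    proof -
      have "y \<in> v" using F(2)[of v y] that by force
      then show ?thesis using small[OF that(1) pY that(2) pv] that(2) by blast
    qed
  qed
qed

text \<open>A coordinate positive at a point stays positive nearby, so the simplices of nearby
  points share a vertex. The relation \<open>R\<close>, that their vertices lie in one path
  component, thus holds locally and spreads over the connected \<open>Y\<close>.\<close>

lemma path_connected_nerve:
  fixes Y :: "'b::topological_space set" and f :: "'v \<Rightarrow> 'b \<Rightarrow> real" and pos :: "'v \<Rightarrow> 'a::real_normed_vector"
  assumes "connected Y" "finite V" and cont: "\<And>v. v \<in> V \<Longrightarrow> continuous_on Y (f v)"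
    and nonneg: "\<And>v y. v \<in> V \<Longrightarrow> y \<in> Y \<Longrightarrow> 0 \<le> f v y" and one: "\<And>y. y \<in> Y \<Longrightarrow> (\<Sum>v\<in>V. f v y) = 1"
  shows "path_connected (body ((\<lambda>y. pos ` {v \<in> V. 0 < f v y}) ` Y))"
proof -
  define s where "s y = {v \<in> V. 0 < f v y}" for y
  define P where "P = body ((\<lambda>y. pos ` s y) ` Y)"
  have simplex: "convex hull (pos ` s y) \<subseteq> P" if "y \<in> Y" for y
    using that by (auto simp: P_def body_def)
  have in_simplex: "path_component P x z" if "y \<in> Y" "x \<in> convex hull (pos ` s y)" "z \<in> convex hull (pos ` s y)" for x y z
    using path_component_of_subset[OF simplex[OF that(1)]] that
      convex_imp_path_connected[OF convex_convex_hull] path_connected_component by metis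
  have vertex: "pos v \<in> convex hull (pos ` s y)" if "v \<in> s y" for v y
    using that by (simp add: hull_inc)
  have ne: "s y \<noteq> {}" if "y \<in> Y" for y
  proof
    assume "s y = {}"
    then have "(\<Sum>v\<in>V. f v y) = 0"
      using nonneg that by (intro sum.neutral) (force simp: s_def)
    then show False using one[OF that] by simp
  qed
  define R where "R y y' \<longleftrightarrow> (\<forall>v\<in>s y. \<forall>w\<in>s y'. path_component P (pos v) (pos w))" for y y'
  have R: "R y y'" if "y \<in> Y" "y' \<in> Y" for y y'
  proof (rule connected_equivalence_relation[OF \<open>connected Y\<close> that, where R = R])
    show "R y x" if "R x y" for x y
      using that unfolding R_def by (meson path_component_sym)
    show "R x z" if "R x y" "R y z" "y \<in> Y" for x y z
      using that ne[OF that(3)] unfolding R_def by (meson path_component_trans ex_in_conv)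
    show "\<exists>T. openin (top_of_set Y) T \<and> a \<in> T \<and> (\<forall>x\<in>T. R a x)" if a: "a \<in> Y" for a
    proof -
      obtain v where v: "v \<in> s a" using ne[OF a] by blast
      then have "v \<in> V" by (simp add: s_def)
      define T where "T = Y \<inter> f v -` {0<..}"
      have "openin (top_of_set Y) T"
        unfolding T_def by (rule continuous_openin_preimage_gen[OF cont[OF \<open>v \<in> V\<close>]]) simp
      moreover have "a \<in> T" using v a by (simp add: T_def s_def)
      moreover have "R a x" if "x \<in> T" for x
        unfolding R_def
      proof (intro ballI)
        fix v1 v2 assume "v1 \<in> s a" "v2 \<in> s x"
        moreover have "x \<in> Y" "v \<in> s x" using that \<open>v \<in> V\<close> by (auto simp: T_def s_def)
        ultimately show "path_component P (pos v1) (pos v2)"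
          using in_simplex[OF a vertex vertex] in_simplex[OF \<open>x \<in> Y\<close> vertex vertex] v
          by (meson path_component_trans)
      qed
      ultimately show ?thesis by blast
    qed
  qed
  have "path_component P x z" if x: "x \<in> P" and z: "z \<in> P" for x z
  proof -
    obtain y where y: "y \<in> Y" "x \<in> convex hull (pos ` s y)" using x by (auto simp: P_def body_def)
    obtain y' where y': "y' \<in> Y" "z \<in> convex hull (pos ` s y')" using z by (auto simp: P_def body_def)
    obtain v w where vw: "v \<in> s y" "w \<in> s y'" using ne y y' by blast
    have "path_component P x (pos v)" using in_simplex[OF y vertex[OF vw(1)]] .
    moreover have "path_component P (pos v) (pos w)" using R[OF y(1) y'(1)] vw by (simp add: R_def)
    moreover have "path_component P (pos w) z" using in_simplex[OF y'(1) vertex[OF vw(2)] y'(2)] .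
    ultimately show ?thesis by (meson path_component_trans)
  qed
  then show ?thesis unfolding P_def s_def path_connected_component by blast
qed

lemma engulfed_ball:
  fixes c :: "'a::euclidean_space"
  assumes "r > 0" "A \<subseteq> ball c r" "cball c r \<subseteq> W"
  shows "engulfed W A"
proof -
  let ?h = "\<lambda>x. c + r *\<^sub>R x" and ?g = "\<lambda>x. (1 / r) *\<^sub>R (x - c)"
  have "homeomorphism UNIV UNIV ?h ?g"
    using \<open>r > 0\<close> by (intro homeomorphismI) (auto intro!: continuous_intros)
  moreover have "x \<in> ?h ` ball 0 1" if "x \<in> A" for x
  proof
    show "x = ?h (?g x)" using \<open>r > 0\<close> by simp
    have "norm (x - c) < r" using assms(2) that by (auto simp: dist_norm norm_minus_commute)
    then have "norm (x - c) / r < 1" using \<open>r > 0\<close> by simp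
    then show "?g x \<in> ball 0 1" using \<open>r > 0\<close> by simp
  qed
  moreover have "?h ` cball 0 1 \<subseteq> cball c r"
    using \<open>r > 0\<close> by (auto simp: dist_norm)
  ultimately have "homeomorphism UNIV UNIV ?h ?g \<and> A \<subseteq> ?h ` ball 0 1 \<and> ?h ` cball 0 1 \<subseteq> W"
    using assms(3) by blast
  then show ?thesis unfolding engulfed_def by (intro exI)
qed

section \<open>Approximation in dimension at least two\<close>

lemma shape_trivialE:
  assumes "shape_trivial Y" "open W" "Y \<subseteq> W"
  obtains U where "open U" "Y \<subseteq> U" "U \<subseteq> W" "contracts_in U W"
  using assms(1)[unfolded shape_trivial_def, THEN spec, of W] assms(2,3) by auto

lemma contracts_inE:
  assumes "contracts_in V U"
  obtains h c where "continuous_on ({0..1::real} \<times> V) h" "h ` ({0..1} \<times> V) \<subseteq> U"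
    "\<forall>x\<in>V. h (0, x) = x \<and> h (1, x) = c"
  using assms unfolding contracts_in_def by (elim exE conjE)

lemma contracts_in_subset:
  assumes "contracts_in V U" "V' \<subseteq> V"
  shows "contracts_in V' U"
proof -
  obtain h c where h: "continuous_on ({0..1::real} \<times> V) h" "h ` ({0..1} \<times> V) \<subseteq> U"
    "\<forall>x\<in>V. h (0, x) = x \<and> h (1, x) = c"
    using assms(1) by (rule contracts_inE)
  have sub: "{0..1::real} \<times> V' \<subseteq> {0..1} \<times> V" using assms(2) by auto
  show ?thesis unfolding contracts_in_def
  proof (intro exI conjI ballI)
    show "continuous_on ({0..1} \<times> V') h" by (rule continuous_on_subset[OF h(1) sub])
    show "h ` ({0..1} \<times> V') \<subseteq> U" using h(2) sub by blast
    show "h (0, x) = x" "h (1, x) = c" if "x \<in> V'" for x using h(3) that assms(2) by auto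
  qed
qed

lemma nerve_sum_in_simplex:
  fixes q :: "'v \<Rightarrow> 'a::real_vector"
  assumes "finite V" "\<And>v. v \<in> V \<Longrightarrow> 0 \<le> c v" "sum c V = (1::real)"
  shows "(\<Sum>v\<in>V. c v *\<^sub>R q v) \<in> convex hull (q ` {v \<in> V. 0 < c v})"
proof -
  have e: "(\<Sum>v\<in>{v \<in> V. 0 < c v}. c v *\<^sub>R q v) = (\<Sum>v\<in>V. c v *\<^sub>R q v)"
    "sum c {v \<in> V. 0 < c v} = sum c V"
    using assms(1,2) by (intro sum.mono_neutral_left; force)+
  show ?thesis unfolding e(1)[symmetric]
    using assms e by (intro convex_sum) (auto simp: hull_inc)
qed

lemma engulfed_approximation_ge_2:
  fixes Y :: "'a::euclidean_space set"
  assumes Y: "compact Y" "Y \<noteq> {}" and dim: "covering_dim_le (top_of_set Y) (int n)"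
    and n: "DIM('a) = 2 * n + 1" "2 \<le> n" and shape: "shape_trivial Y" and "0 < \<epsilon>"
  obtains k where "continuous_on Y k" "\<And>y. y \<in> Y \<Longrightarrow> dist (k y) y < \<epsilon>"
    "engulfed {x. infdist x Y < \<epsilon>} (k ` Y)"
proof -
  define W where "W = {x. infdist x Y < \<epsilon>}"
  have "open W" unfolding W_def by (intro open_Collect_less continuous_intros)
  have "Y \<subseteq> W" using \<open>0 < \<epsilon>\<close> by (auto simp: W_def)
  obtain U where U: "open U" "Y \<subseteq> U" "U \<subseteq> W" "contracts_in U W"
    by (rule shape_trivialE[OF shape \<open>open W\<close> \<open>Y \<subseteq> W\<close>])
  note hom = contracts_in_imp_homotopic_paths[OF U(4)]
  \<comment> \<open>The tracks of this second contraction have to stay in \<open>U\<close>, where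
    paths with common ends are homotopic in \<open>W\<close>.\<close>
  obtain U' where U': "Y \<subseteq> U'" "contracts_in U' U"
    by (rule shape_trivialE[OF shape U(1,2)])
  obtain h c where h: "continuous_on ({0..1::real} \<times> Y) h" "h ` ({0..1} \<times> Y) \<subseteq> U"
    and h01: "\<forall>x\<in>Y. h (0, x) = x \<and> h (1, x) = c"
    by (rule contracts_inE[OF contracts_in_subset[OF U'(2,1)]])
  have h0: "h (0, x) = x" and h1: "h (1, x) = c" if "x \<in> Y" for x using h01 that by auto
  let ?I = "{0..1::real} \<times> Y"
  have cI: "compact ?I" by (intro compact_Times compact_Icc Y)
  have him: "compact (h ` ?I)" "h ` ?I \<noteq> {}"
    using compact_continuous_image[OF h(1) cI] Y(2) by auto
  obtain d where d: "d > 0" "{x. infdist x (h ` ?I) \<le> d} \<subseteq> U"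
    using compact_in_open_separated[OF him(2,1) U(1) h(2)] by blast
  define r where "r = min d \<epsilon> / 4"
  have r: "r > 0" "2 * r \<le> d" "2 * r < \<epsilon>" using d(1) \<open>0 < \<epsilon>\<close> by (auto simp: r_def)
  have ballU: "cball x (2 * r) \<subseteq> U" if "x \<in> h ` ?I" for x
  proof
    fix z assume "z \<in> cball x (2 * r)"
    then have "dist z x \<le> d" using r by (simp add: dist_commute)
    with that have "infdist z (h ` ?I) \<le> d" by (rule infdist_le2)
    then show "z \<in> U" using d(2) by blast
  qed
  obtain \<delta> where \<delta>: "\<delta> > 0" "\<And>x y. x \<in> ?I \<Longrightarrow> y \<in> ?I \<Longrightarrow> dist y x < \<delta> \<Longrightarrow> dist (h y) (h x) < r"
    using compact_uniformly_continuous[OF h(1) cI] r(1) unfolding uniformly_continuous_on_def by meson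
  obtain N :: nat where N: "2 / \<delta> < real N" using reals_Archimedean2 by blast
  then have N0: "0 < N" using \<delta>(1) by (cases "N = 0") (auto simp: divide_less_0_iff)
  have N1: "1 / real N < \<delta> / 2" using N N0 \<delta>(1) by (simp add: field_simps)
  obtain V :: "'a set set" and f :: "'a set \<Rightarrow> 'a \<Rightarrow> real" and p where
    P: "finite V" "\<forall>v\<in>V. continuous_on Y (f v) \<and> (\<forall>y\<in>Y. 0 \<le> f v y)"
      "\<forall>y\<in>Y. (\<Sum>v\<in>V. f v y) = 1 \<and> card {v \<in> V. 0 < f v y} \<le> n + 1"
      "\<forall>v\<in>V. p v \<in> Y \<and> (\<forall>y\<in>Y. 0 < f v y \<longrightarrow> dist (p v) y < \<delta> / 2)"
    by (rule covering_dim_partition[OF Y dim half_gt_zero[OF \<delta>(1)]])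
  have V: "finite V" "\<And>v. v \<in> V \<Longrightarrow> continuous_on Y (f v)" "\<And>v y. v \<in> V \<Longrightarrow> y \<in> Y \<Longrightarrow> 0 \<le> f v y"
      "\<And>y. y \<in> Y \<Longrightarrow> (\<Sum>v\<in>V. f v y) = 1" "\<And>y. y \<in> Y \<Longrightarrow> card {v \<in> V. 0 < f v y} \<le> n + 1"
      "\<And>v. v \<in> V \<Longrightarrow> p v \<in> Y" "\<And>v y. v \<in> V \<Longrightarrow> y \<in> Y \<Longrightarrow> 0 < f v y \<Longrightarrow> dist (p v) y < \<delta> / 2"
    using P by blast+
  have conn: "connected Y" by (rule shape_trivial_connected[OF shape Y(1)])
  define t where "t k = real k / real N" for k
  have t01: "t k \<in> {0..1}" if "k \<le> N" for k using that N0 by (auto simp: t_def)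
  have fin: "finite (V \<times> {0..N})" using V(1) by simp
  obtain q :: "'a set \<times> nat \<Rightarrow> 'a" where q: "inj_on q (V \<times> {0..N})" "q ` (V \<times> {0..N}) \<inter> {} = {}"
    "\<forall>j\<in>V \<times> {0..N}. dist (q j) (case j of (v, k) \<Rightarrow> h (t k, p v)) < r"
    "generic_over {} (q ` (V \<times> {0..N}))"
    by (rule generic_over_family[OF fin finite.emptyI r(1), of "\<lambda>(v, k). h (t k, p v)"])
  define G where "G = q ` (V \<times> {0..N})"
  define s where "s y = {v \<in> V. 0 < f v y}" for y
  have near: "dist (q (v, k')) (h (t k, y)) < 2 * r"
    if "y \<in> Y" "v \<in> s y" "k \<le> N" "k' \<le> N" "\<bar>real k' - real k\<bar> \<le> 1" for y v k k'
  proof -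
    have v: "v \<in> V" "p v \<in> Y" "dist (p v) y < \<delta> / 2" using that V(6,7) by (auto simp: s_def)
    have "dist (t k', p v) (t k, y) \<le> dist (t k') (t k) + dist (p v) y"
      unfolding dist_Pair_Pair by (rule sqrt_sum_squares_le_sum) auto
    also have "dist (t k') (t k) = \<bar>real k' - real k\<bar> / real N"
      by (simp add: t_def dist_real_def flip: diff_divide_distrib)
    also have "\<dots> \<le> 1 / real N" using that by (intro divide_right_mono) auto
    finally have "dist (t k', p v) (t k, y) < \<delta>" using v(3) N1 by linarith
    moreover have "(t k, y) \<in> ?I" "(t k', p v) \<in> ?I" using that v t01 by auto
    ultimately have "dist (h (t k', p v)) (h (t k, y)) < r" using \<delta>(2) by blast
    moreover have "dist (q (v, k')) (h (t k', p v)) < r" using bspec[OF q(3), of "(v, k')"] v that by simp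
    ultimately show ?thesis
      using dist_triangle[of "q (v, k')" "h (t k, y)" "h (t k', p v)"] by linarith
  qed
  define \<K> where "\<K> pos = (\<lambda>y. pos ` s y) ` Y" for pos :: "'a set \<Rightarrow> 'a"
  have fin\<K>: "finite (\<K> pos)" for pos
  proof -
    have "s ` Y \<subseteq> Pow V" by (auto simp: s_def)
    then have "finite (s ` Y)" using V(1) finite_subset by blast
    then show ?thesis by (simp add: \<K>_def flip: image_image)
  qed
  have fins: "finite (s y)" for y using V(1) by (simp add: s_def)
  have pc: "path_connected (body (\<K> pos))" for pos
    unfolding \<K>_def s_def using path_connected_nerve[OF conn V(1) V(2) V(3) V(4)] by blast
  have step: "engulfed W (body (\<K> (\<lambda>v. q (v, k))))" if k: "k < N" and IH: "engulfed W (body (\<K> (\<lambda>v. q (v, Suc k))))" for k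
  proof -
    \<comment> \<open>The vertices in \<open>M\<close> have already moved from time
      \<open>k + 1\<close> back to time \<open>k\<close>. The positions at all times are jointly
      generic, so every intermediate complex is in general position with the next target.\<close>
    define pos where "pos M v = (if v \<in> M then q (v, k) else q (v, Suc k))" for M v
    have posinj: "inj_on (pos M) V" for M
      using inj_onD[OF q(1)] k by (intro inj_onI) (fastforce simp: pos_def split: if_splits)
    have posG: "pos M v \<in> G" if "v \<in> V" for M v
      using that k by (auto simp: pos_def G_def)
    have hI: "h (t k, y) \<in> h ` ?I" if "y \<in> Y" for y using that t01[of k] k by auto
    have posball: "pos M v \<in> cball (h (t k, y)) (2 * r)" if "y \<in> Y" "v \<in> s y" for M v y
      using near[OF that, of k k] near[OF that, of k "Suc k"] k
      by (auto simp: pos_def dist_commute intro: less_imp_le)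
    have "engulfed W (body (\<K> (pos M)))" if "finite M" "M \<subseteq> V" for M
      using that
    proof (induction M)
      case empty
      then show ?case using IH by (simp add: pos_def)
    next
      case (insert v M)
      let ?K = "\<K> (pos M)" and ?v = "q (v, Suc k)" and ?w = "q (v, k)"
      have vV: "v \<in> V" using insert.prems by simp
      have vM: "pos M v = ?v" using insert.hyps by (simp add: pos_def)
      have mem: "?v \<in> pos M ` s y \<longleftrightarrow> v \<in> s y" for y
        using inj_on_image_mem_iff[OF posinj vV, of "s y" M] unfolding vM by (auto simp: s_def)
      have UK: "\<Union>?K \<subseteq> pos M ` V" by (auto simp: \<K>_def s_def)
      have "engulfed W (body ((\<lambda>s. if ?v \<in> s then insert ?w (s - {?v}) else s) ` ?K))"
      proof (rule engulfed_move_vertex[OF \<open>open W\<close> _ _ n(1)])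
        show "4 \<le> DIM('a)" using n by simp
        show "homotopic_paths W p q"
          if "path p" "path q" "path_image p \<subseteq> U" "path_image q \<subseteq> U" "pathstart q = pathstart p"
            "pathfinish q = pathfinish p" for p q
          using hom[OF that(1,3,2,4,5,6)] .
        show "finite ?K" by (rule fin\<K>)
        show "finite s' \<and> card s' \<le> n + 1" if "s' \<in> ?K" for s'
        proof -
          obtain y where y: "y \<in> Y" "s' = pos M ` s y" using \<open>s' \<in> ?K\<close> by (auto simp: \<K>_def)
          have "card s' \<le> card (s y)" unfolding y(2) by (rule card_image_le[OF fins])
          then show ?thesis using V(5)[OF y(1)] y fins by (simp add: s_def)
        qed
        have "insert ?w (\<Union>?K) \<subseteq> G" using UK posG vV k by (auto simp: G_def)
        then show "generic_over {} (insert ?w (\<Union>?K))"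
          using q(4) generic_over_mono unfolding G_def by blast
        have "?w \<notin> pos M ` V"
          using inj_onD[OF q(1)] k insert.hyps(2) vV by (fastforce simp: pos_def split: if_splits)
        then show "?w \<notin> \<Union>?K" using UK by blast
        show "engulfed W (body ?K)" using insert by simp
        show "path_connected (body ?K)" by (rule pc)
        show "body ?K \<subseteq> U"
        proof -
          have "convex hull (pos M ` s y) \<subseteq> U" if "y \<in> Y" for y
          proof -
            have "convex hull (pos M ` s y) \<subseteq> cball (h (t k, y)) (2 * r)"
              using posball[OF that] by (intro hull_minimal) blast+
            then show ?thesis using ballU[OF hI[OF that]] by blast
          qed
          then show ?thesis by (auto simp: body_def \<K>_def)
        qed
        show "convex hull insert ?w s' \<subseteq> U" if s': "s' \<in> ?K" "?v \<in> s'" for s'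
        proof -
          obtain y where y: "y \<in> Y" "s' = pos M ` s y" using s' by (auto simp: \<K>_def)
          then have "v \<in> s y" using s'(2) mem by simp
          then have "?w \<in> cball (h (t k, y)) (2 * r)"
            using near[OF y(1), of v k k] k by (simp add: dist_commute less_imp_le)
          then have "convex hull insert ?w s' \<subseteq> cball (h (t k, y)) (2 * r)"
            using posball[OF y(1)] unfolding y(2) by (intro hull_minimal) auto
          then show ?thesis using ballU[OF hI[OF y(1)]] by blast
        qed
        show "U \<subseteq> W" by (rule U(3))
      qed
      moreover have "(\<lambda>s. if ?v \<in> s then insert ?w (s - {?v}) else s) ` ?K = \<K> (pos (insert v M))"
      proof -
        have *: "(if ?v \<in> pos M ` s y then insert ?w (pos M ` s y - {?v}) else pos M ` s y)
            = pos (insert v M) ` s y" for y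
        proof (cases "v \<in> s y")
          case True
          have "pos M ` s y - {?v} = pos M ` (s y - {v})"
            using inj_on_image_set_diff[OF posinj, of "s y" "{v}" M] vV vM by (auto simp: s_def)
          also have "\<dots> = pos (insert v M) ` (s y - {v})" by (auto simp: pos_def)
          finally have eq: "pos M ` s y - {?v} = pos (insert v M) ` (s y - {v})" .
          have "pos (insert v M) v = ?w" by (simp add: pos_def)
          then have "insert ?w (pos M ` s y - {?v}) = pos (insert v M) ` insert v (s y - {v})"
            unfolding eq image_insert by simp
          then show ?thesis using True mem by (simp add: insert_absorb)
        next
          case False
          then show ?thesis using mem by (auto simp: pos_def image_iff)
        qed
        show ?thesis unfolding \<K>_def image_image by (rule image_cong[OF refl *])
      qed
      ultimately show ?case by simp
    qed
    from this[of V] have "engulfed W (body (\<K> (pos V)))" using V(1) by simp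
    moreover have "\<K> (pos V) = \<K> (\<lambda>v. q (v, k))"
      by (auto simp: \<K>_def pos_def s_def image_iff)
    ultimately show ?thesis by simp
  qed
  \<comment> \<open>At time \<open>N\<close> the contraction is constant, so all vertices lie in one
    small ball about \<open>c\<close>.\<close>
  have start: "engulfed W (body (\<K> (\<lambda>v. q (v, N))))"
  proof (rule engulfed_ball)
    obtain y0 where y0: "y0 \<in> Y" using Y(2) by blast
    have tN: "t N = 1" using N0 by (simp add: t_def)
    have cI: "c \<in> h ` ?I" using h1[OF y0] y0 by (metis atLeastAtMost_iff image_eqI mem_Sigma_iff order_refl zero_le_one)
    show "2 * r > 0" using r by simp
    show "cball c (2 * r) \<subseteq> W" using ballU[OF cI] U(3) by blast
    have "convex hull ((\<lambda>v. q (v, N)) ` s y) \<subseteq> ball c (2 * r)" if "y \<in> Y" for y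
      using near[OF that, of _ N N] h1[OF that] by (intro hull_minimal) (auto simp: dist_commute tN)
    then show "body (\<K> (\<lambda>v. q (v, N))) \<subseteq> ball c (2 * r)" by (auto simp: body_def \<K>_def)
  qed
  have "engulfed W (body (\<K> (\<lambda>v. q (v, N - j))))" if "j \<le> N" for j
    using that
  proof (induction j)
    case 0
    then show ?case using start by simp
  next
    case (Suc j)
    then show ?case using step[of "N - Suc j"] by (simp add: Suc_diff_Suc)
  qed
  from this[of N] have final: "engulfed W (body (\<K> (\<lambda>v. q (v, 0))))" by simp
  define k where "k y = (\<Sum>v\<in>V. f v y *\<^sub>R q (v, 0))" for y
  have kin: "k y \<in> convex hull ((\<lambda>v. q (v, 0)) ` s y)" if "y \<in> Y" for y
    unfolding k_def s_def using V that by (intro nerve_sum_in_simplex) auto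
  show thesis
  proof (rule that[of k])
    show "continuous_on Y k" unfolding k_def by (intro continuous_intros V(2))
    show "dist (k y) y < \<epsilon>" if "y \<in> Y" for y
    proof -
      have t0: "t 0 = 0" by (simp add: t_def)
      have "convex hull ((\<lambda>v. q (v, 0)) ` s y) \<subseteq> ball y (2 * r)"
        using near[OF that, of _ 0 0] h0[OF that] by (intro hull_minimal) (auto simp: dist_commute t0)
      then show ?thesis using kin[OF that] r(3) by (auto simp: dist_commute)
    qed
    have "k ` Y \<subseteq> body (\<K> (\<lambda>v. q (v, 0)))" using kin by (auto simp: body_def \<K>_def)
    then show "engulfed {x. infdist x Y < \<epsilon>} (k ` Y)"
      using engulfed_mono[OF final] by (simp add: W_def)
  qed
qed

section \<open>Reduced walks and trees\<close>

text \<open>Walks in a graph are lists of vertices with the current end at the head. Removing backtracking at every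
  step makes the reduced walks the vertices of the universal covering tree, in which two walks are
  adjacent if one extends the other by one vertex.\<close>

fun walk_step :: "'l \<Rightarrow> 'l list \<Rightarrow> 'l list" where
  "walk_step a (x # y # r) = (if a = x then x # y # r else if a = y then y # r else a # x # y # r)"
| "walk_step a [x] = (if a = x then [x] else [a, x])"
| "walk_step a [] = [a]"

fun reduced :: "'l list \<Rightarrow> bool" where
  "reduced (x # y # z # r) \<longleftrightarrow> x \<noteq> y \<and> x \<noteq> z \<and> reduced (y # z # r)"
| "reduced [x, y] \<longleftrightarrow> x \<noteq> y"
| "reduced _ \<longleftrightarrow> True"

definition walk_adj :: "'l list \<Rightarrow> 'l list \<Rightarrow> bool" where
  "walk_adj r s \<longleftrightarrow> r = s \<or> (\<exists>a. r = a # s) \<or> (\<exists>a. s = a # r)"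

lemma walk_step_nonempty [simp]: "walk_step a r \<noteq> []"
  by (induction a r rule: walk_step.induct) auto

lemma hd_walk_step [simp]: "hd (walk_step a r) = a"
  by (induction a r rule: walk_step.induct) auto

lemma last_walk_step: "r \<noteq> [] \<Longrightarrow> last (walk_step a r) = last r"
  by (induction a r rule: walk_step.induct) auto

lemma reduced_walk_step:
  assumes "reduced r" shows "reduced (walk_step a r)"
proof -
  consider "r = []" | x where "r = [x]" | x y where "r = [x, y]" | x y z s where "r = x # y # z # s"
    by (metis list.exhaust)
  then show ?thesis using assms by cases auto
qed

lemma successively_walk_step:
  assumes "successively E r" "r \<noteq> []" "E a (hd r)"
  shows "successively E (walk_step a r)"
  using assms by (induction a r rule: walk_step.induct) (auto simp: successively_Cons)

lemma walk_step_hd: "walk_step x (x # r) = x # r"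
  by (cases r) auto

lemma walk_adj_walk_step: "walk_adj (x # r) (walk_step a (x # r))"
proof -
  have "walk_step a (x # r) = x # r \<or> walk_step a (x # r) = a # x # r \<or> walk_step a (x # r) = r"
    by (cases r) (auto split: if_splits)
  then show ?thesis by (auto simp: walk_adj_def)
qed

lemma walk_adj_sym: "walk_adj r s \<Longrightarrow> walk_adj s r"
  by (auto simp: walk_adj_def)

text \<open>Both steps go to \<open>c\<close> or to \<open>hd s\<close>, the only labels available.
  From either walk such a step leads to \<open>c # s\<close> or to \<open>s\<close>; reducedness
  ensures that prepending \<open>c\<close> to \<open>s\<close> is not a backtracking.\<close>

lemma walk_step_adj_aux:
  assumes "reduced (c # s)" "s \<noteq> []" "{c, hd s, a, b} \<subseteq> {p, q}"
  shows "walk_adj (walk_step a (c # s)) (walk_step b s)"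
proof -
  obtain x s' where s: "s = x # s'" using assms(2) by (cases s) auto
  have "c \<noteq> x" using assms(1) s by (cases s') auto
  then have a: "a = c \<or> a = x" and b: "b = c \<or> b = x" using assms(3) s by auto
  have "walk_step a (c # s) \<in> {c # s, s}" using a \<open>c \<noteq> x\<close> s by auto
  moreover have "walk_step b s \<in> {c # s, s}"
    using b \<open>c \<noteq> x\<close> s assms(1) by (cases s') auto
  ultimately show ?thesis by (auto simp: walk_adj_def)
qed

text \<open>All labels belong to one edge of the nerve, and an edge lifts to the tree without
  branching. The pair \<open>{p, q}\<close> reflects a cover of multiplicity at most two.\<close>

lemma walk_step_adj:
  assumes "reduced r" "reduced s" "r \<noteq> []" "s \<noteq> []" "walk_adj r s" "{hd r, hd s, a, b} \<subseteq> {p, q}"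
  shows "walk_adj (walk_step a r) (walk_step b s)"
proof -
  consider "r = s" | c where "r = c # s" | c where "s = c # r" using assms(5) by (auto simp: walk_adj_def)
  then show ?thesis
  proof cases
    case 1
    obtain x r' where r: "r = x # r'" using assms(3) by (cases r) auto
    have "a = b \<or> a = x \<or> b = x" using assms(6) 1 r by auto
    then consider "a = b" | "a = x" | "b = x" by blast
    then show ?thesis
    proof cases
      case 1
      then show ?thesis using \<open>r = s\<close> by (simp add: walk_adj_def)
    next
      case 2
      then show ?thesis using \<open>r = s\<close> r walk_adj_walk_step by (metis walk_step_hd)
    next
      case 3
      then show ?thesis using \<open>r = s\<close> r walk_adj_walk_step walk_adj_sym by (metis walk_step_hd)
    qed
  next
    case 2
    then show ?thesis using walk_step_adj_aux[of c s a b p q] assms by auto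
  next
    case 3
    then show ?thesis using walk_step_adj_aux[of c r b a p q] assms walk_adj_sym by auto
  qed
qed

text \<open>A tree contains no triangle: two different extensions of a shortest walk are not
  adjacent.\<close>

lemma walk_adj_clique:
  assumes "S \<noteq> {}" "\<And>r s. r \<in> S \<Longrightarrow> s \<in> S \<Longrightarrow> walk_adj r s"
  shows "\<exists>r\<in>S. S = {r} \<or> (\<exists>a. S = {r, a # r})"
proof -
  define r where "r = arg_min length (\<lambda>r. r \<in> S)"
  have r: "r \<in> S" "\<And>s. s \<in> S \<Longrightarrow> length r \<le> length s"
    using arg_min_nat_lemma[of "\<lambda>r. r \<in> S" _ length] assms(1) unfolding r_def by auto
  have *: "s = r \<or> (\<exists>a. s = a # r)" if "s \<in> S" for s
    using assms(2)[OF r(1) that] r(2)[OF that] by (auto simp: walk_adj_def)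
  show ?thesis
  proof (cases "S = {r}")
    case False
    then obtain s where s: "s \<in> S" "s \<noteq> r" using r(1) by blast
    then obtain a where a: "s = a # r" using * by blast
    have "s' = r \<or> s' = s" if "s' \<in> S" for s'
      using *[OF that] assms(2)[OF that s(1)] a by (auto simp: walk_adj_def)
    then have "S = {r, a # r}" using r(1) s a by blast
    then show ?thesis using r(1) by blast
  qed (use r in blast)
qed

text \<open>Each walk is joined to its parent, which is its tail. A walk with a single label is a
  root and gives a degenerate edge, so its point still belongs to the body.\<close>

definition walk_edges :: "('l list \<Rightarrow> 'a) \<Rightarrow> 'l list set \<Rightarrow> 'a set set" where
  "walk_edges q \<T> = (\<lambda>t. {q t, q (if tl t = [] then t else tl t)}) ` \<T>"

text \<open>A longest walk is a leaf, and the ball around the rest is pushed along the edge to it.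
  This edge and any other have at most four vertices, so for \<open>3 \<le> DIM('a)\<close> they can
  meet only in the point of the parent.\<close>

lemma engulfed_tree:
  fixes q :: "'l list \<Rightarrow> 'a::euclidean_space"
  assumes "finite \<T>" "\<T> \<noteq> {}" "[] \<notin> \<T>" and tl: "\<And>a t. a # t \<in> \<T> \<Longrightarrow> t \<noteq> [] \<Longrightarrow> t \<in> \<T>"
    and root: "\<And>t. t \<in> \<T> \<Longrightarrow> last t = z"
    and inj: "inj_on q \<T>" and gen: "generic_over {} (q ` \<T>)" and dim: "3 \<le> DIM('a)" and W: "open W"
    and qW: "q ` \<T> \<subseteq> W" "\<And>a t. a # t \<in> \<T> \<Longrightarrow> t \<noteq> [] \<Longrightarrow> closed_segment (q (a # t)) (q t) \<subseteq> W"
  shows "engulfed W (body (walk_edges q \<T>))"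
  using assms
proof (induction "card \<T>" arbitrary: \<T> rule: less_induct)
  case less
  define t where "t = (ARG_MAX length t. t \<in> \<T>)"
  have "\<exists>b. \<forall>t. t \<in> \<T> \<longrightarrow> length t < b"
    using less.prems(1) by (intro exI[of _ "Suc (Max (length ` \<T>))"]) (simp add: less_Suc_eq_le)
  then have t: "t \<in> \<T>" "\<And>s. s \<in> \<T> \<Longrightarrow> length s \<le> length t"
    using arg_max_nat_lemma[of "\<lambda>t. t \<in> \<T>" _ length] less.prems(2) unfolding t_def by blast+
  obtain a s where as: "t = a # s" using t(1) less.prems(3) by (cases t) auto
  show ?case
  proof (cases "s = []")
    case True
    have "u = [z]" if u: "u \<in> \<T>" for u
    proof -
      obtain b where "u = [b]" using t(2)[OF u] u less.prems(3) as True
        by (cases u) auto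
      then show ?thesis using less.prems(5)[OF u] by simp
    qed
    then have T: "\<T> = {[z]}" using t(1) by blast
    obtain r where r: "r > 0" "cball (q [z]) r \<subseteq> W"
      using less.prems(9,10) T open_contains_cball by (metis image_subset_iff singletonI)
    have "body (walk_edges q \<T>) \<subseteq> ball (q [z]) r" using T r(1) by (simp add: body_def walk_edges_def)
    then show ?thesis using engulfed_ball r by blast
  next
    case False
    then have sT: "s \<in> \<T>" using less.prems(4)[of a s] t(1) as by simp
    let ?T = "\<T> - {t}"
    have sT': "s \<in> ?T" using sT as by auto
    have tlT: "u \<in> ?T" if "b # u \<in> ?T" "u \<noteq> []" for b u
      using less.prems(4)[of b u] that t(2)[of "b # u"] by auto
    have IH: "engulfed W (body (walk_edges q ?T))"
    proof (rule less.hyps)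
      show "card ?T < card \<T>" using less.prems(1) t(1) by (rule card_Diff1_less)
      show "inj_on q ?T" using less.prems(6) by (rule inj_on_subset) blast
      show "generic_over {} (q ` ?T)" by (rule generic_over_mono[OF less.prems(7)]) auto
      show "closed_segment (q (b # u)) (q u) \<subseteq> W" if "b # u \<in> ?T" "u \<noteq> []" for b u
        using less.prems(11)[of b u] that by blast
      show "finite ?T" "?T \<noteq> {}" "[] \<notin> ?T" using less.prems(1,3) sT' by auto
      show "u \<in> ?T" if "b # u \<in> ?T" "u \<noteq> []" for b u by (rule tlT[OF that])
      show "last u = z" if "u \<in> ?T" for u using less.prems(5) that by blast
      show "q ` ?T \<subseteq> W" using less.prems(10) by blast
    qed (rule dim W)+
    let ?v = "q s" and ?w = "q t" and ?A = "body (walk_edges q ?T)"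
    have vw: "?v \<noteq> ?w" using inj_onD[OF less.prems(6), of s t] sT t(1) as by auto
    have vA: "?v \<in> ?A"
      using sT' by (auto simp: body_def walk_edges_def intro!: bexI[of _ s] hull_inc)
    have c: "card {?w, ?v} \<le> DIM('a) + 1" using dim by (simp add: card_insert_if)
    have "engulfed W (?A \<union> (\<Union>s\<in>{{?v}}. convex hull (insert ?w s)))"
    proof (rule engulfed_sweep[where v = ?v, OF IH _ W])
      show "closed ?A" using less.prems(1)
        by (intro compact_imp_closed compact_body) (auto simp: walk_edges_def)
      show "finite s \<and> ?v \<in> s \<and> ?w \<notin> s" if "s \<in> {{?v}}" for s using that vw by auto
      show "convex hull s \<subseteq> ?A" if "s \<in> {{?v}}" for s using that vA by simp
      show "convex hull insert ?w X \<subseteq> W" if "X \<in> {{?v}}" for X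
        using less.prems(11)[of a s] t(1) as False that by (auto simp: segment_convex_hull)
      fix s' t' y u
      assume st: "s' \<in> {{?v}}" "t' \<in> {{?v}}" and y: "y \<in> ?A" "y \<in> convex hull insert ?w s'" and u: "0 \<le> u"
        "y - u *\<^sub>R (?w - ?v) \<in> convex hull insert ?w t'"
      obtain X where X: "X \<in> walk_edges q ?T" "y \<in> convex hull X"
        using y(1) unfolding body_def by (elim UN_E)
      then obtain r where r: "r \<in> ?T" "X = {q r, q (if tl r = [] then r else tl r)}"
        unfolding walk_edges_def by (elim imageE)
      define r' where "r' = (if tl r = [] then r else tl r)"
      have yr: "y \<in> convex hull {q r, q r'}" using X(2) unfolding r(2) r'_def .
      have r': "r' \<in> ?T"
      proof (cases "tl r = []")
        case True
        then show ?thesis using r(1) by (simp add: r'_def)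
      next
        case False
        then have "hd r # tl r = r" by (cases r) simp_all
        then have "tl r \<in> ?T" using tlT[of "hd r" "tl r"] r(1) False by metis
        then show ?thesis using False by (simp add: r'_def)
      qed
      have ne: "q r \<noteq> ?w" "q r' \<noteq> ?w"
        using inj_onD[OF less.prems(6), of _ t] r(1) r' t(1) by auto
      have "card ({?w, ?v} \<union> {q r, q r'}) \<le> card {?w, ?v} + card {q r, q r'}" by (rule card_Un_le)
      also have "\<dots> \<le> 2 + 2" by (intro add_mono) (auto simp: card_insert_if)
      finally have "card ({?w, ?v} \<union> {q r, q r'}) \<le> DIM('a) + 1" using dim by simp
      then have "y \<in> convex hull ({?w, ?v} \<inter> {q r, q r'})"
        using generic_convex_hull_Int[OF less.prems(7), of "{?w, ?v}" "{q r, q r'}" y]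
          r(1) yr y(2) st r' t(1) sT by auto
      moreover have "{?w, ?v} \<inter> {q r, q r'} \<subseteq> {?v}" using ne by auto
      then have "convex hull ({?w, ?v} \<inter> {q r, q r'}) \<subseteq> convex hull {?v}" by (rule hull_mono)
      ultimately have yv: "y \<in> convex hull {?v}" by blast
      have "u = 0"
        by (rule generic_no_descent[OF less.prems(7) _ _ _ _ _ _ _ yv u(1), of "{?v}" ?w ?v])
          (use c vw sT t(1) st u(2) in auto)
      then show "y - u *\<^sub>R (?w - ?v) \<in> ?A" using y(1) by simp
    qed simp
    then show ?thesis
    proof (rule engulfed_mono)
      have "tl t = s" "tl t \<noteq> []" using as False by auto
      then have "walk_edges q (insert t X) = insert {?w, ?v} (walk_edges q X)" for X
        by (simp add: walk_edges_def)
      from this[of ?T] have "walk_edges q \<T> = insert {?w, ?v} (walk_edges q ?T)"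
        unfolding insert_Diff[OF t(1)] .
      then show "body (walk_edges q \<T>) \<subseteq> ?A \<union> (\<Union>s\<in>{{?v}}. convex hull (insert ?w s))"
        by (auto simp: body_def)
    qed
  qed
qed

section \<open>Approximation in dimensions zero and one\<close>

text \<open>With multiplicity one, every coordinate takes only the values 0 and 1. On the connected
  \<open>Y\<close> one of them is constantly 1, so \<open>Y\<close> lies in a small ball and the
  identity serves as \<open>k\<close>.\<close>

lemma engulfed_approximation_0:
  fixes Y :: "'a::euclidean_space set"
  assumes Y: "compact Y" "Y \<noteq> {}" and dim: "covering_dim_le (top_of_set Y) (int 0)"
    and shape: "shape_trivial Y" and "0 < \<epsilon>"
  obtains k where "continuous_on Y k" "\<forall>y\<in>Y. dist (k y) y < \<epsilon>"
    "engulfed {x. infdist x Y < \<epsilon>} (k ` Y)"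
proof -
  obtain V :: "'a set set" and f :: "'a set \<Rightarrow> 'a \<Rightarrow> real" and p where
    V: "finite V" "\<forall>v\<in>V. continuous_on Y (f v) \<and> (\<forall>y\<in>Y. 0 \<le> f v y)"
      "\<forall>y\<in>Y. (\<Sum>v\<in>V. f v y) = 1 \<and> card {v \<in> V. 0 < f v y} \<le> 0 + 1"
      "\<forall>v\<in>V. p v \<in> Y \<and> (\<forall>y\<in>Y. 0 < f v y \<longrightarrow> dist (p v) y < \<epsilon> / 2)"
    by (rule covering_dim_partition[OF Y dim half_gt_zero[OF \<open>0 < \<epsilon>\<close>]])
  have 01: "f v y = 0 \<or> f v y = 1" if v: "v \<in> V" and y: "y \<in> Y" for v y
  proof (rule ccontr)
    assume a: "\<not> (f v y = 0 \<or> f v y = 1)"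
    then have "0 < f v y" using V(2) v y by force
    have "f w y = 0" if "w \<in> V - {v}" for w
    proof (rule ccontr)
      assume "f w y \<noteq> 0"
      then have "0 < f w y" using V(2) that y by force
      then have "{v, w} \<subseteq> {v \<in> V. 0 < f v y}" using \<open>0 < f v y\<close> v that by auto
      then have "card {v, w} \<le> card {v \<in> V. 0 < f v y}" using V(1) by (intro card_mono) auto
      then have "card {v, w} \<le> 1" using V(3) y by fastforce
      then show False using that by (auto simp: card_insert_if split: if_splits)
    qed
    then have "(\<Sum>v\<in>V. f v y) = f v y"
      using sum.remove[OF V(1) v, of "\<lambda>v. f v y"] by simp
    then show False using a V(3) y by auto
  qed
  obtain y0 where y0: "y0 \<in> Y" using Y(2) by blast
  have "\<exists>v\<in>V. f v y0 \<noteq> 0"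
  proof (rule ccontr)
    assume "\<not> ?thesis"
    then have "(\<Sum>v\<in>V. f v y0) = 0" by (intro sum.neutral) blast
    then show False using V(3) y0 by auto
  qed
  then obtain v where v: "v \<in> V" "f v y0 \<noteq> 0" by blast
  have "connected Y" by (rule shape_trivial_connected[OF shape Y(1)])
  moreover have "continuous_on Y (f v)" using V(2) v(1) by blast
  moreover have "finite (f v ` Y)"
    using 01[OF v(1)] by (intro finite_subset[of "f v ` Y" "{0, 1}"]) auto
  ultimately have "f v constant_on Y" by (rule continuous_finite_range_constant)
  then have "f v y = f v y0" if "y \<in> Y" for y using y0 that unfolding constant_on_def by metis
  then have pos: "0 < f v y" if "y \<in> Y" for y using 01[OF v(1) that] v(2) that by force
  then have near: "dist (p v) y < \<epsilon> / 2" if "y \<in> Y" for y using V(4) v(1) that by blast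
  have pY: "p v \<in> Y" using V(4) v(1) by blast
  show thesis
  proof (rule that[of "\<lambda>x. x"])
    show "engulfed {x. infdist x Y < \<epsilon>} ((\<lambda>x. x) ` Y)"
    proof (rule engulfed_ball)
      show "0 < \<epsilon> / 2" using \<open>0 < \<epsilon>\<close> by simp
      show "(\<lambda>x. x) ` Y \<subseteq> ball (p v) (\<epsilon> / 2)" using near by auto
      show "cball (p v) (\<epsilon> / 2) \<subseteq> {x. infdist x Y < \<epsilon>}"
      proof
        fix x assume "x \<in> cball (p v) (\<epsilon> / 2)"
        then have "infdist x Y \<le> \<epsilon> / 2" using infdist_le2[OF pY, of x "\<epsilon> / 2"] by (simp add: dist_commute)
        then show "x \<in> {x. infdist x Y < \<epsilon>}" using \<open>0 < \<epsilon>\<close> by simp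
      qed
    qed
  qed (use \<open>0 < \<epsilon>\<close> in auto)
qed

lemma subset_pair_if_no_three:
  assumes "\<And>u v w. u \<in> S \<Longrightarrow> v \<in> S \<Longrightarrow> w \<in> S \<Longrightarrow> u = v \<or> u = w \<or> v = w"
  shows "\<exists>p q. S \<subseteq> {p, q}"
proof (cases "\<exists>p\<in>S. \<exists>q\<in>S. p \<noteq> q")
  case True
  then obtain p q where "p \<in> S" "q \<in> S" "p \<noteq> q" by blast
  then have "S \<subseteq> {p, q}" using assms by blast
  then show ?thesis by blast
next
  case False
  then have "S \<subseteq> {SOME p. p \<in> S, SOME p. p \<in> S}" by (metis insertI1 someI subsetI)
  then show ?thesis by blast
qed

text \<open>The contraction leaves \<open>Y\<close>, so multiplicity two is required on a whole
  neighbourhood. Superlevel sets of the extended partition functions form the cover, and the closed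
  set \<open>T\<close> where three of them reach \<open>\<tau>\<close> is removed; it misses
  \<open>Y\<close>.\<close>

lemma one_dimensional_cover:
  fixes Y :: "'a::euclidean_space set"
  assumes Y: "compact Y" "Y \<noteq> {}" and dim: "covering_dim_le (top_of_set Y) (int 1)" and "0 < r"
  obtains L :: "'a set set" and Ov p U where "finite L" "\<forall>v\<in>L. open (Ov v) \<and> p v \<in> Y \<and> Ov v \<subseteq> ball (p v) r"
    "open U" "Y \<subseteq> U" "U \<subseteq> (\<Union>v\<in>L. Ov v)" "\<forall>x\<in>U. \<exists>a b. {v \<in> L. x \<in> Ov v} \<subseteq> {a, b}"
proof -
  obtain L :: "'a set set" and f :: "'a set \<Rightarrow> 'a \<Rightarrow> real" and p where
    L: "finite L" "\<forall>v\<in>L. continuous_on Y (f v) \<and> (\<forall>y\<in>Y. 0 \<le> f v y)"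
      "\<forall>y\<in>Y. (\<Sum>v\<in>L. f v y) = 1 \<and> card {v \<in> L. 0 < f v y} \<le> 1 + 1"
      "\<forall>v\<in>L. p v \<in> Y \<and> (\<forall>y\<in>Y. 0 < f v y \<longrightarrow> dist (p v) y < r)"
    by (rule covering_dim_partition[OF Y dim \<open>0 < r\<close>])
  have "\<exists>g. continuous_on UNIV g \<and> (\<forall>y\<in>Y. g y = f v y)" if v: "v \<in> L" for v
  proof -
    have "continuous_on Y (f v)" "closedin (top_of_set UNIV) Y"
      using L(2) v compact_imp_closed[OF Y(1)] by auto
    from Tietze_unbounded[OF this] show ?thesis by metis
  qed
  then obtain g where g: "\<And>v. v \<in> L \<Longrightarrow> continuous_on UNIV (g v)" "\<And>v y. v \<in> L \<Longrightarrow> y \<in> Y \<Longrightarrow> g v y = f v y"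
    by metis
  have "L \<noteq> {}" using L(3) Y(2) by fastforce
  then have cL: "0 < card L" using L(1) by (simp add: card_gt_0_iff)
  \<comment> \<open>Below \<open>1 / card L\<close>, since functions with sum one cannot all be at
    most \<open>\<tau>\<close>; so the superlevel sets cover \<open>Y\<close>.\<close>
  define \<tau> where "\<tau> = 1 / (2 * real (card L))"
  have \<tau>: "0 < \<tau>" "\<tau> < 1 / real (card L)" using cL by (auto simp: \<tau>_def field_simps)
  define Ov where "Ov v = {x. \<tau> < g v x} \<inter> ball (p v) r" for v
  define T where "T = (\<Union>u\<in>L. \<Union>v\<in>L - {u}. \<Union>w\<in>L - {u, v}. {x. \<tau> \<le> g u x} \<inter> {x. \<tau> \<le> g v x} \<inter> {x. \<tau> \<le> g w x})"
  have op: "open (Ov v)" if "v \<in> L" for v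
    unfolding Ov_def using g(1)[OF that] by (intro open_Int open_Collect_less continuous_intros) auto
  have "closed {x. \<tau> \<le> g v x}" if "v \<in> L" for v
    using g(1)[OF that] by (intro closed_Collect_le continuous_intros)
  then have "closed T"
    unfolding T_def using L(1) by (intro closed_UN closed_Int ballI) auto
  show thesis
  proof (rule that[of L Ov p "(\<Union>v\<in>L. Ov v) - T"])
    show "finite L" by (rule L(1))
    show "\<forall>v\<in>L. open (Ov v) \<and> p v \<in> Y \<and> Ov v \<subseteq> ball (p v) r"
      using op L(4) by (auto simp: Ov_def)
    show "open ((\<Union>v\<in>L. Ov v) - T)" using op \<open>closed T\<close> by (intro open_Diff open_UN) auto
    show "Y \<subseteq> (\<Union>v\<in>L. Ov v) - T"
    proof
      fix y assume y: "y \<in> Y"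
      have "\<exists>v\<in>L. \<tau> < f v y"
      proof (rule ccontr)
        assume "\<not> ?thesis"
        then have "(\<Sum>v\<in>L. f v y) \<le> real (card L) * \<tau>" by (intro sum_bounded_above) force
        also have "\<dots> < 1" using \<tau> cL by (simp add: field_simps)
        finally show False using L(3) y by simp
      qed
      then obtain v where v: "v \<in> L" "\<tau> < f v y" by blast
      then have "y \<in> Ov v" using L(4) y g(2) \<tau>(1) by (force simp: Ov_def)
      moreover have "y \<notin> T"
      proof
        assume "y \<in> T"
        then obtain u v w where uvw: "u \<in> L" "v \<in> L" "w \<in> L" "v \<noteq> u" "w \<noteq> u" "w \<noteq> v"
          "\<tau> \<le> g u y" "\<tau> \<le> g v y" "\<tau> \<le> g w y" unfolding T_def by blast
        then have "{u, v, w} \<subseteq> {v \<in> L. 0 < f v y}" using \<tau>(1) g(2) y by force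
        then have "card {u, v, w} \<le> card {v \<in> L. 0 < f v y}" using L(1) by (intro card_mono) auto
        also have "\<dots> \<le> 2" using L(3) y by (simp add: numeral_2_eq_2)
        finally show False using uvw(4-6) by simp
      qed
      ultimately show "y \<in> (\<Union>v\<in>L. Ov v) - T" using v(1) by blast
    qed
    show "(\<Union>v\<in>L. Ov v) - T \<subseteq> (\<Union>v\<in>L. Ov v)" by blast
    show "\<forall>x\<in>(\<Union>v\<in>L. Ov v) - T. \<exists>a b. {v \<in> L. x \<in> Ov v} \<subseteq> {a, b}"
    proof
      fix x assume "x \<in> (\<Union>v\<in>L. Ov v) - T"
      then have xT: "x \<notin> T" by simp
      show "\<exists>a b. {v \<in> L. x \<in> Ov v} \<subseteq> {a, b}"
      proof (rule subset_pair_if_no_three, rule ccontr)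
        fix u v w assume uvw: "u \<in> {v \<in> L. x \<in> Ov v}" "v \<in> {v \<in> L. x \<in> Ov v}" "w \<in> {v \<in> L. x \<in> Ov v}"
          "\<not> (u = v \<or> u = w \<or> v = w)"
        then have "\<tau> \<le> g u x" "\<tau> \<le> g v x" "\<tau> \<le> g w x" by (auto simp: Ov_def)
        then have "x \<in> T" using uvw unfolding T_def by blast
        then show False using xT by simp
      qed
    qed
  qed
qed

text \<open>The tracks of the contraction are recorded as walks in the nerve of a coarse cover. Walks of nearby points
  stay adjacent after reduction, so a fine partition of unity maps \<open>Y\<close> into a finite tree
  of reduced walks, and a generic copy of this tree near \<open>Y\<close> is engulfed.\<close>

lemma engulfed_approximation_1:
  fixes Y :: "'a::euclidean_space set"
  assumes Y: "compact Y" "Y \<noteq> {}" and dim: "covering_dim_le (top_of_set Y) (int 1)"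
    and d3: "3 \<le> DIM('a)" and shape: "shape_trivial Y" and "0 < \<epsilon>"
  obtains k where "continuous_on Y k" "\<forall>y\<in>Y. dist (k y) y < \<epsilon>"
    "engulfed {x. infdist x Y < \<epsilon>} (k ` Y)"
proof -
  define r where "r = \<epsilon> / 8"
  have r: "0 < r" "8 * r = \<epsilon>" using \<open>0 < \<epsilon>\<close> by (auto simp: r_def)
  define W where "W = {x. infdist x Y < \<epsilon>}"
  have "open W" unfolding W_def by (intro open_Collect_less continuous_intros)
  have ballW: "ball y \<epsilon> \<subseteq> W" if "y \<in> Y" for y
    using le_less_trans[OF infdist_le[OF that]] by (auto simp: W_def dist_commute)
  obtain L :: "'a set set" and Ov pL U0 where L: "finite L"
    "\<forall>v\<in>L. open (Ov v) \<and> pL v \<in> Y \<and> Ov v \<subseteq> ball (pL v) r"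
    "open U0" "Y \<subseteq> U0" "U0 \<subseteq> (\<Union>v\<in>L. Ov v)" "\<forall>x\<in>U0. \<exists>a b. {v \<in> L. x \<in> Ov v} \<subseteq> {a, b}"
    by (rule one_dimensional_cover[OF Y dim r(1)])
  obtain U where U: "Y \<subseteq> U" "contracts_in U U0"
    by (rule shape_trivialE[OF shape L(3,4)])
  obtain h c where h: "continuous_on ({0..1::real} \<times> Y) h" "h ` ({0..1} \<times> Y) \<subseteq> U0"
    and h01: "\<forall>x\<in>Y. h (0, x) = x \<and> h (1, x) = c"
    by (rule contracts_inE[OF contracts_in_subset[OF U(2,1)]])
  have h0: "h (0, x) = x" and h1: "h (1, x) = c" if "x \<in> Y" for x using h01 that by auto
  let ?I = "{0..1::real} \<times> Y"
  have cI: "compact ?I" by (intro compact_Times compact_Icc Y)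
  have "compact (h ` ?I)" using compact_continuous_image[OF h(1) cI] .
  moreover have "h ` ?I \<subseteq> \<Union> (Ov ` L)" using h(2) L(5) by blast
  moreover have "\<And>G. G \<in> Ov ` L \<Longrightarrow> open G" using L(2) by blast
  ultimately obtain l where l: "0 < l" "\<And>x. x \<in> h ` ?I \<Longrightarrow> \<exists>G\<in>Ov ` L. ball x l \<subseteq> G"
    using Heine_Borel_lemma[of "h ` ?I" "Ov ` L"] by metis
  then have "\<forall>x\<in>h ` ?I. \<exists>v\<in>L. ball x l \<subseteq> Ov v" by blast
  \<comment> \<open>\<open>l\<close> is a Lebesgue number: the label of a point remains valid within
    distance \<open>l\<close>, hence for neighbouring values of the contraction.\<close>
  then obtain lab where lab: "\<And>x. x \<in> h ` ?I \<Longrightarrow> lab x \<in> L \<and> ball x l \<subseteq> Ov (lab x)" by metis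
  obtain \<delta> where \<delta>: "\<delta> > 0" "\<And>x y. x \<in> ?I \<Longrightarrow> y \<in> ?I \<Longrightarrow> dist y x < \<delta> \<Longrightarrow> dist (h y) (h x) < l"
    using compact_uniformly_continuous[OF h(1) cI] l(1) unfolding uniformly_continuous_on_def by meson
  obtain N :: nat where N: "2 / \<delta> < real N" using reals_Archimedean2 by blast
  then have N0: "0 < N" using \<delta>(1) by (cases "N = 0") (auto simp: divide_less_0_iff)
  have N1: "1 / real N < \<delta> / 2" using N N0 \<delta>(1) by (simp add: field_simps)
  obtain V :: "'a set set" and f :: "'a set \<Rightarrow> 'a \<Rightarrow> real" and p where
    P: "finite V" "\<forall>v\<in>V. continuous_on Y (f v) \<and> (\<forall>y\<in>Y. 0 \<le> f v y)"
      "\<forall>y\<in>Y. (\<Sum>v\<in>V. f v y) = 1 \<and> card {v \<in> V. 0 < f v y} \<le> 1 + 1"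
      "\<forall>v\<in>V. p v \<in> Y \<and> (\<forall>y\<in>Y. 0 < f v y \<longrightarrow> dist (p v) y < \<delta> / 2)"
    by (rule covering_dim_partition[OF Y dim half_gt_zero[OF \<delta>(1)]])
  \<comment> \<open>Time runs from the constant end of the contraction to the identity, so all walks
    start at \<open>lab c\<close> and live in one tree.\<close>
  define t where "t k = 1 - real k / real N" for k
  have t01: "t k \<in> {0..1}" if "k \<le> N" for k using that N0 by (auto simp: t_def)
  have t0: "t 0 = 1" and tN: "t N = 0" using N0 by (auto simp: t_def)
  define a where "a k v = lab (h (t k, p v))" for k v
  have hI: "h (t k, y) \<in> h ` ?I" if "k \<le> N" "y \<in> Y" for k y using that t01 by auto
  have pV: "p v \<in> Y" if "v \<in> V" for v using P(4) that by blast
  have aL: "a k v \<in> L" if "k \<le> N" "v \<in> V" for k v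
    using lab[OF hI[OF that(1) pV[OF that(2)]]] by (simp add: a_def)
  have near: "h (t k, y) \<in> Ov (a k' v)"
    if "v \<in> V" "y \<in> Y" "dist (p v) y < \<delta> / 2" "k \<le> N" "k' \<le> N" "\<bar>real k' - real k\<bar> \<le> 1" for v y k k'
  proof -
    have "dist (t k', p v) (t k, y) \<le> dist (t k') (t k) + dist (p v) y"
      unfolding dist_Pair_Pair by (rule sqrt_sum_squares_le_sum) auto
    also have "dist (t k') (t k) = \<bar>real k' - real k\<bar> / real N"
      by (simp add: t_def dist_real_def abs_minus_commute flip: diff_divide_distrib)
    also have "\<dots> \<le> 1 / real N" using that by (intro divide_right_mono) auto
    finally have "dist (t k', p v) (t k, y) < \<delta>" using that(3) N1 by linarith
    moreover have "(t k, y) \<in> ?I" "(t k', p v) \<in> ?I" using that pV t01 by auto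
    ultimately have "dist (h (t k', p v)) (h (t k, y)) < l" using \<delta>(2) by blast
    then have "h (t k, y) \<in> ball (h (t k', p v)) l" by simp
    then show ?thesis using lab[OF hI[OF that(5) pV[OF that(1)]]] unfolding a_def by blast
  qed
  define wk where "wk v = rec_nat [a 0 v] (\<lambda>k. walk_step (a (Suc k) v))" for v
  have wk0: "wk v 0 = [a 0 v]" and wkS: "wk v (Suc k) = walk_step (a (Suc k) v) (wk v k)" for v k
    by (simp_all add: wk_def)
  have ne: "wk v k \<noteq> []" and hd: "hd (wk v k) = a k v" and red: "reduced (wk v k)" for v k
    by (induction k) (simp_all add: wk0 wkS reduced_walk_step)
  have last: "last (wk v k) = lab c" if "v \<in> V" for v k
    by (induction k) (simp_all add: wk0 wkS last_walk_step ne a_def t0 h1 pV that)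
  define E where "E x y \<longleftrightarrow> Ov x \<inter> Ov y \<noteq> {}" for x y
  have edges: "successively E (wk v k)" if "v \<in> V" "k \<le> N" for v k
    using that(2)
  proof (induction k)
    case 0
    then show ?case by (simp add: wk0)
  next
    case (Suc k)
    have "h (t k, p v) \<in> Ov (a (Suc k) v)" "h (t k, p v) \<in> Ov (a k v)"
      using near[OF that(1) pV[OF that(1)]] \<delta>(1) Suc.prems by auto
    then have "E (a (Suc k) v) (hd (wk v k))" unfolding hd E_def by blast
    then show ?case using Suc unfolding wkS by (intro successively_walk_step ne) auto
  qed
  define s where "s y = {v \<in> V. 0 < f v y}" for y
  have sV: "v \<in> V" "dist (p v) y < \<delta> / 2" if "y \<in> Y" "v \<in> s y" for v y
    using that P(4) by (auto simp: s_def)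
  \<comment> \<open>In the induction step, \<open>h (t k, y)\<close> lies in the cover sets of all
    four labels involved. These are therefore at most two labels, and simultaneous steps preserve
    adjacency.\<close>
  have adj: "walk_adj (wk v k) (wk w k)" if y: "y \<in> Y" "v \<in> s y" "w \<in> s y" and k: "k \<le> N" for y v w k
    using k
  proof (induction k)
    case 0
    then show ?case using sV[OF y(1)] y by (simp add: wk0 walk_adj_def a_def t0 h1 pV)
  next
    case (Suc k)
    have "h (t k, y) \<in> U0" using h(2) hI[of k y] y(1) Suc.prems by auto
    then obtain b b' where b: "{v \<in> L. h (t k, y) \<in> Ov v} \<subseteq> {b, b'}" using L(6) by meson
    have "a k' u \<in> {b, b'}" if "u \<in> {v, w}" "k' \<in> {k, Suc k}" for u k'
    proof -
      have "u \<in> s y" using that y by auto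
      then have "h (t k, y) \<in> Ov (a k' u)" "a k' u \<in> L"
        using near[OF sV(1)[OF y(1)] y(1) sV(2)[OF y(1)], of u k k'] aL sV[OF y(1)] that Suc.prems by auto
      then show ?thesis using b by blast
    qed
    then have "{a k v, a k w, a (Suc k) v, a (Suc k) w} \<subseteq> {b, b'}" by blast
    then show ?case unfolding wkS
      using Suc by (intro walk_step_adj[of _ _ _ _ b b'] red ne) (auto simp: hd)
  qed
  \<comment> \<open>The nonempty suffixes of the final walks: a finite subtree closed under passing
    to the parent.\<close>
  define \<T> where "\<T> = {u. u \<noteq> [] \<and> (\<exists>v\<in>V. \<exists>x. wk v N = x @ u)}"
  have "finite \<T>"
  proof (rule finite_subset)
    show "\<T> \<subseteq> (\<Union>v\<in>V. (\<lambda>i. drop i (wk v N)) ` {..length (wk v N)})"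
    proof
      fix u assume "u \<in> \<T>"
      then obtain v x where v: "v \<in> V" "wk v N = x @ u" by (auto simp: \<T>_def)
      then have "u = drop (length x) (wk v N)" "length x \<le> length (wk v N)" by auto
      then show "u \<in> (\<Union>v\<in>V. (\<lambda>i. drop i (wk v N)) ` {..length (wk v N)})" using v(1) by blast
    qed
  qed (use P(1) in auto)
  have wkT: "wk v N \<in> \<T>" if "v \<in> V" for v
    unfolding \<T>_def using that ne by (intro CollectI conjI bexI[of _ v] exI[of _ "[]"]) auto
  have tlT: "u \<in> \<T>" "E b (hd u)" if bu: "b # u \<in> \<T>" "u \<noteq> []" for b u
  proof -
    obtain v x where v: "v \<in> V" "wk v N = x @ b # u" using bu by (auto simp: \<T>_def)
    then have "wk v N = (x @ [b]) @ u" by simp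
    then show "u \<in> \<T>" unfolding \<T>_def using bu(2) v(1) by blast
    have "successively E (b # u)"
      using edges[OF v(1), of N] unfolding v(2) by (simp add: successively_append_iff)
    then show "E b (hd u)" using bu(2) by (cases u) auto
  qed
  have hdL: "hd u \<in> L" if "u \<in> \<T>" for u
  proof -
    have *: "set (wk v k) \<subseteq> L" if "v \<in> V" "k \<le> N" for v k
      using that(2)
    proof (induction k)
      case 0
      then show ?case using aL[OF _ that(1)] by (simp add: wk0)
    next
      case (Suc k)
      have "set (walk_step b x) \<subseteq> insert b (set x)" for b x
        by (induction b x rule: walk_step.induct) auto
      then have "set (wk v (Suc k)) \<subseteq> insert (a (Suc k) v) (set (wk v k))" unfolding wkS .
      moreover have "a (Suc k) v \<in> L" using aL[OF Suc.prems that(1)] .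
      moreover have "set (wk v k) \<subseteq> L" using Suc by simp
      ultimately show ?case by blast
    qed
    obtain v x where v: "v \<in> V" "wk v N = x @ u" "u \<noteq> []" using \<open>u \<in> \<T>\<close> by (auto simp: \<T>_def)
    then have "hd u \<in> set (wk v N)" by simp
    then show ?thesis using *[OF v(1)] by blast
  qed
  obtain q :: "'a set list \<Rightarrow> 'a" where q: "inj_on q \<T>" "q ` \<T> \<inter> {} = {}"
    "\<forall>u\<in>\<T>. dist (q u) (pL (hd u)) < r" "generic_over {} (q ` \<T>)"
    by (rule generic_over_family[OF \<open>finite \<T>\<close> finite.emptyI r(1), of "\<lambda>u. pL (hd u)"])
  have Ovp: "dist (pL b) x < r" if "b \<in> L" "x \<in> Ov b" for b x
  proof -
    have "x \<in> ball (pL b) r" using L(2) that by blast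
    then show ?thesis by simp
  qed
  have sne: "s y \<noteq> {}" if "y \<in> Y" for y
  proof
    assume "s y = {}"
    then have "(\<Sum>v\<in>V. f v y) = 0"
      using P(2) that by (intro sum.neutral) (force simp: s_def)
    then show False using P(3) that by auto
  qed
  have engT: "engulfed W (body (walk_edges q \<T>))"
  proof (rule engulfed_tree[where z = "lab c", OF \<open>finite \<T>\<close> _ _ tlT(1) _ q(1,4) d3 \<open>open W\<close>])
    show "\<T> \<noteq> {}" using wkT sne Y(2) by (auto simp: s_def)
    show "[] \<notin> \<T>" by (simp add: \<T>_def)
    show "last u = lab c" if "u \<in> \<T>" for u
    proof -
      obtain v x where v: "v \<in> V" "wk v N = x @ u" "u \<noteq> []" using \<open>u \<in> \<T>\<close> by (auto simp: \<T>_def)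
      then show ?thesis using last[OF v(1), of N] by simp
    qed
    show "q ` \<T> \<subseteq> W"
    proof
      fix x assume "x \<in> q ` \<T>"
      then obtain u where u: "u \<in> \<T>" "x = q u" by blast
      have "pL (hd u) \<in> Y" using L(2) hdL[OF u(1)] by blast
      moreover have "x \<in> ball (pL (hd u)) \<epsilon>" using q(3) u r by (force simp: dist_commute)
      ultimately show "x \<in> W" using ballW by blast
    qed
    show "closed_segment (q (b # u)) (q u) \<subseteq> W" if bu: "b # u \<in> \<T>" "u \<noteq> []" for b u
    proof -
      have bL: "b \<in> L" "hd u \<in> L" using hdL[OF bu(1)] hdL[OF tlT(1)[OF bu]] by auto
      obtain x where x: "x \<in> Ov b" "x \<in> Ov (hd u)" using tlT(2)[OF bu] unfolding E_def by blast
      have "dist (q (b # u)) (pL b) < r" using bspec[OF q(3) bu(1)] by simp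
      moreover have "dist (q u) (pL (hd u)) < r" using q(3) tlT(1)[OF bu] by blast
      moreover have "dist (pL b) x < r" "dist (pL (hd u)) x < r" using Ovp bL x by auto
      ultimately have "dist (q (b # u)) (pL b) < \<epsilon>" "dist (q u) (pL b) < \<epsilon>"
        using r dist_triangle[of "q u" "pL b" "pL (hd u)"] dist_triangle2[of "pL (hd u)" "pL b" x] by linarith+
      then have "closed_segment (q (b # u)) (q u) \<subseteq> ball (pL b) \<epsilon>"
        by (intro closed_segment_subset) (auto simp: dist_commute)
      then show ?thesis using ballW L(2) bL(1) by blast
    qed
  qed
  define k where "k y = (\<Sum>v\<in>V. f v y *\<^sub>R q (wk v N))" for y
  have kin: "k y \<in> convex hull ((\<lambda>v. q (wk v N)) ` s y)" if "y \<in> Y" for y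
    unfolding k_def s_def using P that by (intro nerve_sum_in_simplex) auto
  show thesis
  proof (rule that[of k])
    show "continuous_on Y k" unfolding k_def using P(2) by (intro continuous_intros) blast
    show "\<forall>y\<in>Y. dist (k y) y < \<epsilon>"
    proof
      fix y assume y: "y \<in> Y"
      have "q (wk v N) \<in> ball y \<epsilon>" if "v \<in> s y" for v
      proof -
        have "h (t N, y) \<in> Ov (a N v)" using near[OF sV(1)[OF y that] y sV(2)[OF y that], of N N] by simp
        then have "y \<in> Ov (a N v)" using y by (simp add: tN h0)
        then have "dist (pL (a N v)) y < r" using Ovp aL sV[OF y that] by blast
        moreover have "dist (q (wk v N)) (pL (a N v)) < r"
          using bspec[OF q(3) wkT[OF sV(1)[OF y that]]] by (simp add: hd)
        ultimately show ?thesis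
          using dist_triangle[of "q (wk v N)" y "pL (a N v)"] r by (simp add: dist_commute)
      qed
      then have "convex hull ((\<lambda>v. q (wk v N)) ` s y) \<subseteq> ball y \<epsilon>" by (intro hull_minimal) auto
      then show "dist (k y) y < \<epsilon>" using kin[OF y] by (auto simp: dist_commute)
    qed
    have "k y \<in> body (walk_edges q \<T>)" if y: "y \<in> Y" for y
    proof -
      \<comment> \<open>The walks at the vertices of one simplex are pairwise adjacent, so they form
        a vertex or an edge of the tree.\<close>
      let ?S = "(\<lambda>v. wk v N) ` s y"
      have "\<exists>u\<in>?S. ?S = {u} \<or> (\<exists>b. ?S = {u, b # u})"
        using adj[OF y] sne[OF y] by (intro walk_adj_clique) auto
      then obtain u where u: "u \<in> ?S" "?S = {u} \<or> (\<exists>b. ?S = {u, b # u})" by blast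
      have ST: "?S \<subseteq> \<T>" using wkT sV[OF y] by blast
      have im: "(\<lambda>v. q (wk v N)) ` s y = q ` ?S" by (simp add: image_image)
      have "\<exists>w\<in>\<T>. q ` ?S \<subseteq> {q w, q (if tl w = [] then w else tl w)}"
      proof (cases "?S = {u}")
        case True
        then show ?thesis using ST by auto
      next
        case False
        then obtain b where b: "?S = {u, b # u}" using u(2) by blast
        then have "b # u \<in> \<T>" "u \<noteq> []" using ST u(1) \<T>_def by auto
        then show ?thesis unfolding b by (intro bexI[of _ "b # u"]) auto
      qed
      then obtain w where w: "w \<in> \<T>" "q ` ?S \<subseteq> {q w, q (if tl w = [] then w else tl w)}" by blast
      have "k y \<in> convex hull {q w, q (if tl w = [] then w else tl w)}"
        using kin[OF y] hull_mono[OF w(2), of convex] unfolding im by blast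
      then show ?thesis using w(1) unfolding body_def walk_edges_def by blast
    qed
    then show "engulfed {x. infdist x Y < \<epsilon>} (k ` Y)"
      using engulfed_mono[OF engT] unfolding W_def by blast
  qed
qed

lemma engulfed_approximation:
  fixes Y :: "'a::euclidean_space set"
  assumes Y: "compact Y" "Y \<noteq> {}" and dim: "covering_dim_le (top_of_set Y) (int n)"
    and n: "DIM('a) = 2 * n + 1" and shape: "shape_trivial Y" and "0 < \<epsilon>"
  obtains k where "continuous_on Y k" "\<forall>y\<in>Y. dist (k y) y < \<epsilon>"
    "engulfed {x. infdist x Y < \<epsilon>} (k ` Y)"
proof -
  consider "n = 0" | "n = 1" | "2 \<le> n" by linarith
  then show thesis
  proof cases
    case 1
    show thesis
      by (rule engulfed_approximation_0[OF Y dim[unfolded 1] shape \<open>0 < \<epsilon>\<close>]) (rule that)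
  next
    case 2
    have "3 \<le> DIM('a)" using n 2 by simp
    show thesis
      by (rule engulfed_approximation_1[OF Y dim[unfolded 2] \<open>3 \<le> DIM('a)\<close> shape \<open>0 < \<epsilon>\<close>]) (rule that)
  next
    case 3
    show thesis
      by (rule engulfed_approximation_ge_2[OF Y dim n 3 shape \<open>0 < \<epsilon>\<close>]) (rule that, auto)
  qed
qed

section \<open>Transfer and genericity\<close>

lemma homeomorphic_map_covering_dim_le:
  assumes hom: "homeomorphic_map X Y f" and dim: "covering_dim_le X n"
  shows "covering_dim_le Y n"
  unfolding covering_dim_le_def
proof (intro conjI allI impI)
  show "- 1 \<le> n" using dim by (simp add: covering_dim_le_def)
  fix \<U> assume \<U>: "finite \<U> \<and> (\<forall>U\<in>\<U>. openin Y U) \<and> \<Union>\<U> = topspace Y"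
  have cont: "continuous_map X Y f" using hom by (rule homeomorphic_imp_continuous_map)
  have surj: "f ` topspace X = topspace Y" using hom by (rule homeomorphic_imp_surjective_map)
  have inj: "inj_on f (topspace X)" using hom by (rule homeomorphic_imp_injective_map)
  define pre where "pre U = {x \<in> topspace X. f x \<in> U}" for U
  have "openin X (pre U)" if "U \<in> \<U>" for U
    unfolding pre_def by (rule openin_continuous_map_preimage[OF cont]) (use \<U> that in blast)
  then have "finite (pre ` \<U>)" "\<forall>U\<in>pre ` \<U>. openin X U"
    using \<U> by simp_all
  moreover have "\<Union>(pre ` \<U>) = topspace X"
  proof -
    have "f x \<in> \<Union>\<U>" if "x \<in> topspace X" for x
      using imageI[OF that, of f] \<U> surj by simp
    then show ?thesis by (auto simp: pre_def)
  qed
  ultimately obtain \<V> where \<V>: "finite \<V>" "\<forall>V\<in>\<V>. openin X V" "\<Union>\<V> = topspace X"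
    "\<forall>V\<in>\<V>. \<exists>U\<in>pre ` \<U>. V \<subseteq> U" "\<forall>x\<in>topspace X. int (card {V \<in> \<V>. x \<in> V}) \<le> n + 1"
    using dim[unfolded covering_dim_le_def, THEN conjunct2, THEN spec, of "pre ` \<U>"] by auto
  have sub: "V \<subseteq> topspace X" if "V \<in> \<V>" for V using \<V>(2) openin_subset that by blast
  show "\<exists>\<V>. finite \<V> \<and> (\<forall>V\<in>\<V>. openin Y V) \<and> \<Union>\<V> = topspace Y \<and> (\<forall>V\<in>\<V>. \<exists>U\<in>\<U>. V \<subseteq> U) \<and>
      (\<forall>x\<in>topspace Y. int (card {V \<in> \<V>. x \<in> V}) \<le> n + 1)"
  proof (intro exI[of _ "(`) f ` \<V>"] conjI ballI)
    show "finite ((`) f ` \<V>)" using \<V>(1) by simp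
    show "openin Y V" if "V \<in> (`) f ` \<V>" for V
      using that \<V>(2) homeomorphic_imp_open_map[OF hom] by (auto simp: open_map_def)
    show "\<Union> ((`) f ` \<V>) = topspace Y" unfolding surj[symmetric] \<V>(3)[symmetric] image_Union ..
    show "\<exists>U\<in>\<U>. V \<subseteq> U" if V: "V \<in> (`) f ` \<V>" for V
    proof -
      obtain V' where V': "V' \<in> \<V>" "V = f ` V'" using V by (elim imageE)
      then obtain U where U: "U \<in> \<U>" "V' \<subseteq> pre U" using \<V>(4) by (metis imageE)
      then have "V \<subseteq> U" unfolding V'(2) pre_def by blast
      then show ?thesis using U(1) by blast
    qed
    show "int (card {V \<in> (`) f ` \<V>. y \<in> V}) \<le> n + 1" if y: "y \<in> topspace Y" for y
    proof -
      obtain x where x: "x \<in> topspace X" "y = f x" using y unfolding surj[symmetric] by blast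
      have "{V \<in> (`) f ` \<V>. y \<in> V} \<subseteq> (`) f ` {V \<in> \<V>. x \<in> V}"
      proof
        fix V assume "V \<in> {V \<in> (`) f ` \<V>. y \<in> V}"
        then have "V \<in> (`) f ` \<V>" "f x \<in> V" using x(2) by auto
        then obtain V' where V': "V' \<in> \<V>" "V = f ` V'" by (elim imageE)
        then obtain x' where x': "x' \<in> V'" "f x = f x'" using \<open>f x \<in> V\<close> by (auto elim: imageE)
        have "x' \<in> topspace X" using sub[OF V'(1)] x'(1) by (rule subsetD)
        then have "x = x'" by (rule inj_onD[OF inj x'(2) x(1)])
        then have "V' \<in> {V \<in> \<V>. x \<in> V}" using V'(1) x'(1) by simp
        then show "V \<in> (`) f ` {V \<in> \<V>. x \<in> V}" unfolding V'(2) by (rule imageI)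
      qed
      then have "card {V \<in> (`) f ` \<V>. y \<in> V} \<le> card ((`) f ` {V \<in> \<V>. x \<in> V})"
        using \<V>(1) by (intro card_mono) auto
      also have "\<dots> \<le> card {V \<in> \<V>. x \<in> V}" using \<V>(1) by (intro card_image_le) auto
      finally show ?thesis using \<V>(5) x(1) by (meson of_nat_mono order_trans)
    qed
  qed
qed

lemma homeomorphic_map_compact_image:
  fixes f :: "'b::metric_space \<Rightarrow> 'a::metric_space"
  assumes "compact E" "continuous_on E f" "inj_on f E"
  shows "homeomorphic_map (top_of_set E) (top_of_set (f ` E)) f"
proof (rule continuous_imp_homeomorphic_map)
  show "continuous_map (top_of_set E) (top_of_set (f ` E)) f" using assms(2) by auto
  show "compact_space (top_of_set E)" using assms(1) by (simp add: compact_space_subtopology compactin_euclidean_iff)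
  show "Hausdorff_space (top_of_set (f ` E))" by (intro Hausdorff_space_subtopology Hausdorff_space_euclidean)
qed (use assms(3) in auto)

text \<open>General position of the images of the vertices of a fine nerve separates points that are
  not close.\<close>

lemma almost_injective_approximation:
  fixes E :: "'b::metric_space set" and f :: "'b \<Rightarrow> 'a::euclidean_space"
  assumes E: "compact E" "E \<noteq> {}" and dim: "covering_dim_le (top_of_set E) (int n)"
    and n: "DIM('a) = 2 * n + 1" and f: "continuous_on E f" and "0 < \<epsilon>" "0 < \<delta>"
  obtains g where "continuous_on E g" "\<forall>x\<in>E. dist (g x) (f x) < \<epsilon>"
    "\<forall>x\<in>E. \<forall>y\<in>E. g x = g y \<longrightarrow> dist x y < \<delta>"
proof -
  obtain d where d: "0 < d" "\<And>x y. x \<in> E \<Longrightarrow> y \<in> E \<Longrightarrow> dist y x < d \<Longrightarrow> dist (f y) (f x) < \<epsilon> / 2"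
    using compact_uniformly_continuous[OF f E(1)] half_gt_zero[OF \<open>0 < \<epsilon>\<close>]
    unfolding uniformly_continuous_on_def by meson
  \<comment> \<open>Points with equal images will share a nerve vertex \<open>v\<close> and lie
    within \<open>r\<close> of \<open>p v\<close>, hence within \<open>2 * r \<le> \<delta>\<close>
    of each other; \<open>r \<le> d\<close> controls the distance to \<open>f\<close>.\<close>
  define r where "r = min d (\<delta> / 2)"
  have r: "0 < r" "r \<le> d" "2 * r \<le> \<delta>" using d(1) \<open>0 < \<delta>\<close> by (auto simp: r_def)
  obtain V :: "'b set set" and h :: "'b set \<Rightarrow> 'b \<Rightarrow> real" and p where
    V: "finite V" "\<forall>v\<in>V. continuous_on E (h v) \<and> (\<forall>y\<in>E. 0 \<le> h v y)"
      "\<forall>y\<in>E. (\<Sum>v\<in>V. h v y) = 1 \<and> card {v \<in> V. 0 < h v y} \<le> n + 1"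
      "\<forall>v\<in>V. p v \<in> E \<and> (\<forall>y\<in>E. 0 < h v y \<longrightarrow> dist (p v) y < r)"
    by (rule covering_dim_partition[OF E dim r(1)])
  obtain q where q: "inj_on q V" "q ` V \<inter> {} = {}" "\<forall>v\<in>V. dist (q v) (f (p v)) < \<epsilon> / 2" "generic_over {} (q ` V)"
    by (rule generic_over_family[OF V(1) finite.emptyI half_gt_zero[OF \<open>0 < \<epsilon>\<close>], of "\<lambda>v. f (p v)"])
  define s where "s y = {v \<in> V. 0 < h v y}" for y
  have fins: "finite (s y)" for y using V(1) by (simp add: s_def)
  have s: "v \<in> V" "dist (p v) y < r" if "y \<in> E" "v \<in> s y" for v y using that V(4) by (auto simp: s_def)
  define g where "g y = (\<Sum>v\<in>V. h v y *\<^sub>R q v)" for y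
  have gin: "g y \<in> convex hull (q ` s y)" if "y \<in> E" for y
    unfolding g_def s_def using V that by (intro nerve_sum_in_simplex) auto
  show thesis
  proof (rule that[of g]; (intro ballI impI)?)
    show "continuous_on E g" unfolding g_def using V(2) by (intro continuous_intros) blast
    show "dist (g x) (f x) < \<epsilon>" if x: "x \<in> E" for x
    proof -
      have "q v \<in> ball (f x) \<epsilon>" if v: "v \<in> s x" for v
      proof -
        have "dist (f (p v)) (f x) < \<epsilon> / 2"
          using d(2)[OF x, of "p v"] s[OF x v] V(4) r(2) by force
        moreover have "dist (q v) (f (p v)) < \<epsilon> / 2" using q(3) s[OF x v] by blast
        ultimately show ?thesis using dist_triangle[of "q v" "f x" "f (p v)"] by (simp add: dist_commute)
      qed
      then have "convex hull (q ` s x) \<subseteq> ball (f x) \<epsilon>" by (intro hull_minimal) auto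
      then show ?thesis using gin[OF x] by (auto simp: dist_commute)
    qed
    show "dist x y < \<delta>" if xy: "x \<in> E" "y \<in> E" "g x = g y" for x y
    proof -
      have c: "card (q ` s z) \<le> n + 1" if "z \<in> E" for z
      proof -
        have "card (q ` s z) \<le> card (s z)" by (rule card_image_le[OF fins])
        then show ?thesis using V(3) that unfolding s_def by force
      qed
      \<comment> \<open>Two simplices with \<open>n + 1\<close> vertices each can fill
        \<open>DIM('a) + 1\<close> exactly; this is where the dimension \<open>2 * n + 1\<close>
        enters.\<close>
      have "card (q ` s x \<union> q ` s y) \<le> card (q ` s x) + card (q ` s y)" by (rule card_Un_le)
      also have "\<dots> \<le> DIM('a) + 1" using c[OF xy(1)] c[OF xy(2)] n by simp
      finally have cc: "card (q ` s x \<union> q ` s y) \<le> DIM('a) + 1" .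
      have "q ` s x \<union> q ` s y \<subseteq> q ` V" by (auto simp: s_def)
      moreover have "g x \<in> convex hull (q ` s y)" using gin[OF xy(2)] xy(3) by simp
      ultimately have "g x \<in> convex hull (q ` s x \<inter> q ` s y)"
        by (rule generic_convex_hull_Int[OF q(4) finite_imageI[OF fins] finite_imageI[OF fins] _ cc gin[OF xy(1)]])
      then have "q ` s x \<inter> q ` s y \<noteq> {}" by auto
      then obtain v w where "v \<in> s x" "w \<in> s y" "q v = q w" by blast
      then have v: "v \<in> s x" "v \<in> s y" using inj_onD[OF q(1)] s[OF xy(1)] s[OF xy(2)] by metis+
      show ?thesis
        using s(2)[OF xy(1) v(1)] s(2)[OF xy(2) v(2)] dist_triangle3[of x y "p v"] r(3) by simp
    qed
  qed
qed

text \<open>Maps on \<open>E\<close> are represented by bounded continuous maps on the whole space,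
  which form a complete metric space. Extending the difference \<open>g - F\<close> with its norm
  bound keeps the result close to \<open>F\<close> everywhere and not only on
  \<open>E\<close>.\<close>

lemma bcontfun_extension_near:
  fixes F :: "'b::{metric_space,second_countable_topology} \<Rightarrow>\<^sub>C 'a::euclidean_space"
  assumes "compact E" "continuous_on E g" "\<forall>x\<in>E. dist (g x) (F x) \<le> \<epsilon>" "0 \<le> \<epsilon>"
  obtains F' :: "'b \<Rightarrow>\<^sub>C 'a" where "\<forall>x\<in>E. F' x = g x" "dist F' F \<le> \<epsilon>"
proof -
  have cont: "continuous_on E (\<lambda>x. g x - F x)" by (intro continuous_intros assms(2)) simp
  have cl: "closedin (top_of_set UNIV) E" using compact_imp_closed[OF assms(1)] by simp
  have bd: "norm (g x - F x) \<le> \<epsilon>" if "x \<in> E" for x using assms(3) that by (simp add: dist_norm)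
  obtain d where d: "continuous_on UNIV d" "\<And>x. x \<in> E \<Longrightarrow> d x = g x - F x" "\<And>x. x \<in> UNIV \<Longrightarrow> norm (d x) \<le> \<epsilon>"
    by (rule Tietze[OF cont cl assms(4) bd]) auto
  then have "d \<in> bcontfun" by (intro bcontfun_normI) auto
  then obtain D :: "'b \<Rightarrow>\<^sub>C 'a" where D: "d = apply_bcontfun D" by (rule bcontfunE)
  show thesis
  proof (rule that[of "F + D"])
    show "\<forall>x\<in>E. (F + D) x = g x" using d(2) D by (simp add: plus_bcontfun.rep_eq)
    show "dist (F + D) F \<le> \<epsilon>"
      using d(3) D by (intro dist_bound) (simp add: plus_bcontfun.rep_eq dist_norm)
  qed
qed

section \<open>Baire category and open conditions on maps\<close>

lemma Baire_closure:
  fixes \<G> :: "'c::complete_space set set"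
  assumes "countable \<G>" "\<And>T. T \<in> \<G> \<Longrightarrow> open T \<and> closure T = UNIV"
  shows "closure (\<Inter>\<G>) = UNIV"
  using Met_TC.metric_Baire_category[where 'a='c, of \<G>] assms complete_UNIV by simp

text \<open>The pairs at distance at least \<open>r\<close> form a compact set, on which the
  distance of the images has a positive minimum \<open>m\<close>. A perturbation below
  \<open>m / 2\<close> cannot close this gap.\<close>

lemma open_almost_injective:
  fixes E :: "'b::metric_space set"
  assumes "compact E"
  shows "open {F :: 'b \<Rightarrow>\<^sub>C 'a::real_normed_vector. \<forall>x\<in>E. \<forall>y\<in>E. r \<le> dist x y \<longrightarrow> F x \<noteq> F y}"
  unfolding open_dist
proof
  fix F :: "'b \<Rightarrow>\<^sub>C 'a" assume F: "F \<in> {F :: 'b \<Rightarrow>\<^sub>C 'a. \<forall>x\<in>E. \<forall>y\<in>E. r \<le> dist x y \<longrightarrow> F x \<noteq> F y}"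
  let ?K = "(E \<times> E) \<inter> {z. r \<le> dist (fst z) (snd z)}"
  have "closed {z :: 'b \<times> 'b. r \<le> dist (fst z) (snd z)}"
    by (intro closed_Collect_le continuous_intros)
  then have K: "compact ?K" using assms by (intro compact_Int_closed compact_Times)
  show "\<exists>e>0. \<forall>F'. dist F' F < e \<longrightarrow> F' \<in> {F :: 'b \<Rightarrow>\<^sub>C 'a. \<forall>x\<in>E. \<forall>y\<in>E. r \<le> dist x y \<longrightarrow> F x \<noteq> F y}"
  proof (cases "?K = {}")
    case True
    then have "\<not> r \<le> dist x y" if "x \<in> E" "y \<in> E" for x y using that by auto
    then show ?thesis by (intro exI[of _ 1]) auto
  next
    case False
    have "continuous_on ?K (\<lambda>z. dist (F (fst z)) (F (snd z)))"
      by (intro continuous_intros continuous_on_compose2[OF continuous_on_apply_bcontfun[of UNIV F]]) auto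
    then obtain z where z: "z \<in> ?K" "\<forall>w\<in>?K. dist (F (fst z)) (F (snd z)) \<le> dist (F (fst w)) (F (snd w))"
      using continuous_attains_inf[OF K False] by blast
    define m where "m = dist (F (fst z)) (F (snd z))"
    have "m > 0" using F z(1) by (auto simp: m_def)
    have "F' x \<noteq> F' y" if F': "dist F' F < m / 2" and xy: "x \<in> E" "y \<in> E" "r \<le> dist x y" for F' x y
    proof
      assume eq: "F' x = F' y"
      have "m \<le> dist (F x) (F y)" using z(2) xy by (force simp: m_def)
      also have "\<dots> \<le> dist (F' x) (F x) + dist (F' y) (F y)"
        using dist_triangle3[of "F x" "F y" "F' x"] eq by simp
      also have "\<dots> < m" using dist_bounded[of F' x F] dist_bounded[of F' y F] F' by linarith
      finally show False by simp
    qed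
    then show ?thesis using \<open>m > 0\<close> by (intro exI[of _ "m / 2"]) auto
  qed
qed

lemma infdist_image_near:
  assumes "A \<noteq> {}" "\<And>x. x \<in> A \<Longrightarrow> dist (f x) (g x) \<le> r"
  shows "infdist z (f ` A) \<le> infdist z (g ` A) + r"
proof -
  have "infdist z (f ` A) - r \<le> dist z (g x)" if "x \<in> A" for x
    using infdist_le[of "f x" "f ` A" z] dist_triangle[of z "f x" "g x"] assms(2)[OF that] that
    by (simp add: dist_commute)
  then have "infdist z (f ` A) - r \<le> infdist z (g ` A)"
    unfolding infdist_notempty[of "g ` A"] infdist_def using assms(1)
    by (auto intro!: cINF_greatest)
  then show ?thesis by simp
qed

text \<open>The same homeomorphism serves all nearby maps: the image has a margin inside the open
  ball, and by compactness the closed ball has one inside the neighbourhood, which itself moves with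
  the map.\<close>

lemma open_engulfed_image:
  fixes E :: "'b::metric_space set"
  assumes "compact E" "E \<noteq> {}"
  shows "open {F :: 'b \<Rightarrow>\<^sub>C 'a::euclidean_space. engulfed {x. infdist x (F ` E) < r} (F ` E)}"
  unfolding open_dist
proof
  fix F :: "'b \<Rightarrow>\<^sub>C 'a" assume "F \<in> {F :: 'b \<Rightarrow>\<^sub>C 'a. engulfed {x. infdist x (F ` E) < r} (F ` E)}"
  then obtain h g :: "'a \<Rightarrow> 'a" where h: "homeomorphism UNIV UNIV h g" "F ` E \<subseteq> h ` ball 0 1"
    "h ` cball 0 1 \<subseteq> {x. infdist x (F ` E) < r}" unfolding engulfed_def by blast
  have "open (h ` ball 0 1)" using homeomorphism_imp_open_map[OF h(1), of "ball 0 1"] by simp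
  moreover have "compact (F ` E)" by (intro compact_continuous_image assms(1)) simp
  ultimately obtain d where d: "d > 0" "{x. infdist x (F ` E) \<le> d} \<subseteq> h ` ball 0 1"
    using compact_in_open_separated[of "F ` E"] h(2) assms(2) by blast
  have ch: "continuous_on (cball 0 1) h"
    using h(1) continuous_on_subset unfolding homeomorphism_def by blast
  have "compact (h ` cball 0 1)" by (intro compact_continuous_image ch) simp
  moreover have "h ` cball 0 1 \<noteq> {}" by simp
  moreover have "continuous_on (h ` cball 0 1) (\<lambda>x. infdist x (F ` E))" by (intro continuous_intros)
  ultimately obtain z where z: "z \<in> h ` cball 0 1" "\<forall>x\<in>h ` cball 0 1. infdist x (F ` E) \<le> infdist z (F ` E)"
    using continuous_attains_sup by blast
  define e where "e = min d ((r - infdist z (F ` E)) / 2)"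
  have e: "0 < e" "e \<le> d" "infdist z (F ` E) + e < r"
    using d(1) z(1) h(3) by (auto simp: e_def min_def field_simps)
  show "\<exists>e>0. \<forall>F'. dist F' F < e \<longrightarrow> F' \<in> {F :: 'b \<Rightarrow>\<^sub>C 'a. engulfed {x. infdist x (F ` E) < r} (F ` E)}"
  proof (intro exI[of _ e] conjI allI impI e(1))
    fix F' :: "'b \<Rightarrow>\<^sub>C 'a" assume F': "dist F' F < e"
    have dst: "dist (F' x) (F x) \<le> e" for x using dist_bounded[of F' x F] F' by linarith
    have "F' ` E \<subseteq> h ` ball 0 1"
    proof
      fix y assume "y \<in> F' ` E"
      then obtain x where x: "x \<in> E" "y = F' x" by blast
      have "infdist y (F ` E) \<le> dist y (F x)" by (rule infdist_le) (use x in auto)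
      also have "\<dots> \<le> d" using dst[of x] e(2) x(2) by simp
      finally show "y \<in> h ` ball 0 1" using d(2) by blast
    qed
    moreover have "h ` cball 0 1 \<subseteq> {x. infdist x (F' ` E) < r}"
    proof
      fix x assume "x \<in> h ` cball 0 1"
      then have "infdist x (F ` E) \<le> infdist z (F ` E)" using z(2) by blast
      moreover have "infdist x (F' ` E) \<le> infdist x (F ` E) + e"
        using dst by (intro infdist_image_near[OF assms(2)]) auto
      ultimately show "x \<in> {x. infdist x (F' ` E) < r}" using e(3) by simp
    qed
    ultimately have "engulfed {x. infdist x (F' ` E) < r} (F' ` E)"
      unfolding engulfed_def using h(1) by (intro exI conjI)
    then show "F' \<in> {F :: 'b \<Rightarrow>\<^sub>C 'a. engulfed {x. infdist x (F ` E) < r} (F ` E)}" by simp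
  qed
qed

section \<open>Cellular embeddings\<close>

lemma Hilbert_cube_eq: "Hilbert_cube = top_of_set {x. \<forall>i. x i \<in> {0..1}}"
proof -
  have "Hilbert_cube = subtopology (product_topology (\<lambda>_. euclidean) UNIV) (PiE UNIV (\<lambda>_. {0..1}))"
    unfolding Hilbert_cube_def by (rule subtopology_product_topology[symmetric])
  also have "PiE UNIV (\<lambda>_. {0..1}) = {x :: nat \<Rightarrow> real. \<forall>i. x i \<in> {0..1}}" by (auto simp: PiE_def)
  finally show ?thesis by (simp add: euclidean_product_topology)
qed

lemma homotopic_imp_contracts_in:
  fixes V U :: "'a::topological_space set"
  assumes "homotopic_with_canon (\<lambda>_. True) V U (\<lambda>x. x) (\<lambda>x. c)"
  shows "contracts_in V U"
proof -
  obtain h :: "real \<times> 'a \<Rightarrow> 'a"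
    where h: "continuous_map (prod_topology (top_of_set {0..1}) (top_of_set V)) (top_of_set U) h"
      "\<forall>x. h (0, x) = x" "\<forall>x. h (1, x) = c"
    using assms unfolding homotopic_with_def by (elim exE conjE)
  then have "continuous_on ({0..1} \<times> V) h" "h ` ({0..1} \<times> V) \<subseteq> U"
    by (auto simp: prod_topology_subtopology_eu)
  then show ?thesis using h(2,3) unfolding contracts_in_def by blast
qed

text \<open>The contraction in the Hilbert cube is transported by Tietze extensions of the homeomorphism and of its
  inverse, preceded by a straight-line homotopy in a small neighbourhood of the image.\<close>

lemma cell_like_in_imp_shape_trivial:
  fixes f :: "(nat \<Rightarrow> real) \<Rightarrow> 'a::euclidean_space"
  assumes cell: "cell_like_in Hilbert_cube E" and E: "compact E" "E \<subseteq> topspace Hilbert_cube" "E \<noteq> {}"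
    and f: "continuous_on E f" "inj_on f E"
  shows "shape_trivial (f ` E)"
  unfolding shape_trivial_def
proof (intro allI impI)
  fix W :: "'a set" assume W: "open W \<and> f ` E \<subseteq> W"
  define Q where "Q = {x :: nat \<Rightarrow> real. \<forall>i. x i \<in> {0..1}}"
  have HQ: "Hilbert_cube = top_of_set Q" unfolding Q_def by (rule Hilbert_cube_eq)
  have EQ: "E \<subseteq> Q" using E(2) unfolding HQ topspace_euclidean_subtopology .
  have cE: "closedin (top_of_set UNIV) E" using compact_imp_closed[OF E(1)] by simp
  have Y: "compact (f ` E)" "f ` E \<noteq> {}" using compact_continuous_image[OF f(1) E(1)] E(3) by auto
  have cY: "closedin (top_of_set UNIV) (f ` E)" using compact_imp_closed[OF Y(1)] by simp
  obtain \<Psi> where \<Psi>: "continuous_on UNIV \<Psi>" "\<And>x. x \<in> E \<Longrightarrow> \<Psi> x = f x"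
    by (rule Tietze_unbounded[OF f(1) cE]) auto
  define g where "g = inv_into E f"
  have gf: "g (f x) = x" if "x \<in> E" for x unfolding g_def using f(2) that by simp
  have contg: "continuous_on (f ` E) g"
    by (rule continuous_on_inv[OF f(1) E(1)]) (use gf in blast)
  \<comment> \<open>The inverse is extended one coordinate at a time with values in the unit
    interval, so that the extension maps into the cube.\<close>
  have "\<exists>k. continuous_on UNIV k \<and> (\<forall>y\<in>f ` E. k y = g y i) \<and> (\<forall>y. k y \<in> {0..1::real})" for i
  proof -
    have c: "continuous_on (f ` E) (\<lambda>y. g y i)"
      by (rule continuous_on_product_then_coordinatewise[OF contg])
    have "g y i \<in> cbox 0 1" if "y \<in> f ` E" for y
      using that EQ gf by (auto simp: Q_def)
    from Tietze_closed_interval_1[OF c cY zero_le_one this] obtain k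
      where "continuous_on UNIV k" "\<And>y. y \<in> f ` E \<Longrightarrow> k y = g y i" "\<And>y. y \<in> UNIV \<Longrightarrow> k y \<in> cbox 0 1"
      by metis
    then show ?thesis by (intro exI[of _ k]) auto
  qed
  then obtain \<phi> where \<phi>: "\<And>i. continuous_on UNIV (\<phi> i)" "\<And>i y. y \<in> f ` E \<Longrightarrow> \<phi> i y = g y i"
    "\<And>i y. \<phi> i y \<in> {0..1::real}" by metis
  define \<Phi> where "\<Phi> y i = \<phi> i y" for y i
  have cont\<Phi>: "continuous_on UNIV \<Phi>"
    unfolding \<Phi>_def by (intro continuous_on_coordinatewise_then_product \<phi>(1))
  have \<Phi>Q: "\<Phi> y \<in> Q" for y using \<phi>(3) by (simp add: \<Phi>_def Q_def)
  have \<Phi>f: "\<Phi> (f x) = x" if "x \<in> E" for x using \<phi>(2) gf that by (auto simp: \<Phi>_def)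
  define UQ where "UQ = Q \<inter> \<Psi> -` W"
  have "openin (top_of_set Q) UQ"
    unfolding UQ_def
    by (rule continuous_openin_preimage_gen[OF continuous_on_subset[OF \<Psi>(1)]]) (use W in auto)
  moreover have "E \<subseteq> UQ" using EQ W \<Psi>(2) by (auto simp: UQ_def)
  ultimately have "neighborhood_in Hilbert_cube E UQ"
    unfolding neighborhood_in_def HQ by (intro conjI exI[of _ UQ]) (auto simp: UQ_def)
  then obtain V c where V: "neighborhood_in Hilbert_cube E V" "V \<subseteq> UQ" "c \<in> UQ"
    "homotopic_with (\<lambda>_. True) (subtopology Hilbert_cube V) (subtopology Hilbert_cube UQ) (\<lambda>x. x) (\<lambda>x. c)"
    using cell unfolding cell_like_in_def by blast
  have "Q \<inter> V = V" "Q \<inter> UQ = UQ" using V(2) by (auto simp: UQ_def)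
  then have hom: "homotopic_with_canon (\<lambda>_. True) V UQ (\<lambda>x. x) (\<lambda>x. c)"
    using V(4) unfolding HQ subtopology_subtopology by simp
  obtain O' where O': "open O'" "E \<subseteq> O'" "Q \<inter> O' \<subseteq> V"
  proof -
    obtain V' where "openin (top_of_set Q) V'" "E \<subseteq> V'" "V' \<subseteq> V"
      using V(1) unfolding neighborhood_in_def HQ by blast
    then show thesis using that unfolding openin_open by blast
  qed
  obtain d where d: "d > 0" "{x. infdist x (f ` E) \<le> d} \<subseteq> W"
    using compact_in_open_separated[OF Y(2,1)] W by blast
  have cont\<Psi>\<Phi>: "continuous_on UNIV (\<lambda>y. \<Psi> (\<Phi> y))"
    by (rule continuous_on_compose2[OF \<Psi>(1) cont\<Phi>]) simp
  \<comment> \<open>The first condition sends \<open>U\<close> into \<open>V\<close>, where the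
    contraction is available. The other two make the segment from \<open>y\<close> to
    \<open>\<Psi> (\<Phi> y)\<close> short and start it near the image of \<open>E\<close>;
    \<open>d / 2 + d / 2\<close> keeps it in \<open>W\<close>.\<close>
  define U where "U = \<Phi> -` O' \<inter> {y. dist y (\<Psi> (\<Phi> y)) < d / 2} \<inter> {y. infdist y (f ` E) < d / 2}"
  have "open U" unfolding U_def
    by (intro open_Int open_Collect_less open_vimage O'(1) cont\<Phi> continuous_intros cont\<Psi>\<Phi>)
  moreover have "f ` E \<subseteq> U"
    using O'(2) \<Phi>f \<Psi>(2) d(1) by (auto simp: U_def)
  moreover have "U \<subseteq> W" using d by (auto simp: U_def)
  moreover have "contracts_in U W"
  proof (rule homotopic_imp_contracts_in)
    have 1: "homotopic_with_canon (\<lambda>_. True) U W (\<lambda>x. x) (\<lambda>y. \<Psi> (\<Phi> y))"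
    proof (rule homotopic_with_linear)
      show "continuous_on U (\<lambda>y. \<Psi> (\<Phi> y))" by (rule continuous_on_subset[OF cont\<Psi>\<Phi>]) simp
      show "closed_segment y (\<Psi> (\<Phi> y)) \<subseteq> W" if y: "y \<in> U" for y
      proof
        fix x assume "x \<in> closed_segment y (\<Psi> (\<Phi> y))"
        moreover have "closed_segment y (\<Psi> (\<Phi> y)) \<subseteq> ball y (d / 2)"
          using y d(1) by (intro closed_segment_subset) (auto simp: U_def)
        ultimately have "dist x y < d / 2" by (auto simp: dist_commute)
        then have "infdist x (f ` E) \<le> d"
          using infdist_triangle[of x "f ` E" y] y by (auto simp: U_def)
        then show "x \<in> W" using d(2) by blast
      qed
    qed (rule continuous_on_id)
    have 2: "homotopic_with_canon (\<lambda>_. True) V W (\<Psi> \<circ> (\<lambda>x. x)) (\<Psi> \<circ> (\<lambda>x. c))"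
    proof (rule homotopic_with_compose_continuous_left[OF hom])
      show "continuous_on UQ \<Psi>" by (rule continuous_on_subset[OF \<Psi>(1)]) simp
    qed (auto simp: UQ_def)
    have "homotopic_with_canon (\<lambda>_. True) U W ((\<Psi> \<circ> (\<lambda>x. x)) \<circ> \<Phi>) ((\<Psi> \<circ> (\<lambda>x. c)) \<circ> \<Phi>)"
    proof (rule homotopic_with_compose_continuous_right[OF 2])
      show "continuous_on U \<Phi>" by (rule continuous_on_subset[OF cont\<Phi>]) simp
      show "\<Phi> \<in> U \<rightarrow> V" using O'(3) \<Phi>Q by (auto simp: U_def)
    qed
    then have "homotopic_with_canon (\<lambda>_. True) U W (\<lambda>y. \<Psi> (\<Phi> y)) (\<lambda>_. \<Psi> c)" by (simp add: comp_def)
    with 1 show "homotopic_with_canon (\<lambda>_. True) U W (\<lambda>x. x) (\<lambda>_. \<Psi> c)" by (rule homotopic_with_trans)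
  qed
  ultimately show "\<exists>U. open U \<and> f ` E \<subseteq> U \<and> U \<subseteq> W \<and> contracts_in U W" by blast
qed

lemma engulfed_imp_cell:
  fixes Y :: "'a::euclidean_space set"
  assumes "engulfed W Y"
  obtains D where "D homeomorphic cbox (0::'a) One" "Y \<subseteq> interior D" "D \<subseteq> W"
proof -
  obtain h g :: "'a \<Rightarrow> 'a" where h: "homeomorphism UNIV UNIV h g" "Y \<subseteq> h ` ball 0 1" "h ` cball 0 1 \<subseteq> W"
    using assms unfolding engulfed_def by blast
  have "homeomorphism (cball 0 1) (h ` cball 0 1) h g"
    by (rule homeomorphism_of_subsets[OF h(1)]) auto
  then have "h ` cball 0 1 homeomorphic cball (0::'a) 1"
    using homeomorphic_sym homeomorphic_def by blast
  moreover have "cball (0::'a) 1 homeomorphic cbox (0::'a) One"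
  proof (rule homeomorphic_convex_compact)
    have "box (0::'a) One \<noteq> {}" by (simp add: box_ne_empty inner_Basis)
    then show "interior (cbox (0::'a) One) \<noteq> {}" by (simp add: interior_cbox)
  qed auto
  ultimately have "h ` cball 0 1 homeomorphic cbox (0::'a) One" by (rule homeomorphic_trans)
  moreover have "h ` ball 0 1 \<subseteq> interior (h ` cball 0 1)"
    using homeomorphism_imp_open_map[OF h(1), of "ball 0 1"]
    by (intro interior_maximal image_mono ball_subset_cball) simp
  ultimately show thesis using that h(2,3) by blast
qed

text \<open>The balls provided by \<open>eng\<close> are unrelated to each other. Each next one is
  taken in a neighbourhood thin enough to lie in the interior of its predecessor, and with radii
  tending to zero.\<close>

lemma engulfed_imp_cellular:
  fixes Y :: "'a::euclidean_space set"
  assumes Y: "compact Y" "Y \<noteq> {}" and eng: "\<And>k :: nat. engulfed {x. infdist x Y < 1 / Suc k} Y"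
  shows "cellular Y"
proof -
  have "\<exists>D. \<forall>k :: nat. (D k homeomorphic cbox (0::'a) One \<and> Y \<subseteq> interior (D k) \<and> D k \<subseteq> {x. infdist x Y < 1 / Suc k})
      \<and> D (Suc k) \<subseteq> interior (D k)"
  proof (rule dependent_nat_choice)
    show "\<exists>D. D homeomorphic cbox (0::'a) One \<and> Y \<subseteq> interior D \<and> D \<subseteq> {x. infdist x Y < 1 / Suc 0}"
      using engulfed_imp_cell[OF eng[of 0]] by metis
  next
    fix D and k :: nat
    assume D: "D homeomorphic cbox (0::'a) One \<and> Y \<subseteq> interior D \<and> D \<subseteq> {x. infdist x Y < 1 / Suc k}"
    then obtain e where e: "e > 0" "{x. infdist x Y \<le> e} \<subseteq> interior D"
      using compact_in_open_separated[OF Y(2,1) open_interior] by blast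
    obtain j where j: "1 / Suc j < e" using nat_approx_posE[OF e(1)] by auto
    define l where "l = max j (Suc k)"
    have l: "1 / real (Suc l) \<le> 1 / real (Suc j)" "1 / real (Suc l) \<le> 1 / real (Suc (Suc k))"
      by (auto simp: l_def intro!: divide_left_mono)
    obtain D' where D': "D' homeomorphic cbox (0::'a) One" "Y \<subseteq> interior D'" "D' \<subseteq> {x. infdist x Y < 1 / Suc l}"
      using engulfed_imp_cell[OF eng[of l]] by metis
    have "D' \<subseteq> interior D" using D'(3) e(2) l(1) j by force
    moreover have "D' \<subseteq> {x. infdist x Y < 1 / Suc (Suc k)}" using D'(3) l(2) by force
    ultimately show "\<exists>D'. (D' homeomorphic cbox (0::'a) One \<and> Y \<subseteq> interior D' \<and> D' \<subseteq> {x. infdist x Y < 1 / Suc (Suc k)}) \<and> D' \<subseteq> interior D"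
      using D' by blast
  qed
  then obtain D where D: "\<And>k :: nat. D k homeomorphic cbox (0::'a) One" "\<And>k. Y \<subseteq> interior (D k)"
    "\<And>k. D k \<subseteq> {x. infdist x Y < 1 / Suc k}" "\<And>k. D (Suc k) \<subseteq> interior (D k)" by blast
  have "(\<Inter>k. D k) \<subseteq> Y"
  proof
    fix x assume x: "x \<in> (\<Inter>k. D k)"
    have "infdist x Y \<le> 0"
    proof (rule field_le_epsilon)
      fix e :: real assume "0 < e"
      then obtain j where "1 / Suc j < e" using nat_approx_posE by blast
      moreover have "infdist x Y < 1 / Suc j" using x D(3) by blast
      ultimately show "infdist x Y \<le> 0 + e" by simp
    qed
    then have "infdist x Y = 0" using infdist_nonneg[of x Y] by simp
    then show "x \<in> Y" using in_closed_iff_infdist_zero[OF compact_imp_closed[OF Y(1)] Y(2)] by blast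
  qed
  moreover have "Y \<subseteq> (\<Inter>k. D k)" using D(2) interior_subset by blast
  ultimately show ?thesis unfolding cellular_def using D by (intro exI[of _ D]) auto
qed

theorem theorem1p4:
  fixes X :: "'a topology" and n :: nat
  assumes "compact_space X"
    and "metrizable_space X"
    and "has_covering_dim X (int n)"
    and "cell_like_space X"
    and "CARD('m::finite) = 2 * n + 1"
  shows "\<exists>e :: 'a \<Rightarrow> real ^ 'm.
           embedding_map X euclidean e \<and> cellular (e ` topspace X)"
proof -
  obtain i where i: "embedding_map X Hilbert_cube i" "cell_like_in Hilbert_cube (i ` topspace X)"
    using assms(4) unfolding cell_like_space_def by blast
  define E where "E = i ` topspace X"
  have conti: "continuous_map X Hilbert_cube i"
    using homeomorphic_imp_continuous_map[OF i(1)[unfolded embedding_map_def]]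
    by (simp add: continuous_map_in_subtopology)
  have EH: "E \<subseteq> topspace Hilbert_cube"
    unfolding E_def by (rule continuous_map_image_subset_topspace[OF conti])
  have HE: "subtopology Hilbert_cube E = top_of_set E"
    using EH by (simp add: Hilbert_cube_eq subtopology_subtopology Int_absorb1)
  have homi: "homeomorphic_map X (top_of_set E) i"
    using i(1) unfolding embedding_map_def HE[symmetric] by (simp add: E_def)
  have "compactin Hilbert_cube E"
    unfolding E_def using assms(1) by (intro image_compactin[OF _ conti]) (simp add: compact_space_def)
  then have cE: "compact E"
    using HE EH by (simp add: compactin_subspace compact_space_subtopology flip: compactin_euclidean_iff)
  have dimE: "covering_dim_le (top_of_set E) (int n)"
    using homeomorphic_map_covering_dim_le[OF homi] assms(3) unfolding has_covering_dim_def by blast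
  have cell: "cell_like_in Hilbert_cube E" using i(2) by (simp add: E_def)
  \<comment> \<open>The empty set is a neighbourhood of itself, but contains no point
    \<open>c\<close> to contract to.\<close>
  have nE: "E \<noteq> {}"
  proof
    assume "E = {}"
    then have "neighborhood_in Hilbert_cube E {}" by (auto simp: neighborhood_in_def)
    then show False using cell unfolding cell_like_in_def by blast
  qed
  have dim: "DIM(real ^ 'm) = 2 * n + 1" using assms(5) by simp
  define G where "G k = {F :: (nat \<Rightarrow> real) \<Rightarrow>\<^sub>C (real ^ 'm).
      \<forall>x\<in>E. \<forall>y\<in>E. 1 / real (Suc k) \<le> dist x y \<longrightarrow> F x \<noteq> F y}" for k :: nat
  define B where "B k = {F :: (nat \<Rightarrow> real) \<Rightarrow>\<^sub>C (real ^ 'm). engulfed {x. infdist x (F ` E) < 1 / real (Suc k)} (F ` E)}" for k :: nat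
  have openG: "open (G k)" for k unfolding G_def by (rule open_almost_injective[OF cE])
  have openB: "open (B k)" for k unfolding B_def by (rule open_engulfed_image[OF cE nE])
  have denseG: "closure (G k) = UNIV" for k
  proof -
    have "F \<in> closure (G k)" for F
      unfolding closure_approachable
    proof (intro allI impI)
      fix e :: real assume "0 < e"
      obtain g where g: "continuous_on E g" "\<forall>x\<in>E. dist (g x) (F x) < e / 2"
        "\<forall>x\<in>E. \<forall>y\<in>E. g x = g y \<longrightarrow> dist x y < 1 / real (Suc k)"
        by (rule almost_injective_approximation[OF cE nE dimE dim, of F "e / 2" "1 / real (Suc k)"]) (use \<open>0 < e\<close> in auto)
      obtain F' where F': "\<forall>x\<in>E. apply_bcontfun F' x = g x" "dist F' F \<le> e / 2"
        by (rule bcontfun_extension_near[OF cE g(1), of F "e / 2"]) (use g(2) \<open>0 < e\<close> in \<open>auto intro: less_imp_le\<close>)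
      have "F' \<in> G k" unfolding G_def using F'(1) g(3) by force
      then show "\<exists>F'\<in>G k. dist F' F < e" using F'(2) \<open>0 < e\<close> by (intro bexI[of _ F']) auto
    qed
    then show ?thesis by blast
  qed
  have inj: "inj_on F E" if "\<And>k. F \<in> G k" for F
  proof (rule inj_onI, rule ccontr)
    fix x y assume xy: "x \<in> E" "y \<in> E" "F x = F y" "x \<noteq> y"
    then obtain k where "1 / real (Suc k) < dist x y" using nat_approx_posE[of "dist x y"] by auto
    then show False using that[of k] xy unfolding G_def by force
  qed
  have contF: "continuous_on E (apply_bcontfun F)" for F :: "(nat \<Rightarrow> real) \<Rightarrow>\<^sub>C (real ^ 'm)" by simp
  have denseB: "closure (B k) = UNIV" for k
  proof -
    have "F \<in> closure (B k)" for F
      unfolding closure_approachable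
    proof (intro allI impI)
      fix e :: real assume "0 < e"
      \<comment> \<open>Engulfing perturbations are available for embedded copies of the space. So
        \<open>F\<close> is first moved to a nearby \<open>F1\<close> that is injective on
        \<open>E\<close>, found by category, and only then perturbed along its image.\<close>
      have "closure (\<Inter>(range G)) = UNIV"
        using openG denseG by (intro Baire_closure) auto
      then have "F \<in> closure (\<Inter>(range G))" by simp
      then obtain F1 where F1: "F1 \<in> \<Inter>(range G)" "dist F1 F < e / 2"
        unfolding closure_approachable using half_gt_zero[OF \<open>0 < e\<close>] by blast
      have injF1: "inj_on F1 E" using F1(1) by (intro inj) blast
      define Y where "Y = F1 ` E"
      have Y: "compact Y" "Y \<noteq> {}"
        using compact_continuous_image[OF contF cE] nE by (auto simp: Y_def)
      have dimY: "covering_dim_le (top_of_set Y) (int n)"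
        unfolding Y_def
        by (rule homeomorphic_map_covering_dim_le[OF homeomorphic_map_compact_image[OF cE contF injF1] dimE])
      have shape: "shape_trivial Y"
        unfolding Y_def by (rule cell_like_in_imp_shape_trivial[OF cell cE EH nE contF injF1])
      \<comment> \<open>\<open>r \<le> e / 4\<close> leaves room beside the first approximation by
        \<open>e / 2\<close>. Replacing the neighbourhood of \<open>Y\<close> by that of its
        perturbed image costs another \<open>r\<close>, hence the bound on
        \<open>2 * r\<close>.\<close>
      define r where "r = min (e / 4) (1 / (2 * real (Suc k)))"
      have r: "0 < r" "r \<le> e / 4" "2 * r \<le> 1 / real (Suc k)"
        using \<open>0 < e\<close> by (auto simp: r_def min_def field_simps)
      obtain \<kappa> where \<kappa>: "continuous_on Y \<kappa>" "\<forall>y\<in>Y. dist (\<kappa> y) y < r"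
        "engulfed {x. infdist x Y < r} (\<kappa> ` Y)"
        by (rule engulfed_approximation[OF Y dimY dim shape r(1)])
      have "continuous_on E (\<lambda>x. \<kappa> (F1 x))"
        by (rule continuous_on_compose2[OF \<kappa>(1) contF]) (simp add: Y_def)
      moreover have "\<forall>x\<in>E. dist (\<kappa> (F1 x)) (F1 x) \<le> r" using \<kappa>(2) by (auto simp: Y_def intro: less_imp_le)
      ultimately obtain F' where F': "\<forall>x\<in>E. apply_bcontfun F' x = \<kappa> (F1 x)" "dist F' F1 \<le> r"
        using bcontfun_extension_near[OF cE _ _ less_imp_le[OF r(1)]] by blast
      have im: "F' ` E = \<kappa> ` Y" using F'(1) by (force simp: Y_def)
      have "{x. infdist x Y < r} \<subseteq> {x. infdist x (\<kappa> ` Y) < 1 / real (Suc k)}"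
      proof
        fix x assume "x \<in> {x. infdist x Y < r}"
        moreover have "infdist x (\<kappa> ` Y) \<le> infdist x ((\<lambda>y. y) ` Y) + r"
          using \<kappa>(2) by (intro infdist_image_near[OF Y(2)]) (auto intro: less_imp_le)
        ultimately show "x \<in> {x. infdist x (\<kappa> ` Y) < 1 / real (Suc k)}" using r(3) by simp
      qed
      then have "engulfed {x. infdist x (\<kappa> ` Y) < 1 / real (Suc k)} (\<kappa> ` Y)"
        by (rule engulfed_superset[OF \<kappa>(3)])
      then have "F' \<in> B k" unfolding B_def im[symmetric] by simp
      moreover have "dist F' F < e"
        using dist_triangle[of F' F F1] F'(2) F1(2) r(2) \<open>0 < e\<close> by linarith
      ultimately show "\<exists>F'\<in>B k. dist F' F < e" by blast
    qed
    then show ?thesis by blast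
  qed
  have "closure (\<Inter>(range G \<union> range B)) = UNIV"
    using openG denseG openB denseB by (intro Baire_closure) auto
  then have "\<Inter>(range G \<union> range B) \<noteq> {}" by auto
  then obtain F where "F \<in> \<Inter>(range G \<union> range B)" unfolding ex_in_conv[symmetric] by (elim exE)
  then have F: "F \<in> G k" "F \<in> B k" for k by blast+
  have injF: "inj_on F E" using F(1) by (rule inj)
  have homF: "homeomorphic_map (top_of_set E) (top_of_set (F ` E)) F"
    by (rule homeomorphic_map_compact_image[OF cE contF injF])
  have "homeomorphic_map X (top_of_set (F ` E)) (F \<circ> i)"
    by (rule homeomorphic_map_compose[OF homi homF])
  then have "embedding_map X euclidean (F \<circ> i)"
    unfolding embedding_map_def E_def by (simp add: image_comp)
  moreover have "cellular (F ` E)"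
  proof (rule engulfed_imp_cellular)
    show "compact (F ` E)" by (rule compact_continuous_image[OF contF cE])
    show "F ` E \<noteq> {}" using nE by simp
    show "engulfed {x. infdist x (F ` E) < 1 / real (Suc k)} (F ` E)" for k using F(2)[of k] by (simp add: B_def)
  qed
  then have "cellular ((F \<circ> i) ` topspace X)" by (simp add: E_def image_comp)
  ultimately show ?thesis by blast
qed

end
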